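(* Let $\mathcal F$ be a pro-saturated fusion system on a pro-$p$ group $S$. Then $\mathcal F\cong\varprojlim_{N}\mathcal F/N$, where $N$ runs through all open strongly $\mathcal F$-closed subgroups of $S$, ordered by inclusion.
   Context: Fix a prime $p$. All subgroups of profinite groups are closed and all homomorphisms are continuous. Fusion systems. A fusion system on a finite $p$-group $S$ is a category $\mathcal F$ whose objects are all subgroups of $S$ and whose morphisms are injective group homomorphisms, such that (a) $\mathcal F$ contains every homomorphism between subgroups induced by conjugation by an element of $S$; (b) every morphism of $\mathcal F$ factors as an isomorphism in $\mathcal F$ followed by an inclusion. A morphism from a fusion system $\mathcal F$ on $S$ to a fusion system $\mathcal G$ on $T$ is a group homomorphism $\alpha:S\to T$ for which there is a (necessarily unique) functor $A:\mathcal F\to\mathcal G$ with $A(P)=\alpha(P)$ for all $P\le S$ and $\alpha\varphi=A(\varphi)\alpha$ (on $P$) for all $\varphi\in\mathrm{Hom}_{\mathcal F}(P,Q)$. Pro-fusion systems. Given an inverse system of fusion systems $\mathcal F_i$ on finite $p$-groups $S_i$, indexed by a directed set $I$, with morphisms of fusion systems $(f_{i,j},F_{i,j}):\mathcal F_j\to\mathcal F_i$ for $j\ge i$ satisfying $f_{i,j}f_{j,k}=f_{i,k}$, put $S=\varprojlim_i S_i$ with projections $f_i:S\to S_i$. The pro-fusion system $\mathcal F=\varprojlim_i\mathcal F_i$ on the pro-$p$ group $S$ is the category whose objects are the closed subgroups of $S$ and with $\mathrm{Hom}_{\mathcal F}(P,Q)=\varprojlim_i\mathrm{Hom}_{\mathcal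 F_i}(f_i(P),f_i(Q))$, whose elements are regarded as homomorphisms $P\to Q$. Morphisms and isomorphisms of pro-fusion systems are defined by the same conditions as for fusion systems. Saturation of a fusion system $\mathcal F$ on a finite $p$-group $S$. Let $\mathrm{Aut}_S(Q)$ be the image of $N_S(Q)$ in $\mathrm{Aut}_{\mathcal F}(Q)$. For an isomorphism $\varphi:R\to Q$ in $\mathcal F$ let $N_\varphi=\{x\in N_S(R)\mid \exists y\in N_S(Q):\ \varphi(xux^{-1})=y\varphi(u)y^{-1}\ \forall u\in R\}$. $Q$ is receptive if for all $R\le S$ and all isomorphisms $\varphi:R\to Q$ in $\mathcal F$ there is a morphism $\tilde\varphi:N_\varphi\to N_S(Q)$ in $\mathcal F$ with $\tilde\varphi|_R=\varphi$. $Q$ is fully normalized if it is receptive and $\mathrm{Aut}_S(Q)$ is a Sylow $p$-subgroup of $\mathrm{Aut}_{\mathcal F}(Q)$. $\mathcal F$ is saturated if every $\mathcal F$-isomorphism class of subgroups of $S$ contains a fully normalized subgroup. A pro-fusion system is pro-saturated if it is isomorphic to an inverse limit of saturated fusion systems on finite $p$-groups. Quotients. $N\le S$ is strongly $\mathcal F$-closed if for all $\varphi\in\mathrm{Hom}_{\mathcal F}(R,S)$, $R\le N$ implies $\varphi(R)\le N$. For $N$ open and strongly $\mathcal F$-closed, $\mathcal F/N$ is the fusion system on $S/N$ in which a homomorphism $\varphi:PN/N\to S/N$ is a morphism if and only if there is $\tilde\varphi\in\mathrm{Hom}_{\mathcal F}(PN,S)$ with $\varphi(uN)=\tilde\varphi(u)N$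 for all $u\in P$. For $M\le N$ the transition morphism $\mathcal F/M\to\mathcal F/N$ is induced by the natural map $S/M\to S/N$. *)

theory Defs
  imports
    "HOL-Algebra.Group_Action"
    "HOL-Algebra.Product_Groups"
    "HOL-Analysis.Function_Topology"
    "HOL-Computational_Algebra.Primes"
begin

section \<open>Categories of closed subgroups\<close>

text \<open>
  The underlying data of a (pro-)fusion system. Finite \<open>p\<close>-groups carry the discrete topology, so
  fusion systems on finite \<open>p\<close>-groups and pro-fusion systems share this type, and their
  morphisms are the same notion. A morphism from \<open>P\<close> to \<open>Q\<close> is a function that is
  \<^const>\<open>extensional\<close> on \<open>P\<close>; \<open>fhom F P Q\<close> is meaningful only if \<open>P\<close> and \<open>Q\<close> are objects.
\<close>

record 'a fusion_data =
  fgrp :: "'a monoid"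
  ftop :: "'a topology"
  fhom :: "'a set \<Rightarrow> 'a set \<Rightarrow> ('a \<Rightarrow> 'a) set"

definition objs :: "'a fusion_data \<Rightarrow> 'a set set" where
  "objs F = {P. subgroup P (fgrp F) \<and> closedin (ftop F) P}"

locale fusion_category = group "fgrp F" for F :: "'a fusion_data" +
  assumes topspace_eq: "topspace (ftop F) = carrier (fgrp F)"
    and fhom_hom: "\<lbrakk>P \<in> objs F; Q \<in> objs F; \<phi> \<in> fhom F P Q\<rbrakk> \<Longrightarrow>
      \<phi> \<in> hom ((fgrp F)\<lparr>carrier := P\<rparr>) ((fgrp F)\<lparr>carrier := Q\<rparr>)"
    and fhom_inj: "\<lbrakk>P \<in> objs F; Q \<in> objs F; \<phi> \<in> fhom F P Q\<rbrakk> \<Longrightarrow> inj_on \<phi> P"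
    and fhom_continuous: "\<lbrakk>P \<in> objs F; Q \<in> objs F; \<phi> \<in> fhom F P Q\<rbrakk> \<Longrightarrow>
      continuous_map (subtopology (ftop F) P) (subtopology (ftop F) Q) \<phi>"
    and fhom_extensional: "\<lbrakk>P \<in> objs F; Q \<in> objs F; \<phi> \<in> fhom F P Q\<rbrakk> \<Longrightarrow> \<phi> \<in> extensional P"
    and fhom_id: "P \<in> objs F \<Longrightarrow> (\<lambda>u\<in>P. u) \<in> fhom F P P"
    and fhom_compose: "\<lbrakk>P \<in> objs F; Q \<in> objs F; R \<in> objs F; \<phi> \<in> fhom F P Q; \<psi> \<in> fhom F Q R\<rbrakk> \<Longrightarrow>
      compose P \<psi> \<phi> \<in> fhom F P R"

definition fiso :: "'a fusion_data \<Rightarrow> 'a set \<Rightarrow> 'a set \<Rightarrow> ('a \<Rightarrow> 'a) set" where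
  "fiso F P Q = {\<phi> \<in> fhom F P Q. \<exists>\<psi>\<in>fhom F Q P.
     compose P \<psi> \<phi> = (\<lambda>u\<in>P. u) \<and> compose Q \<phi> \<psi> = (\<lambda>v\<in>Q. v)}"

abbreviation conj_by :: "('a, 'b) monoid_scheme \<Rightarrow> 'a \<Rightarrow> 'a \<Rightarrow> 'a" where
  "conj_by G x u \<equiv> x \<otimes>\<^bsub>G\<^esub> u \<otimes>\<^bsub>G\<^esub> inv\<^bsub>G\<^esub> x"

section \<open>Fusion systems on finite \<open>p\<close>-groups\<close>

definition finite_p_group :: "nat \<Rightarrow> ('a, 'b) monoid_scheme \<Rightarrow> bool" where
  "finite_p_group p G \<longleftrightarrow> group G \<and> finite (carrier G) \<and> (\<exists>n. order G = p ^ n)"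

locale fusion_system = fusion_category F for p :: nat and F :: "'a fusion_data" +
  assumes p_group: "finite_p_group p (fgrp F)"
    and discrete: "ftop F = discrete_topology (carrier (fgrp F))"
    and conjugation: "\<lbrakk>P \<in> objs F; Q \<in> objs F; x \<in> carrier (fgrp F); conj_by (fgrp F) x ` P \<subseteq> Q\<rbrakk> \<Longrightarrow>
      (\<lambda>u\<in>P. conj_by (fgrp F) x u) \<in> fhom F P Q"
    and factorization: "\<lbrakk>P \<in> objs F; Q \<in> objs F; \<phi> \<in> fhom F P Q\<rbrakk> \<Longrightarrow>
      \<exists>R\<in>objs F. R \<subseteq> Q \<and> \<phi> \<in> fiso F P R"

subsection \<open>Saturation\<close>

definition Aut_grp :: "'a fusion_data \<Rightarrow> 'a set \<Rightarrow> ('a \<Rightarrow> 'a) monoid" where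
  "Aut_grp F Q = (BijGroup Q)\<lparr>carrier := fiso F Q Q\<rparr>"

definition Aut_S :: "'a fusion_data \<Rightarrow> 'a set \<Rightarrow> ('a \<Rightarrow> 'a) set" where
  "Aut_S F Q = (\<lambda>x. \<lambda>u\<in>Q. conj_by (fgrp F) x u) ` normalizer (fgrp F) Q"

definition sylow_subgroup :: "nat \<Rightarrow> 'a set \<Rightarrow> ('a, 'b) monoid_scheme \<Rightarrow> bool" where
  "sylow_subgroup p H G \<longleftrightarrow> subgroup H G \<and> card H = p ^ multiplicity p (order G)"

definition ext_dom :: "'a fusion_data \<Rightarrow> 'a set \<Rightarrow> 'a set \<Rightarrow> ('a \<Rightarrow> 'a) \<Rightarrow> 'a set" where
  "ext_dom F R Q \<phi> = {x \<in> normalizer (fgrp F) R. \<exists>y\<in>normalizer (fgrp F) Q.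
     \<forall>u\<in>R. \<phi> (conj_by (fgrp F) x u) = conj_by (fgrp F) y (\<phi> u)}"

definition receptive :: "'a fusion_data \<Rightarrow> 'a set \<Rightarrow> bool" where
  "receptive F Q \<longleftrightarrow> (\<forall>R\<in>objs F. \<forall>\<phi>\<in>fiso F R Q.
     \<exists>\<psi>\<in>fhom F (ext_dom F R Q \<phi>) (normalizer (fgrp F) Q). restrict \<psi> R = \<phi>)"

definition fully_normalized :: "nat \<Rightarrow> 'a fusion_data \<Rightarrow> 'a set \<Rightarrow> bool" where
  "fully_normalized p F Q \<longleftrightarrow> receptive F Q \<and> sylow_subgroup p (Aut_S F Q) (Aut_grp F Q)"

definition saturated :: "nat \<Rightarrow> 'a fusion_data \<Rightarrow> bool" where
  "saturated p F \<longleftrightarrow> fusion_system p F \<and>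
     (\<forall>P\<in>objs F. \<exists>Q\<in>objs F. fiso F P Q \<noteq> {} \<and> fully_normalized p F Q)"

section \<open>Morphisms\<close>

text \<open>
  \<open>A P Q\<close> is the action of the functor \<open>A\<close> on the morphisms from \<open>P\<close> to \<open>Q\<close>; on objects it is
  \<open>P \<mapsto> \<alpha> ` P\<close>.
\<close>

definition induced_functor ::
  "'a fusion_data \<Rightarrow> 'b fusion_data \<Rightarrow> ('a \<Rightarrow> 'b) \<Rightarrow>
   ('a set \<Rightarrow> 'a set \<Rightarrow> ('a \<Rightarrow> 'a) \<Rightarrow> ('b \<Rightarrow> 'b)) \<Rightarrow> bool" where
  "induced_functor F G \<alpha> A \<longleftrightarrow>
     (\<forall>P\<in>objs F. \<alpha> ` P \<in> objs G) \<and>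
     (\<forall>P\<in>objs F. \<forall>Q\<in>objs F. \<forall>\<phi>\<in>fhom F P Q.
        A P Q \<phi> \<in> fhom G (\<alpha> ` P) (\<alpha> ` Q) \<and> (\<forall>u\<in>P. \<alpha> (\<phi> u) = A P Q \<phi> (\<alpha> u))) \<and>
     (\<forall>P\<in>objs F. A P P (\<lambda>u\<in>P. u) = (\<lambda>v\<in>\<alpha> ` P. v)) \<and>
     (\<forall>P\<in>objs F. \<forall>Q\<in>objs F. \<forall>R\<in>objs F. \<forall>\<phi>\<in>fhom F P Q. \<forall>\<psi>\<in>fhom F Q R.
        A P R (compose P \<psi> \<phi>) = compose (\<alpha> ` P) (A Q R \<psi>) (A P Q \<phi>))"

definition fusion_morphism :: "'a fusion_data \<Rightarrow> 'b fusion_data \<Rightarrow> ('a \<Rightarrow> 'b) \<Rightarrow> bool" where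
  "fusion_morphism F G \<alpha> \<longleftrightarrow>
     \<alpha> \<in> hom (fgrp F) (fgrp G) \<and> continuous_map (ftop F) (ftop G) \<alpha> \<and>
     (\<exists>A. induced_functor F G \<alpha> A)"

definition fusion_isomorphic :: "'a fusion_data \<Rightarrow> 'b fusion_data \<Rightarrow> bool" (infix \<open>\<cong>\<^sub>f\<close> 50) where
  "F \<cong>\<^sub>f G \<longleftrightarrow> (\<exists>\<alpha> \<beta>. fusion_morphism F G \<alpha> \<and> fusion_morphism G F \<beta> \<and>
     (\<forall>x\<in>carrier (fgrp F). \<beta> (\<alpha> x) = x) \<and> (\<forall>y\<in>carrier (fgrp G). \<alpha> (\<beta> y) = y))"

section \<open>Inverse limits\<close>

text \<open>
  \<open>f i j\<close>, for \<open>rel i j\<close>, is the transition map from the \<open>j\<close>-th to the \<open>i\<close>-th fusion system.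
\<close>

locale inverse_system =
  fixes p :: nat and I :: "'i set" and rel :: "'i \<Rightarrow> 'i \<Rightarrow> bool"
    and Fs :: "'i \<Rightarrow> 'g fusion_data" and f :: "'i \<Rightarrow> 'i \<Rightarrow> 'g \<Rightarrow> 'g"
  assumes nonempty: "I \<noteq> {}"
    and rel_refl: "i \<in> I \<Longrightarrow> rel i i"
    and rel_trans: "\<lbrakk>i \<in> I; j \<in> I; k \<in> I; rel i j; rel j k\<rbrakk> \<Longrightarrow> rel i k"
    and rel_directed: "\<lbrakk>i \<in> I; j \<in> I\<rbrakk> \<Longrightarrow> \<exists>k\<in>I. rel i k \<and> rel j k"
    and fusion_systems: "i \<in> I \<Longrightarrow> fusion_system p (Fs i)"
    and transition: "\<lbrakk>i \<in> I; j \<in> I; rel i j\<rbrakk> \<Longrightarrow> fusion_morphism (Fs j) (Fs i) (f i j)"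
    and transition_id: "\<lbrakk>i \<in> I; x \<in> carrier (fgrp (Fs i))\<rbrakk> \<Longrightarrow> f i i x = x"
    and transition_comp: "\<lbrakk>i \<in> I; j \<in> I; k \<in> I; rel i j; rel j k; x \<in> carrier (fgrp (Fs k))\<rbrakk> \<Longrightarrow>
      f i j (f j k x) = f i k x"

definition lim_carrier ::
  "'i set \<Rightarrow> ('i \<Rightarrow> 'i \<Rightarrow> bool) \<Rightarrow> ('i \<Rightarrow> 'g fusion_data) \<Rightarrow> ('i \<Rightarrow> 'i \<Rightarrow> 'g \<Rightarrow> 'g) \<Rightarrow> ('i \<Rightarrow> 'g) set" where
  "lim_carrier I rel Fs f =
     {x \<in> \<Pi>\<^sub>E i\<in>I. carrier (fgrp (Fs i)). \<forall>i\<in>I. \<forall>j\<in>I. rel i j \<longrightarrow> f i j (x j) = x i}"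

text \<open>
  The elements of the inverse limit of the sets \<open>Hom(f\<^sub>i(P), f\<^sub>i(Q))\<close>. The compatibility
  \<open>F\<^sub>i\<^sub>j(\<phi>\<^sub>j) = \<phi>\<^sub>i\<close> is stated through the equation that determines \<open>F\<^sub>i\<^sub>j(\<phi>\<^sub>j)\<close>:
  since \<open>f\<^sub>i\<^sub>j\<close> maps \<open>f\<^sub>j(P)\<close> onto \<open>f\<^sub>i(P)\<close>, it says \<open>f\<^sub>i\<^sub>j \<circ> \<phi>\<^sub>j = \<phi>\<^sub>i \<circ> f\<^sub>i\<^sub>j\<close> on \<open>f\<^sub>j(P)\<close>.
\<close>

definition lim_families ::
  "'i set \<Rightarrow> ('i \<Rightarrow> 'i \<Rightarrow> bool) \<Rightarrow> ('i \<Rightarrow> 'g fusion_data) \<Rightarrow> ('i \<Rightarrow> 'i \<Rightarrow> 'g \<Rightarrow> 'g) \<Rightarrow>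
   ('i \<Rightarrow> 'g) set \<Rightarrow> ('i \<Rightarrow> 'g) set \<Rightarrow> ('i \<Rightarrow> 'g \<Rightarrow> 'g) set" where
  "lim_families I rel Fs f P Q =
     {\<phi> \<in> \<Pi>\<^sub>E i\<in>I. fhom (Fs i) ((\<lambda>x. x i) ` P) ((\<lambda>x. x i) ` Q).
        \<forall>i\<in>I. \<forall>j\<in>I. rel i j \<longrightarrow> (\<forall>u\<in>(\<lambda>x. x j) ` P. f i j (\<phi> j u) = \<phi> i (f i j u))}"

definition inverse_limit ::
  "'i set \<Rightarrow> ('i \<Rightarrow> 'i \<Rightarrow> bool) \<Rightarrow> ('i \<Rightarrow> 'g fusion_data) \<Rightarrow> ('i \<Rightarrow> 'i \<Rightarrow> 'g \<Rightarrow> 'g) \<Rightarrow>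
   ('i \<Rightarrow> 'g) fusion_data" where
  "inverse_limit I rel Fs f =
     \<lparr>fgrp = (product_group I (\<lambda>i. fgrp (Fs i)))\<lparr>carrier := lim_carrier I rel Fs f\<rparr>,
      ftop = subtopology (product_topology (\<lambda>i. ftop (Fs i)) I) (lim_carrier I rel Fs f),
      fhom = (\<lambda>P Q. (\<lambda>\<phi>. \<lambda>x\<in>P. \<lambda>i\<in>I. \<phi> i (x i)) ` lim_families I rel Fs f P Q)\<rparr>"

text \<open>
  Pro-fusion systems are taken up to isomorphism, so that the underlying group need not literally
  be a set of compatible families. The type arguments are the types of the indices and of the
  elements of the finite groups in the inverse system. HOL cannot quantify existentially over
  types, but a hypothesis \<open>pro_saturated TYPE('i) TYPE('g) p F\<close> with type variables \<open>'i\<close>, \<open>'g\<close>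
  covers all choices.
\<close>

definition pro_fusion_system :: "'i itself \<Rightarrow> 'g itself \<Rightarrow> nat \<Rightarrow> 'a fusion_data \<Rightarrow> bool" where
  "pro_fusion_system _ _ p F \<longleftrightarrow> fusion_category F \<and>
     (\<exists>(I :: 'i set) rel (Fs :: 'i \<Rightarrow> 'g fusion_data) f.
        inverse_system p I rel Fs f \<and> F \<cong>\<^sub>f inverse_limit I rel Fs f)"

definition pro_saturated :: "'i itself \<Rightarrow> 'g itself \<Rightarrow> nat \<Rightarrow> 'a fusion_data \<Rightarrow> bool" where
  "pro_saturated ti tg p F \<longleftrightarrow> pro_fusion_system ti tg p F \<and>
     (\<exists>(I :: 'i set) rel (Fs :: 'i \<Rightarrow> 'g fusion_data) f.
        inverse_system p I rel Fs f \<and> (\<forall>i\<in>I. saturated p (Fs i)) \<and> F \<cong>\<^sub>f inverse_limit I rel Fs f)"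

section \<open>Quotients\<close>

definition strongly_closed :: "'a fusion_data \<Rightarrow> 'a set \<Rightarrow> bool" where
  "strongly_closed F N \<longleftrightarrow> N \<in> objs F \<and>
     (\<forall>R\<in>objs F. \<forall>\<phi>\<in>fhom F R (carrier (fgrp F)). R \<subseteq> N \<longrightarrow> \<phi> ` R \<subseteq> N)"

definition open_strongly_closed :: "'a fusion_data \<Rightarrow> 'a set set" where
  "open_strongly_closed F = {N. strongly_closed F N \<and> openin (ftop F) N}"

text \<open>
  For \<open>N\<close> open and strongly closed. A subgroup of \<open>S/N\<close> is a set \<open>X\<close> of cosets and has the form
  \<open>PN/N\<close> with \<open>PN = \<Union>X\<close>. Cosets are right cosets, which agree with left ones since \<open>N\<close> is normal.
  Quantifying over \<open>u\<close> in \<open>PN\<close> rather than in \<open>P\<close> makes no difference, as the lift maps \<open>N\<close> into \<open>N\<close>.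
\<close>

definition fusion_quotient :: "'a fusion_data \<Rightarrow> 'a set \<Rightarrow> 'a set fusion_data" where
  "fusion_quotient F N =
     \<lparr>fgrp = fgrp F Mod N,
      ftop = discrete_topology (carrier (fgrp F Mod N)),
      fhom = (\<lambda>X Y. {\<phi> \<in> hom ((fgrp F Mod N)\<lparr>carrier := X\<rparr>) ((fgrp F Mod N)\<lparr>carrier := Y\<rparr>).
        \<phi> \<in> extensional X \<and>
        (\<exists>\<psi>\<in>fhom F (\<Union>X) (carrier (fgrp F)).
           \<forall>u\<in>\<Union>X. \<phi> (N #>\<^bsub>fgrp F\<^esub> u) = N #>\<^bsub>fgrp F\<^esub> \<psi> u)})\<rparr>"

text \<open>For \<open>M \<subseteq> N\<close>, the natural map \<open>S/M \<rightarrow> S/N\<close> sends a coset \<open>C\<close> of \<open>M\<close> to the coset \<open>NC\<close> of \<open>N\<close>.\<close>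

definition fusion_quotient_map :: "'a fusion_data \<Rightarrow> 'a set \<Rightarrow> 'a set \<Rightarrow> 'a set \<Rightarrow> 'a set" where
  "fusion_quotient_map F N M = (\<lambda>C. N <#>\<^bsub>fgrp F\<^esub> C)"

end

theory Submission
  imports Defs "HOL-Algebra.Zassenhaus" "HOL-Analysis.Product_Topology"
begin

text \<open>
  The heart of the matter is that every morphism \<open>\<phi> : P \<rightarrow> S\<close> agrees modulo an open strongly closed
  subgroup \<open>N\<close> with a morphism defined on \<open>NP\<close>; this makes the transition maps between the quotients,
  and the maps from \<open>F\<close> to the quotients, morphisms of fusion systems.

  For a saturated fusion system on a finite group one argues by downward induction on \<open>|P|\<close>. The
  isomorphisms with the required property form a groupoid, and by induction they include those that
  extend to a larger subgroup. So it suffices to treat automorphisms of a fully normalized \<open>Q\<close>: the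
  automorphisms that are trivial modulo \<open>N\<close> are clearly of the required kind, and by the Frattini
  argument every automorphism is a product of one of these with one that normalizes the image of
  \<open>N\<^sub>N(Q)\<close> in \<open>Aut\<^sub>S(Q)\<close>, which extends to a larger subgroup by receptivity.

  In an inverse limit of saturated fusion systems \<open>F\<^sub>i\<close> on \<open>S\<^sub>i\<close>, the preimage in \<open>S\<^sub>j\<close> of the image of \<open>N\<close> in
  \<open>S\<^sub>i\<close> is strongly closed for large \<open>j\<close>, by compactness. The finite case then gives nonempty finite
  sets of lifts over the \<open>F\<^sub>j\<close>, whose inverse limit is nonempty. Finally, a compatible family
  of morphisms of the quotients is a morphism of \<open>F\<close>, since the kernels of the projections to the \<open>S\<^sub>i\<close>
  are among the open strongly closed subgroups.
\<close>

section \<open>Actions of finite \<open>p\<close>-groups on cosets\<close>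

text \<open>Saturation enters because a morphism of \<open>F/N\<close> must come from a morphism of
  \<open>F\<close> defined on all of \<open>NP\<close>, whereas a morphism on \<open>P\<close> need
  not extend to \<open>NP\<close>. Passing from \<open>F/M\<close> to \<open>F/N\<close> therefore
  requires changing morphisms modulo \<open>N\<close> until they are defined on \<open>NP\<close>.
  Such a replacement is not canonical: lifts picked over different \<open>F\<^sub>i\<close> need not
  be compatible, which is why the finite sets of all lifts, and not single lifts, are passed to the
  limit. A second obstacle is that neither the transition maps nor the projections of
  \<open>S\<close> are assumed surjective, and a morphism of \<open>F\<^sub>i\<close> need not come
  from \<open>F\<close>; so the image of \<open>N\<close> in \<open>S\<^sub>i\<close> need not be
  strongly closed in \<open>F\<^sub>i\<close>. For this reason membership in \<open>N\<close> is
  tested at one fixed level whose kernel lies in \<open>N\<close>, and strong closure is only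
  claimed for preimages at high levels.\<close>

lemma (in group_action) dvd_card_not_fixed:
  assumes p: "prime p" and ord: "order G = p ^ n" and fin: "finite E"
  shows "p dvd card (E - {x \<in> E. \<forall>g\<in>carrier G. \<phi> g x = x})"
proof -
  let ?Fix = "{x \<in> E. \<forall>g\<in>carrier G. \<phi> g x = x}"
  \<comment> \<open>Orbits have \<open>p\<close>-power size, so divisibility by \<open>p\<close>
    singles out those with more than one point.\<close>
  let ?C = "{orb \<in> orbits G E \<phi>. p dvd card orb}"
  have sub: "orb \<subseteq> E" if "orb \<in> orbits G E \<phi>" for orb
    using that orbits_coverture by blast
  have "\<Union>?C = E - ?Fix"
  proof (intro equalityI subsetI)
    fix x assume "x \<in> \<Union>?C"
    then obtain orb where orb: "orb \<in> orbits G E \<phi>" "p dvd card orb" "x \<in> orb" by auto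
    have x: "x \<in> E" using orb sub by auto
    have "orb = orbit G \<phi> x"
      using orb x disjoint_union[of orb "orbit G \<phi> x"] orbit_refl[OF x] unfolding orbits_def by blast
    have "x \<notin> ?Fix"
    proof
      assume "x \<in> ?Fix"
      then have "orbit G \<phi> x \<subseteq> {x}" unfolding orbit_def by auto
      then have "orbit G \<phi> x = {x}" using orbit_refl[OF x] by auto
      with \<open>orb = orbit G \<phi> x\<close> have "orb = {x}" by (rule trans)
      with orb(2) have "p dvd 1" by simp
      then show False using p by (metis not_prime_unit)
    qed
    with x show "x \<in> E - ?Fix" by simp
  next
    fix x assume x: "x \<in> E - ?Fix"
    have "card (orbit G \<phi> x) dvd p ^ n"
    proof -
      have "card (orbit G \<phi> x) * card (stabilizer G \<phi> x) = p ^ n"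
        using orbit_stabilizer_theorem[of x] x ord by simp
      then show ?thesis by (rule dvdI[OF sym])
    qed
    then obtain k where k: "card (orbit G \<phi> x) = p ^ k"
      using divides_primepow_nat[OF p] by blast
    have "k \<noteq> 0"
    proof
      assume "k = 0"
      then obtain y where "orbit G \<phi> x = {y}" using k by (auto simp: card_1_singleton_iff)
      moreover have "x \<in> orbit G \<phi> x" using orbit_refl x by auto
      ultimately have "\<phi> g x = x" if "g \<in> carrier G" for g
        using that unfolding orbit_def by auto
      then show False using x by auto
    qed
    then have "p dvd card (orbit G \<phi> x)" using k by (simp add: dvd_power)
    moreover have "x \<in> orbit G \<phi> x" "orbit G \<phi> x \<in> orbits G E \<phi>"
      using x orbit_refl unfolding orbits_def by auto
    ultimately show "x \<in> \<Union>?C" by auto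
  qed
  moreover have "p dvd card (\<Union>?C)"
  proof (rule dvd_partition)
    show "finite (\<Union>?C)" using fin \<open>\<Union>?C = E - ?Fix\<close> by simp
  next
    show "\<forall>c1\<in>?C. \<forall>c2\<in>?C. c1 \<noteq> c2 \<longrightarrow> c1 \<inter> c2 = {}"
      using disjoint_union by blast
  qed simp
  ultimately show ?thesis by simp
qed

text \<open>Translating right cosets on the right reverses products; the inverse turns this into a
  left action. The acting group \<open>B\<close> reaches \<open>G\<close> through an arbitrary
  \<open>h\<close>, so that a normalizer in \<open>S\<close> can later act on cosets in an
  automorphism group.\<close>

lemma (in group) rcoset_action:
  assumes B: "group B" and h: "h \<in> hom B G" and H: "subgroup H G"
  shows "group_action B (rcosets H) (\<lambda>b. \<lambda>X\<in>rcosets H. X #> inv (h b))"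
proof -
  have hc: "h b \<in> carrier G" if "b \<in> carrier B" for b using that h by (rule hom_in_carrier[rotated])
  have Xc: "X \<subseteq> carrier G" if "X \<in> rcosets H" for X
    using that H subgroup.rcosets_carrier is_group by blast
  have cl: "X #> y \<in> rcosets H" if "X \<in> rcosets H" "y \<in> carrier G" for X y
    using that H unfolding RCOSETS_def by (auto simp: coset_mult_assoc subgroup.subset)
  have bij: "(\<lambda>X\<in>rcosets H. X #> inv (h b)) \<in> Bij (rcosets H)" if "b \<in> carrier B" for b
  proof -
    have "bij_betw (\<lambda>X\<in>rcosets H. X #> inv (h b)) (rcosets H) (rcosets H)"
      by (rule bij_betw_byWitness[where f' = "\<lambda>X. X #> h b"])
        (use hc[OF that] Xc cl in \<open>auto simp: coset_mult_assoc\<close>)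
    then show ?thesis by (simp add: Bij_def)
  qed
  have "(\<lambda>b. \<lambda>X\<in>rcosets H. X #> inv (h b)) \<in> hom B (BijGroup (rcosets H))"
  proof (rule homI)
    fix b assume "b \<in> carrier B"
    then show "(\<lambda>X\<in>rcosets H. X #> inv (h b)) \<in> carrier (BijGroup (rcosets H))"
      using bij by (simp add: BijGroup_def)
  next
    fix b c assume bc: "b \<in> carrier B" "c \<in> carrier B"
    have "X #> inv (h (b \<otimes>\<^bsub>B\<^esub> c)) = X #> inv (h c) #> inv (h b)" if "X \<in> rcosets H" for X
      using that Xc bc hc hom_mult[OF h] by (simp add: coset_mult_assoc inv_mult_group)
    then show "(\<lambda>X\<in>rcosets H. X #> inv (h (b \<otimes>\<^bsub>B\<^esub> c))) =
      (\<lambda>X\<in>rcosets H. X #> inv (h b)) \<otimes>\<^bsub>BijGroup (rcosets H)\<^esub> (\<lambda>X\<in>rcosets H. X #> inv (h c))"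
      using bij bc cl hc by (auto simp: BijGroup_def compose_def fun_eq_iff restrict_def)
  qed
  then show ?thesis
    using B group_BijGroup by (intro group_action.intro group_hom.intro group_hom_axioms.intro)
qed

text \<open>Turns fixed points into conjugations: a coset fixed by every element of a group supplies
  one \<open>x\<close> that conjugates this group into \<open>H\<close>.\<close>

lemma (in group) rcoset_fixed_iff:
  assumes H: "subgroup H G" and x: "x \<in> carrier G" and bc: "b \<in> carrier G"
  shows "H #> x #> inv b = H #> x \<longleftrightarrow> x \<otimes> b \<otimes> inv x \<in> H"
proof -
  have Hs: "H \<subseteq> carrier G" using H subgroup.subset by auto
  have "H #> x #> inv b = H #> x \<longleftrightarrow> H #> x #> inv b #> b = H #> x #> b"
    by (metis Hs bc coset_mult_assoc coset_mult_one inv_closed l_inv r_inv x r_coset_subset_G)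
  also have "\<dots> \<longleftrightarrow> H #> x = H #> (x \<otimes> b)"
    using Hs bc x by (simp add: coset_mult_assoc m_assoc)
  also have "\<dots> \<longleftrightarrow> x \<otimes> b \<in> H #> x"
    using H bc x by (metis m_closed rcos_self repr_independence)
  also have "\<dots> \<longleftrightarrow> x \<otimes> b \<otimes> inv x \<in> H"
    using H bc x by (simp add: subgroup.rcos_module is_group)
  finally show ?thesis .
qed

text \<open>The containment half of Sylow's theorem: the number of non-fixed cosets is divisible by
  \<open>p\<close> and the index is not, so some coset is fixed by all of \<open>B\<close>.\<close>

lemma (in group) p_group_hom_conj_subset:
  assumes "prime p" and fin: "finite (carrier G)"
    and B: "group B" and ordB: "order B = p ^ n" and h: "h \<in> hom B G"
    and H: "subgroup H G" and ndvd: "\<not> p dvd card (rcosets H)"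
  shows "\<exists>x\<in>carrier G. \<forall>b\<in>carrier B. x \<otimes> h b \<otimes> inv x \<in> H"
proof -
  interpret act: group_action B "rcosets H" "\<lambda>b. \<lambda>X\<in>rcosets H. X #> inv (h b)"
    using rcoset_action B h H .
  let ?Fix = "{X \<in> rcosets H. \<forall>b\<in>carrier B. (\<lambda>X\<in>rcosets H. X #> inv (h b)) X = X}"
  have finE: "finite (rcosets H)" using fin by (simp add: RCOSETS_def)
  have "p dvd card (rcosets H - ?Fix)"
    using act.dvd_card_not_fixed[OF \<open>prime p\<close> ordB finE] .
  then have "?Fix \<noteq> {}" using ndvd by (metis Diff_empty)
  then obtain X where X: "X \<in> rcosets H" "\<And>b. b \<in> carrier B \<Longrightarrow> X #> inv (h b) = X" by auto
  then obtain x where x: "x \<in> carrier G" "X = H #> x" unfolding RCOSETS_def by auto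
  then have "\<forall>b\<in>carrier B. x \<otimes> h b \<otimes> inv x \<in> H"
    using X rcoset_fixed_iff[OF H x(1)] hom_in_carrier[OF h] by auto
  with x show ?thesis by auto
qed

text \<open>\<open>H\<close> acts on its own cosets, whose number is a power of \<open>p\<close>
  greater than 1. The number of fixed cosets is then divisible by \<open>p\<close>; as
  \<open>H\<close> is one of them, there is another, and its representatives normalize
  \<open>H\<close>.\<close>

lemma (in group) p_group_normalizer_grows:
  assumes "prime p" and ord: "order G = p ^ n" and H: "subgroup H G" and ne: "H \<noteq> carrier G"
  shows "\<exists>x\<in>carrier G - H. \<forall>h\<in>H. x \<otimes> h \<otimes> inv x \<in> H"
proof -
  have fin: "finite (carrier G)"
    using ord \<open>prime p\<close> order_gt_0_iff_finite by (metis prime_gt_0_nat zero_less_power)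
  have Hs: "H \<subseteq> carrier G" and finH: "finite H"
    using H subgroup.subset fin finite_subset by metis+
  have lag: "card (rcosets H) * card H = p ^ n" using lagrange[OF H] ord by simp
  obtain m where m: "card H = p ^ m"
    using lag \<open>prime p\<close> divides_primepow_nat by (metis dvd_triv_right)
  obtain k where k: "card (rcosets H) = p ^ k"
    using lag \<open>prime p\<close> divides_primepow_nat by (metis dvd_triv_left)
  have "card H < p ^ n" using psubset_card_mono[OF fin, of H] ne Hs ord by (auto simp: order_def)
  then have "k \<noteq> 0" using lag k by (metis less_irrefl mult_1 power_0)
  then have pd: "p dvd card (rcosets H)" using k by (simp add: dvd_power)
  have id_hom: "(\<lambda>h. h) \<in> hom (G\<lparr>carrier := H\<rparr>) G" using Hs by (auto simp: hom_def)
  interpret act: group_action "G\<lparr>carrier := H\<rparr>" "rcosets H" "\<lambda>b. \<lambda>X\<in>rcosets H. X #> inv b"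
    using rcoset_action[OF subgroup_imp_group[OF H] id_hom H] .
  let ?Fix = "{X \<in> rcosets H. \<forall>b\<in>carrier (G\<lparr>carrier := H\<rparr>). (\<lambda>X\<in>rcosets H. X #> inv b) X = X}"
  have finE: "finite (rcosets H)" using fin by (simp add: RCOSETS_def)
  have "p dvd card (rcosets H - ?Fix)"
    using act.dvd_card_not_fixed[OF \<open>prime p\<close> _ finE] m by (simp add: order_def)
  moreover have "card (rcosets H) = card (rcosets H - ?Fix) + card ?Fix"
    using finE by (metis (no_types, lifting) add.commute card_Diff_subset card_mono finite_subset le_add_diff_inverse mem_Collect_eq subsetI)
  ultimately have "p dvd card ?Fix" using pd by (simp only: dvd_add_right_iff)
  have "?Fix \<noteq> {H}"
  proof
    assume "?Fix = {H}"
    then have "card ?Fix = 1" by simp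
    with \<open>p dvd card ?Fix\<close> show False using \<open>prime p\<close> by (metis not_prime_unit)
  qed
  moreover have "H \<in> ?Fix"
    using H by (auto simp: subgroup.rcos_const[OF H is_group] subgroup.m_inv_closed
        subgroup.subgroup_in_rcosets[OF H is_group])
  ultimately obtain X where X: "X \<in> ?Fix" "X \<noteq> H" by blast
  then obtain x where x: "x \<in> carrier G" "X = H #> x" unfolding RCOSETS_def by auto
  have "x \<otimes> b \<otimes> inv x \<in> H" if b: "b \<in> H" for b
  proof -
    have "X #> inv b = X" using X(1) b by auto
    then show ?thesis using x b Hs rcoset_fixed_iff[OF H x(1), of b] by auto
  qed
  moreover have "x \<notin> H" using X x subgroup.rcos_const[OF H is_group] by auto
  ultimately show ?thesis using x by auto
qed

text \<open>\<open>card T\<close> is already the full \<open>p\<close>-part of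
  \<open>order G\<close>. A factor \<open>p\<close> in the index of \<open>T\<close> in
  \<open>H\<close> would push the \<open>p\<close>-part of \<open>card H\<close> beyond it, although
  \<open>card H\<close> divides \<open>order G\<close>.\<close>

lemma (in group) sylow_index_in_subgroup:
  assumes "prime p" and fin: "finite (carrier G)" and T: "sylow_subgroup p T G"
    and H: "subgroup H G" and TH: "T \<subseteq> H"
  shows "\<not> p dvd card (rcosets\<^bsub>G\<lparr>carrier := H\<rparr>\<^esub> T)"
proof
  assume "p dvd card (rcosets\<^bsub>G\<lparr>carrier := H\<rparr>\<^esub> T)"
  moreover have subT: "subgroup T G" and cT: "card T = p ^ multiplicity p (order G)"
    using T by (auto simp: sylow_subgroup_def)
  have "card (rcosets\<^bsub>G\<lparr>carrier := H\<rparr>\<^esub> T) * card T = card H"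
    using group.lagrange[OF subgroup_imp_group[OF H] subgroup_incl[OF subT H TH]]
    by (simp add: order_def)
  ultimately have "p ^ Suc (multiplicity p (order G)) dvd card H"
    using cT by (metis mult_dvd_mono dvd_refl power_Suc)
  also have "card H dvd order G" using lagrange[OF H] by (metis dvd_triv_right)
  finally have "p ^ Suc (multiplicity p (order G)) dvd order G" .
  moreover have "order G \<noteq> 0" using fin order_gt_0_iff_finite by simp
  ultimately show False
    using \<open>prime p\<close> by (metis not_prime_unit multiplicity_geI not_less_eq_eq order_refl)
qed

text \<open>
  The Frattini argument: \<open>k \<otimes> a\<close> normalizes the Sylow subgroup \<open>T \<inter> K\<close> of \<open>K\<close>.
\<close>

lemma (in group) frattini_sylow:
  assumes p: "prime p" and fin: "finite (carrier G)" and T: "sylow_subgroup p T G"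
    and K: "K \<lhd> G" and a: "a \<in> carrier G"
  shows "\<exists>k\<in>K. \<forall>c\<in>T \<inter> K. (k \<otimes> a) \<otimes> c \<otimes> inv (k \<otimes> a) \<in> T"
proof -
  interpret K: normal K G by (rule K)
  have subT: "subgroup T G" and cT: "card T = p ^ multiplicity p (order G)"
    using T by (auto simp: sylow_subgroup_def)
  have Tc: "t \<in> carrier G" if "t \<in> T" for t using that subT subgroup.mem_carrier by metis
  \<comment> \<open>The Sylow argument takes place in \<open>KT\<close>, where \<open>T\<close> has
    index prime to \<open>p\<close>. The group to be moved into \<open>T\<close> is the
    \<open>a\<close>-conjugate of \<open>T \<inter> K\<close>, which lies in \<open>K\<close> by
    normality.\<close>
  let ?H = "K <#> T" and ?B = "G\<lparr>carrier := T \<inter> K\<rparr>"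
  have subH: "subgroup ?H G" using mult_norm_subgroup[OF K subT] .
  have TH: "T \<subseteq> ?H"
  proof
    fix t assume t: "t \<in> T"
    then have "t = \<one> \<otimes> t" using Tc by simp
    with t K.one_closed show "t \<in> ?H" unfolding set_mult_def by blast
  qed
  have KH: "K \<subseteq> ?H"
  proof
    fix k assume k: "k \<in> K"
    then have "k = k \<otimes> \<one>" by simp
    with k subgroup.one_closed[OF subT] show "k \<in> ?H" unfolding set_mult_def by blast
  qed
  have subB: "subgroup (T \<inter> K) G" using subgroups_Inter_pair[OF subT K.subgroup_axioms] .
  have "card (T \<inter> K) dvd card T"
    using group.lagrange[OF subgroup_imp_group[OF subT] subgroup_incl[OF subB subT Int_lower1]]
    by (simp add: order_def) (metis dvd_triv_right)
  then obtain n where n: "order ?B = p ^ n"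
    using cT divides_primepow_nat[OF p] by (auto simp: order_def)
  have h: "(\<lambda>c. a \<otimes> c \<otimes> inv a) \<in> hom ?B (G\<lparr>carrier := ?H\<rparr>)"
  proof (rule homI)
    fix c assume "c \<in> carrier ?B"
    then show "a \<otimes> c \<otimes> inv a \<in> carrier (G\<lparr>carrier := ?H\<rparr>)"
      using K.inv_op_closed2[OF a, of c] KH by auto
  next
    fix c d assume "c \<in> carrier ?B" "d \<in> carrier ?B"
    then have "c \<in> carrier G" "d \<in> carrier G" using Tc by auto
    moreover have "inv a \<otimes> (a \<otimes> z) = z" if "z \<in> carrier G" for z
      using a that by (simp flip: m_assoc)
    ultimately show "a \<otimes> (c \<otimes>\<^bsub>?B\<^esub> d) \<otimes> inv a =
      (a \<otimes> c \<otimes> inv a) \<otimes>\<^bsub>G\<lparr>carrier := ?H\<rparr>\<^esub> (a \<otimes> d \<otimes> inv a)"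
      using a by (simp add: m_assoc)
  qed
  have finH: "finite (carrier (G\<lparr>carrier := ?H\<rparr>))"
    using finite_subset[OF subgroup.subset[OF subH] fin] by simp
  obtain g where g: "g \<in> ?H" and
    gT: "\<And>c. c \<in> T \<inter> K \<Longrightarrow> g \<otimes> (a \<otimes> c \<otimes> inv a) \<otimes> inv g \<in> T"
    using group.p_group_hom_conj_subset[OF subgroup_imp_group[OF subH] p finH
        subgroup_imp_group[OF subB] n h subgroup_incl[OF subT subH TH]
        sylow_index_in_subgroup[OF p fin T subH TH]] subH by auto
  \<comment> \<open>The conjugating element is only known to be of the form \<open>kt\<close>.
    Conjugating once more by \<open>inv t\<close> stays inside \<open>T\<close> and replaces
    \<open>kt\<close> by \<open>inv t \<otimes> k \<otimes> t\<close>, which lies in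
    \<open>K\<close>.\<close>
  obtain k t where kt: "k \<in> K" "t \<in> T" "g = k \<otimes> t" using g by (auto simp: set_mult_def)
  note c = kt Tc[OF kt(2)] K.mem_carrier[OF kt(1)] a
  define k' where "k' = inv t \<otimes> k \<otimes> t"
  have k': "k' \<in> K" using K.inv_op_closed1[of t k] c unfolding k'_def by simp
  have "(k' \<otimes> a) \<otimes> c \<otimes> inv (k' \<otimes> a) \<in> T" if "c \<in> T \<inter> K" for c
  proof -
    have cc: "c \<in> carrier G" using that Tc by auto
    have "(k' \<otimes> a) \<otimes> c \<otimes> inv (k' \<otimes> a) = inv t \<otimes> (g \<otimes> (a \<otimes> c \<otimes> inv a) \<otimes> inv g) \<otimes> t"
      using c cc unfolding k'_def by (simp add: m_assoc inv_mult_group)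
    then show ?thesis using gT[OF that] kt subT by (simp add: subgroupE)
  qed
  with k' show ?thesis by blast
qed

text \<open>\<open>normalizer\<close> demands an equality of sets; for finite \<open>Q\<close> an
  inclusion gives it, since conjugation is injective.\<close>

lemma (in group) normalizer_memI:
  assumes "Q \<subseteq> carrier G" "x \<in> carrier G" "finite Q" "\<And>u. u \<in> Q \<Longrightarrow> x \<otimes> u \<otimes> inv x \<in> Q"
  shows "x \<in> normalizer G Q"
proof -
  have eq: "x <# Q #> inv x = (\<lambda>u. x \<otimes> u \<otimes> inv x) ` Q" by (auto simp: l_coset_def r_coset_def)
  have "inj_on (\<lambda>u. x \<otimes> u \<otimes> inv x) Q"
    using assms(1,2) by (auto simp: inj_on_def subset_iff)
  then have "(\<lambda>u. x \<otimes> u \<otimes> inv x) ` Q = Q"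
    using assms by (intro endo_inj_surj) auto
  then show ?thesis using assms eq by (simp add: normalizer_def stabilizer_def)
qed

lemma (in group) normalizer_memD:
  assumes "Q \<subseteq> carrier G" "x \<in> normalizer G Q"
  shows "x \<in> carrier G" "\<And>u. u \<in> Q \<Longrightarrow> x \<otimes> u \<otimes> inv x \<in> Q"
proof -
  have eq: "x <# Q #> inv x = (\<lambda>u. x \<otimes> u \<otimes> inv x) ` Q" by (auto simp: l_coset_def r_coset_def)
  show "x \<in> carrier G" using assms by (simp add: normalizer_def stabilizer_def)
  show "x \<otimes> u \<otimes> inv x \<in> Q" if "u \<in> Q" for u
    using assms that eq by (auto simp: normalizer_def stabilizer_def)
qed

section \<open>Strongly closed subgroups\<close>

context fusion_category
begin

abbreviation S :: "'a set" where "S \<equiv> carrier (fgrp F)"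

abbreviation times_S (infixl \<open>\<cdot>\<close> 70) where "x \<cdot> y \<equiv> x \<otimes>\<^bsub>fgrp F\<^esub> y"

abbreviation inv_S where "inv_S x \<equiv> inv\<^bsub>fgrp F\<^esub> x"

abbreviation one_S (\<open>\<e>\<close>) where "\<e> \<equiv> \<one>\<^bsub>fgrp F\<^esub>"

lemma objs_subgroup: "P \<in> objs F \<Longrightarrow> subgroup P (fgrp F)"
  by (simp add: objs_def)

lemma objs_subset: "P \<in> objs F \<Longrightarrow> P \<subseteq> S"
  by (simp add: objs_def subgroup.subset)

lemma objs_mem: "P \<in> objs F \<Longrightarrow> u \<in> P \<Longrightarrow> u \<in> S"
  using objs_subset by auto

lemma carrier_objs: "S \<in> objs F"
  using subgroup_self closedin_topspace[of "ftop F"] topspace_eq by (simp add: objs_def)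

lemma objs_Int: "P \<in> objs F \<Longrightarrow> Q \<in> objs F \<Longrightarrow> P \<inter> Q \<in> objs F"
  by (simp add: objs_def subgroups_Inter_pair closedin_Int)

context
  fixes P Q \<phi> assumes P: "P \<in> objs F" and Q: "Q \<in> objs F" and \<phi>: "\<phi> \<in> fhom F P Q"
begin

lemma fhom_group_hom: "group_hom ((fgrp F)\<lparr>carrier := P\<rparr>) (fgrp F) \<phi>"
proof -
  have "\<phi> \<in> hom ((fgrp F)\<lparr>carrier := P\<rparr>) (fgrp F)"
    using fhom_hom[OF P Q \<phi>] objs_subset[OF Q] by (auto simp: hom_def)
  then show ?thesis
    using subgroup_imp_group[OF objs_subgroup[OF P]] is_group
    by (simp add: group_hom_def group_hom_axioms_def)
qed

lemma fhom_mem: "u \<in> P \<Longrightarrow> \<phi> u \<in> Q"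
  using fhom_hom[OF P Q \<phi>] by (auto simp: hom_def)

lemma fhom_memS: "u \<in> P \<Longrightarrow> \<phi> u \<in> S"
  using fhom_mem objs_mem[OF Q] by auto

lemma fhom_mult: "u \<in> P \<Longrightarrow> v \<in> P \<Longrightarrow> \<phi> (u \<cdot> v) = \<phi> u \<cdot> \<phi> v"
  using fhom_hom[OF P Q \<phi>] by (auto simp: hom_def)

lemma fhom_one: "\<phi> \<e> = \<e>"
  using group_hom.hom_one[OF fhom_group_hom] by simp

lemma fhom_inv: "u \<in> P \<Longrightarrow> \<phi> (inv_S u) = inv_S (\<phi> u)"
  using group_hom.hom_inv[OF fhom_group_hom] m_inv_consistent[OF objs_subgroup[OF P]] by simp

end

lemma fisoD:
  assumes "P \<in> objs F" "Q \<in> objs F" "\<phi> \<in> fiso F P Q"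
  shows "\<phi> \<in> fhom F P Q" "\<phi> ` P = Q"
proof -
  show \<phi>: "\<phi> \<in> fhom F P Q" using assms by (simp add: fiso_def)
  obtain \<psi> where \<psi>: "\<psi> \<in> fhom F Q P" "compose Q \<phi> \<psi> = (\<lambda>v\<in>Q. v)"
    using assms by (auto simp: fiso_def)
  have "v \<in> \<phi> ` P" if "v \<in> Q" for v
  proof -
    have "\<phi> (\<psi> v) = v" using fun_cong[OF \<psi>(2), of v] that by (simp add: compose_def)
    then show ?thesis using fhom_mem[OF assms(2,1) \<psi>(1) that] by force
  qed
  then show "\<phi> ` P = Q" using fhom_mem[OF assms(1,2) \<phi>] by auto
qed

lemma fiso_inverse:
  assumes "P \<in> objs F" "Q \<in> objs F" "\<phi> \<in> fiso F P Q"
  obtains \<psi> where "\<psi> \<in> fiso F Q P" "\<And>u. u \<in> P \<Longrightarrow> \<psi> (\<phi> u) = u" "\<And>v. v \<in> Q \<Longrightarrow> \<phi> (\<psi> v) = v"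
proof -
  obtain \<psi> where \<psi>: "\<psi> \<in> fhom F Q P" "compose P \<psi> \<phi> = (\<lambda>u\<in>P. u)" "compose Q \<phi> \<psi> = (\<lambda>v\<in>Q. v)"
    using assms by (auto simp: fiso_def)
  have "\<psi> \<in> fiso F Q P" using \<psi> assms by (auto simp: fiso_def)
  moreover have "\<psi> (\<phi> u) = u" if "u \<in> P" for u
    using fun_cong[OF \<psi>(2), of u] that by (simp add: compose_def)
  moreover have "\<phi> (\<psi> v) = v" if "v \<in> Q" for v
    using fun_cong[OF \<psi>(3), of v] that by (simp add: compose_def)
  ultimately show ?thesis using that by blast
qed

lemma fiso_compose:
  assumes "P \<in> objs F" "Q \<in> objs F" "R \<in> objs F" "\<phi> \<in> fiso F P Q" "\<psi> \<in> fiso F Q R"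
  shows "compose P \<psi> \<phi> \<in> fiso F P R"
proof -
  obtain \<phi>' where \<phi>': "\<phi>' \<in> fiso F Q P" "\<And>u. u \<in> P \<Longrightarrow> \<phi>' (\<phi> u) = u" "\<And>v. v \<in> Q \<Longrightarrow> \<phi> (\<phi>' v) = v"
    by (rule fiso_inverse[OF assms(1,2,4)]) blast
  obtain \<psi>' where \<psi>': "\<psi>' \<in> fiso F R Q" "\<And>u. u \<in> Q \<Longrightarrow> \<psi>' (\<psi> u) = u" "\<And>v. v \<in> R \<Longrightarrow> \<psi> (\<psi>' v) = v"
    by (rule fiso_inverse[OF assms(2,3,5)]) blast
  note h = fisoD(1)[OF assms(1,2,4)] fisoD(1)[OF assms(2,3,5)]
    fisoD(1)[OF assms(2,1) \<phi>'(1)] fisoD(1)[OF assms(3,2) \<psi>'(1)]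
  have "compose P (compose R \<phi>' \<psi>') (compose P \<psi> \<phi>) = (\<lambda>u\<in>P. u)"
    using fhom_mem[OF assms(1,2) h(1)] fhom_mem[OF assms(2,3) h(2)] \<phi>'(2) \<psi>'(2)
    by (auto simp: compose_def fun_eq_iff)
  moreover have "compose R (compose P \<psi> \<phi>) (compose R \<phi>' \<psi>') = (\<lambda>u\<in>R. u)"
    using fhom_mem[OF assms(2,1) h(3)] fhom_mem[OF assms(3,2) h(4)] \<phi>'(3) \<psi>'(3)
    by (auto simp: compose_def fun_eq_iff)
  moreover have "compose P \<psi> \<phi> \<in> fhom F P R" "compose R \<phi>' \<psi>' \<in> fhom F R P"
    using fhom_compose assms h by blast+
  ultimately show ?thesis by (auto simp: fiso_def)
qed

end

text \<open>The two closure axioms common to fusion systems on finite groups and to their limits.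
  The basic facts on strongly closed subgroups rest on them, so that they serve both the
  \<open>Fs i\<close> and the limit.\<close>

locale divisible_fusion = fusion_category F for F :: "'a fusion_data" +
  assumes conj_fhom: "\<lbrakk>P \<in> objs F; Q \<in> objs F; x \<in> carrier (fgrp F); conj_by (fgrp F) x ` P \<subseteq> Q\<rbrakk> \<Longrightarrow>
      (\<lambda>u\<in>P. conj_by (fgrp F) x u) \<in> fhom F P Q"
    and fhom_factor: "\<lbrakk>P \<in> objs F; Q \<in> objs F; \<phi> \<in> fhom F P Q\<rbrakk> \<Longrightarrow>
      \<exists>R\<in>objs F. R \<subseteq> Q \<and> \<phi> \<in> fiso F P R"

sublocale fusion_system \<subseteq> divisible_fusion F
  using conjugation factorization by unfold_locales

context divisible_fusion
begin

text \<open>Inclusions are conjugations by the identity.\<close>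

lemma fhom_inclusion:
  assumes "P \<in> objs F" "Q \<in> objs F" "P \<subseteq> Q"
  shows "(\<lambda>u\<in>P. u) \<in> fhom F P Q"
proof -
  have eq: "conj_by (fgrp F) \<e> u = u" if "u \<in> P" for u
    using that objs_mem[OF assms(1)] by simp
  then have "(\<lambda>u\<in>P. conj_by (fgrp F) \<e> u) = (\<lambda>u\<in>P. u)" by (auto simp: fun_eq_iff)
  moreover have "conj_by (fgrp F) \<e> ` P \<subseteq> Q" using eq assms(3) by auto
  ultimately show ?thesis using conj_fhom[OF assms(1,2) one_closed] by simp
qed

lemma fhom_image:
  assumes "P \<in> objs F" "Q \<in> objs F" "\<phi> \<in> fhom F P Q"
  shows "\<phi> ` P \<in> objs F" "\<phi> \<in> fiso F P (\<phi> ` P)"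
proof -
  obtain R where "R \<in> objs F" "\<phi> \<in> fiso F P R" using fhom_factor[OF assms] by auto
  with fisoD(2)[OF assms(1), of R \<phi>] show "\<phi> ` P \<in> objs F" "\<phi> \<in> fiso F P (\<phi> ` P)" by auto
qed

lemma fiso_iff:
  assumes "P \<in> objs F" "Q \<in> objs F"
  shows "\<phi> \<in> fiso F P Q \<longleftrightarrow> \<phi> \<in> fhom F P Q \<and> \<phi> ` P = Q"
  using fisoD[OF assms] fhom_image[OF assms] by metis

lemma fhom_codomain:
  assumes "P \<in> objs F" "Q \<in> objs F" "R \<in> objs F" "\<phi> \<in> fhom F P Q" "\<phi> ` P \<subseteq> R"
  shows "\<phi> \<in> fhom F P R"
proof -
  note im = fhom_image[OF assms(1,2,4)]
  have "compose P (\<lambda>v\<in>\<phi> ` P. v) \<phi> \<in> fhom F P R"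
    using fhom_compose[OF assms(1) im(1) assms(3) fisoD(1)[OF assms(1) im]
        fhom_inclusion[OF im(1) assms(3,5)]] .
  also have "compose P (\<lambda>v\<in>\<phi> ` P. v) \<phi> = \<phi>"
    using fhom_extensional[OF assms(1,2,4)] by (auto simp: compose_def fun_eq_iff extensional_def)
  finally show ?thesis .
qed

lemma fhom_restrict:
  assumes "P \<in> objs F" "Q \<in> objs F" "R \<in> objs F" "\<phi> \<in> fhom F P Q" "R \<subseteq> P"
  shows "restrict \<phi> R \<in> fhom F R Q"
proof -
  have "compose R \<phi> (\<lambda>v\<in>R. v) \<in> fhom F R Q"
    using fhom_compose[OF assms(3,1,2) fhom_inclusion[OF assms(3,1,5)] assms(4)] .
  also have "compose R \<phi> (\<lambda>v\<in>R. v) = restrict \<phi> R"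
    by (auto simp: compose_def fun_eq_iff)
  finally show ?thesis .
qed

context
  fixes N assumes N: "strongly_closed F N"
begin

lemma strongly_closed_objs: "N \<in> objs F"
  using N by (simp add: strongly_closed_def)

text \<open>The definition only speaks of morphisms into \<open>S\<close> whose whole source lies in
  \<open>N\<close>; restricting to \<open>P \<inter> N\<close> and enlarging the target brings every
  morphism into that form.\<close>

lemma strongly_closed_mem:
  assumes "P \<in> objs F" "Q \<in> objs F" "\<phi> \<in> fhom F P Q" "u \<in> P" "u \<in> N"
  shows "\<phi> u \<in> N"
proof -
  have R: "P \<inter> N \<in> objs F" using objs_Int assms(1) strongly_closed_objs .
  have "\<phi> \<in> fhom F P S"
    using fhom_codomain[OF assms(1,2) carrier_objs assms(3)] fhom_memS[OF assms(1-3)] by auto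
  then have "restrict \<phi> (P \<inter> N) \<in> fhom F (P \<inter> N) S"
    using fhom_restrict[OF assms(1) carrier_objs R] by auto
  then have "restrict \<phi> (P \<inter> N) ` (P \<inter> N) \<subseteq> N"
    using N R unfolding strongly_closed_def by blast
  with assms(4,5) show ?thesis by auto
qed

text \<open>By factorization the inverse of \<open>\<phi>\<close> on its image is again a morphism,
  and it keeps \<open>N\<close> inside \<open>N\<close>.\<close>

lemma strongly_closed_reflect:
  assumes "P \<in> objs F" "Q \<in> objs F" "\<phi> \<in> fhom F P Q" "u \<in> P" "\<phi> u \<in> N"
  shows "u \<in> N"
proof -
  note im = fhom_image[OF assms(1-3)]
  obtain \<psi> where "\<psi> \<in> fiso F (\<phi> ` P) P" "\<And>u. u \<in> P \<Longrightarrow> \<psi> (\<phi> u) = u"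
    by (rule fiso_inverse[OF assms(1) im]) blast
  then show ?thesis
    using strongly_closed_mem[OF im(1) assms(1) fisoD(1)[OF im(1) assms(1)], of \<psi> "\<phi> u"] assms(4,5)
    by auto
qed

lemma strongly_closed_normal: "N \<lhd> fgrp F"
proof (rule normal_inv_iff[THEN iffD2], intro conjI ballI)
  show "subgroup N (fgrp F)" using objs_subgroup[OF strongly_closed_objs] .
  fix x u assume x: "x \<in> S" and u: "u \<in> N"
  have "conj_by (fgrp F) x ` N \<subseteq> S" using x objs_mem[OF strongly_closed_objs] by auto
  then have "(\<lambda>u\<in>N. conj_by (fgrp F) x u) \<in> fhom F N S"
    using conj_fhom[OF strongly_closed_objs carrier_objs x] by simp
  then show "conj_by (fgrp F) x u \<in> N"
    using strongly_closed_mem[OF strongly_closed_objs carrier_objs _ u u] u by fastforce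
qed

end

end

lemma (in group) rcos_eq_iff:
  assumes "subgroup N G" "x \<in> carrier G" "y \<in> carrier G"
  shows "N #> x = N #> y \<longleftrightarrow> x \<otimes> inv y \<in> N"
  using assms by (metis rcos_self repr_independence subgroup.rcos_module is_group)

text \<open>
  The two closure assumptions are automatic if \<open>S\<close> is finite or if \<open>N\<close> is open in a pro-\<open>p\<close> group.
\<close>

locale strongly_closed_fusion = divisible_fusion F for F :: "'a fusion_data" +
  fixes N
  assumes N: "strongly_closed F N"
    and prod_objs: "P \<in> objs F \<Longrightarrow> N <#>\<^bsub>fgrp F\<^esub> P \<in> objs F"
    and image_N: "\<lbrakk>P \<in> objs F; \<phi> \<in> fhom F P (carrier (fgrp F)); N \<subseteq> P\<rbrakk> \<Longrightarrow> \<phi> ` N = N"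
begin

abbreviation coset_N :: "'a \<Rightarrow> 'a set" where "coset_N x \<equiv> N #>\<^bsub>fgrp F\<^esub> x"

abbreviation prod_N :: "'a set \<Rightarrow> 'a set" where "prod_N P \<equiv> N <#>\<^bsub>fgrp F\<^esub> P"

sublocale normal N "fgrp F"
  by (rule strongly_closed_normal[OF N])

lemma N_objs: "N \<in> objs F"
  using strongly_closed_objs[OF N] .

lemma N_mem: "n \<in> N \<Longrightarrow> n \<in> S"
  using mem_carrier .

lemma coset_eq_iff: "x \<in> S \<Longrightarrow> y \<in> S \<Longrightarrow> coset_N x = coset_N y \<longleftrightarrow> x \<cdot> inv_S y \<in> N"
  using rcos_eq_iff[OF subgroup_axioms] .

lemma coset_eqE:
  assumes "x \<in> S" "y \<in> S" "coset_N x = coset_N y"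
  obtains n where "n \<in> N" "x = n \<cdot> y"
  using assms coset_eq_iff[OF assms(1,2)] N_mem that[of "x \<cdot> inv_S y"] by (simp add: m_assoc)

lemma coset_mult_N: "n \<in> N \<Longrightarrow> x \<in> S \<Longrightarrow> coset_N (n \<cdot> x) = coset_N x"
  using N_mem by (simp add: coset_eq_iff m_assoc)

lemma coset_mult: "x \<in> S \<Longrightarrow> y \<in> S \<Longrightarrow> coset_N (x \<cdot> y) = coset_N x <#>\<^bsub>fgrp F\<^esub> coset_N y"
  by (simp add: rcos_sum)

lemma prod_N_mem: "u \<in> prod_N P \<longleftrightarrow> (\<exists>n\<in>N. \<exists>v\<in>P. u = n \<cdot> v)"
  by (auto simp: set_mult_def)

lemma subset_prod_N: "P \<in> objs F \<Longrightarrow> P \<subseteq> prod_N P"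
proof
  fix u assume P: "P \<in> objs F" and u: "u \<in> P"
  have "u = \<e> \<cdot> u" using objs_mem[OF P u] by simp
  then show "u \<in> prod_N P" using u one_closed unfolding prod_N_mem by blast
qed

lemma N_subset_prod_N: "P \<in> objs F \<Longrightarrow> N \<subseteq> prod_N P"
proof
  fix n assume P: "P \<in> objs F" and n: "n \<in> N"
  have "n = n \<cdot> \<e>" using N_mem[OF n] by simp
  then show "n \<in> prod_N P" using n subgroup.one_closed[OF objs_subgroup[OF P]]
    unfolding prod_N_mem by blast
qed

lemma prod_N_absorb: "P \<in> objs F \<Longrightarrow> N \<subseteq> P \<Longrightarrow> prod_N P = P"
  using subset_prod_N[of P] subgroup.m_closed[OF objs_subgroup[of P]]
  by (auto simp: prod_N_mem subset_iff)

text \<open>The condition under which \<open>\<phi>\<close> induces a morphism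
  \<open>PN/N \<rightarrow> S/N\<close> of \<open>F/N\<close>. A lift need not extend
  \<open>\<phi>\<close>; agreement is demanded modulo \<open>N\<close> and on \<open>P\<close> only,
  which controls the lift on all of \<open>NP\<close> because it maps \<open>N\<close> into
  \<open>N\<close>.\<close>

definition lifts :: "'a set \<Rightarrow> ('a \<Rightarrow> 'a) \<Rightarrow> bool" where
  "lifts P \<phi> \<longleftrightarrow> (\<exists>\<psi>\<in>fhom F (prod_N P) S. \<forall>u\<in>P. coset_N (\<psi> u) = coset_N (\<phi> u))"

text \<open>Makes liftable isomorphisms composable and invertible. The lift reaches all of
  \<open>NR\<close> because it maps \<open>N\<close> onto \<open>N\<close>, by
  \<open>image_N\<close>.\<close>

lemma lifts_fiso:
  assumes P: "P \<in> objs F" and R: "R \<in> objs F" and \<phi>: "\<phi> \<in> fiso F P R" and "lifts P \<phi>"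
  obtains \<psi> where "\<psi> \<in> fiso F (prod_N P) (prod_N R)" "\<And>u. u \<in> P \<Longrightarrow> coset_N (\<psi> u) = coset_N (\<phi> u)"
proof -
  obtain \<psi> where \<psi>: "\<psi> \<in> fhom F (prod_N P) S" "\<And>u. u \<in> P \<Longrightarrow> coset_N (\<psi> u) = coset_N (\<phi> u)"
    using assms unfolding lifts_def by auto
  note NP = prod_objs[OF P] and NR = prod_objs[OF R]
  note h = fhom_memS[OF NP carrier_objs \<psi>(1)] fhom_mult[OF NP carrier_objs \<psi>(1)]
  note \<phi>R = fisoD[OF P R \<phi>]
  have \<phi>S: "\<phi> u \<in> S" if "u \<in> P" for u using fhom_memS[OF P R \<phi>R(1) that] .
  have sub: "u \<in> prod_N P" if "u \<in> P \<or> u \<in> N" for u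
    using that subset_prod_N[OF P] N_subset_prod_N[OF P] by auto
  have "\<psi> ` prod_N P = prod_N R"
  proof (intro equalityI subsetI)
    fix y assume "y \<in> \<psi> ` prod_N P"
    then obtain n u where nu: "n \<in> N" "u \<in> P" "y = \<psi> (n \<cdot> u)" by (auto simp: prod_N_mem)
    obtain m where m: "m \<in> N" "\<psi> u = m \<cdot> \<phi> u"
      using coset_eqE[OF h(1)[OF sub] \<phi>S \<psi>(2)] nu by metis
    have n': "\<psi> n \<in> N" using strongly_closed_mem[OF N NP carrier_objs \<psi>(1) sub] nu by auto
    have "y = (\<psi> n \<cdot> m) \<cdot> \<phi> u"
      using nu m h(2)[OF sub sub] n' N_mem \<phi>S by (simp add: m_assoc)
    moreover have "\<psi> n \<cdot> m \<in> N" using n' m m_closed by simp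
    moreover have "\<phi> u \<in> R" using nu \<phi>R by auto
    ultimately show "y \<in> prod_N R" unfolding prod_N_mem by blast
  next
    fix y assume "y \<in> prod_N R"
    then obtain n u where nu: "n \<in> N" "u \<in> P" "y = n \<cdot> \<phi> u" using \<phi>R by (auto simp: prod_N_mem)
    obtain m where m: "m \<in> N" "\<psi> u = m \<cdot> \<phi> u"
      using coset_eqE[OF h(1)[OF sub] \<phi>S \<psi>(2)] nu by metis
    \<comment> \<open>Here \<open>m\<close> is the deviation of \<open>\<psi> u\<close> from
      \<open>\<phi> u\<close>. Solving \<open>\<psi> k = n \<cdot> inv_S m\<close> with
      \<open>k\<close> in \<open>N\<close> cancels it, so that \<open>k \<cdot> u\<close> is sent to
      \<open>n \<cdot> \<phi> u\<close>.\<close>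
    have "n \<cdot> inv_S m \<in> N" using nu m by (simp add: m_inv_closed)
    then obtain k where k: "k \<in> N" "n \<cdot> inv_S m = \<psi> k"
      using image_N[OF NP \<psi>(1) N_subset_prod_N[OF P]] by blast
    have "\<psi> (k \<cdot> u) = n \<cdot> inv_S m \<cdot> (m \<cdot> \<phi> u)"
      using k m nu h(2)[OF sub sub] by simp
    moreover have "inv_S m \<cdot> (m \<cdot> \<phi> u) = \<phi> u"
      using m N_mem \<phi>S[OF nu(2)] by (simp flip: m_assoc)
    ultimately have "\<psi> (k \<cdot> u) = y" using nu m N_mem \<phi>S[OF nu(2)] by (simp add: m_assoc)
    then show "y \<in> \<psi> ` prod_N P" using k(1) nu(2) by (intro image_eqI[where x = "k \<cdot> u"]) (auto simp: prod_N_mem)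
  qed
  moreover have "\<psi> \<in> fhom F (prod_N P) (prod_N R)"
    using fhom_codomain[OF NP carrier_objs NR \<psi>(1)] calculation by auto
  ultimately show ?thesis using that fiso_iff[OF NP NR] \<psi>(2) by blast
qed

text \<open>The first lift deviates from \<open>\<phi>\<close> by an element of \<open>N\<close>,
  and the second lift keeps this deviation inside the strongly closed \<open>N\<close>.\<close>

lemma lifts_compose:
  assumes P: "P \<in> objs F" and Q: "Q \<in> objs F" and R: "R \<in> objs F"
    and \<phi>: "\<phi> \<in> fiso F P Q" "lifts P \<phi>" and \<chi>: "\<chi> \<in> fiso F Q R" "lifts Q \<chi>"
  shows "lifts P (compose P \<chi> \<phi>)"
proof -
  obtain \<psi> where \<psi>: "\<psi> \<in> fiso F (prod_N P) (prod_N Q)" "\<And>u. u \<in> P \<Longrightarrow> coset_N (\<psi> u) = coset_N (\<phi> u)"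
    using lifts_fiso[OF P Q \<phi>] by blast
  obtain \<theta> where \<theta>: "\<theta> \<in> fhom F (prod_N Q) S" "\<And>u. u \<in> Q \<Longrightarrow> coset_N (\<theta> u) = coset_N (\<chi> u)"
    using \<chi> unfolding lifts_def by auto
  note NP = prod_objs[OF P] and NQ = prod_objs[OF Q]
  note \<psi>h = fisoD(1)[OF NP NQ \<psi>(1)]
  have comp: "compose (prod_N P) \<theta> \<psi> \<in> fhom F (prod_N P) S"
    using fhom_compose[OF NP NQ carrier_objs \<psi>h \<theta>(1)] .
  have "coset_N (compose (prod_N P) \<theta> \<psi> u) = coset_N (compose P \<chi> \<phi> u)" if u: "u \<in> P" for u
  proof -
    have uN: "u \<in> prod_N P" using u subset_prod_N[OF P] by auto
    have \<phi>u: "\<phi> u \<in> Q" using fhom_mem[OF P Q fisoD(1)[OF P Q \<phi>(1)] u] .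
    then have \<phi>uN: "\<phi> u \<in> prod_N Q" using subset_prod_N[OF Q] by auto
    obtain m where m: "m \<in> N" "\<psi> u = m \<cdot> \<phi> u"
      using coset_eqE[OF fhom_memS[OF NP NQ \<psi>h uN] objs_mem[OF Q \<phi>u] \<psi>(2)[OF u]] .
    have mN: "m \<in> prod_N Q" using m N_subset_prod_N[OF Q] by auto
    have "\<theta> (\<psi> u) = \<theta> m \<cdot> \<theta> (\<phi> u)"
      using m fhom_mult[OF NQ carrier_objs \<theta>(1) mN \<phi>uN] by simp
    moreover have "\<theta> m \<in> N" using strongly_closed_mem[OF N NQ carrier_objs \<theta>(1) mN m(1)] .
    ultimately have "coset_N (\<theta> (\<psi> u)) = coset_N (\<theta> (\<phi> u))"
      using coset_mult_N fhom_memS[OF NQ carrier_objs \<theta>(1) \<phi>uN] by simp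
    then show ?thesis using u uN \<theta>(2)[OF \<phi>u] by (simp add: compose_def)
  qed
  with comp show ?thesis unfolding lifts_def by blast
qed

lemma lifts_inverse:
  assumes P: "P \<in> objs F" and Q: "Q \<in> objs F" and \<phi>: "\<phi> \<in> fiso F P Q" "lifts P \<phi>"
    and \<chi>: "\<chi> \<in> fiso F Q P" and inv: "\<And>u. u \<in> P \<Longrightarrow> \<chi> (\<phi> u) = u"
  shows "lifts Q \<chi>"
proof -
  obtain \<psi> where \<psi>: "\<psi> \<in> fiso F (prod_N P) (prod_N Q)" "\<And>u. u \<in> P \<Longrightarrow> coset_N (\<psi> u) = coset_N (\<phi> u)"
    using lifts_fiso[OF P Q \<phi>] by blast
  note NP = prod_objs[OF P] and NQ = prod_objs[OF Q]
  obtain \<theta> where \<theta>: "\<theta> \<in> fiso F (prod_N Q) (prod_N P)" "\<And>u. u \<in> prod_N P \<Longrightarrow> \<theta> (\<psi> u) = u"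
    using fiso_inverse[OF NP NQ \<psi>(1)] by metis
  note \<theta>h = fisoD(1)[OF NQ NP \<theta>(1)]
  note \<psi>h = fisoD(1)[OF NP NQ \<psi>(1)]
  have "coset_N (\<theta> v) = coset_N (\<chi> v)" if v: "v \<in> Q" for v
  proof -
    obtain u where u: "u \<in> P" "v = \<phi> u" using v fisoD(2)[OF P Q \<phi>(1)] by auto
    have uN: "u \<in> prod_N P" using u subset_prod_N[OF P] by auto
    have vN: "v \<in> prod_N Q" using v subset_prod_N[OF Q] by auto
    obtain m where m: "m \<in> N" "v = m \<cdot> \<psi> u"
      using coset_eqE[OF objs_mem[OF Q v] fhom_memS[OF NP NQ \<psi>h uN]] \<psi>(2)[OF u(1)] u(2) by metis
    have mN: "m \<in> prod_N Q" using m N_subset_prod_N[OF Q] by auto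
    have "\<theta> v = \<theta> m \<cdot> u"
      using m fhom_mult[OF NQ NP \<theta>h mN fhom_mem[OF NP NQ \<psi>h uN]] \<theta>(2)[OF uN] by simp
    moreover have "\<theta> m \<in> N" using strongly_closed_mem[OF N NQ NP \<theta>h mN m(1)] .
    ultimately show ?thesis using coset_mult_N objs_mem[OF P u(1)] inv[OF u(1)] u(2) by simp
  qed
  moreover have "\<theta> \<in> fhom F (prod_N Q) S"
    using fhom_codomain[OF NQ NP carrier_objs \<theta>h] fhom_memS[OF NQ NP \<theta>h] by auto
  ultimately show ?thesis unfolding lifts_def by blast
qed

text \<open>Passes from an extension to the map itself, as \<open>NP \<subseteq> NR\<close>. With
  \<open>R = P\<close> it also replaces a composite by a map that agrees with it on
  \<open>P\<close>.\<close>

lemma lifts_restrict: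
  assumes P: "P \<in> objs F" and R: "R \<in> objs F" and "P \<subseteq> R" and "lifts R \<chi>"
    and eq: "\<And>u. u \<in> P \<Longrightarrow> \<phi> u = \<chi> u"
  shows "lifts P \<phi>"
proof -
  obtain \<psi> where \<psi>: "\<psi> \<in> fhom F (prod_N R) S" "\<And>u. u \<in> R \<Longrightarrow> coset_N (\<psi> u) = coset_N (\<chi> u)"
    using \<open>lifts R \<chi>\<close> unfolding lifts_def by auto
  have "prod_N P \<subseteq> prod_N R" using \<open>P \<subseteq> R\<close> by (rule mono_set_mult[OF subset_refl])
  then have "restrict \<psi> (prod_N P) \<in> fhom F (prod_N P) S"
    using fhom_restrict[OF prod_objs[OF R] carrier_objs prod_objs[OF P] \<psi>(1)] by simp
  moreover have "coset_N (restrict \<psi> (prod_N P) u) = coset_N (\<phi> u)" if "u \<in> P" for u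
    using that subset_prod_N[OF P] \<psi>(2) eq \<open>P \<subseteq> R\<close> by auto
  ultimately show ?thesis unfolding lifts_def by blast
qed

text \<open>The lift is the inclusion of \<open>NP\<close> in \<open>S\<close>. This covers the
  automorphisms that are trivial modulo \<open>N\<close>.\<close>

lemma lifts_trivial:
  assumes P: "P \<in> objs F" and "\<And>u. u \<in> P \<Longrightarrow> coset_N (\<phi> u) = coset_N u"
  shows "lifts P \<phi>"
proof -
  have "(\<lambda>u\<in>prod_N P. u) \<in> fhom F (prod_N P) S"
    using fhom_inclusion[OF prod_objs[OF P] carrier_objs objs_subset[OF prod_objs[OF P]]] .
  moreover have "coset_N ((\<lambda>u\<in>prod_N P. u) u) = coset_N (\<phi> u)" if "u \<in> P" for u
    using that subset_prod_N[OF P] assms(2) by auto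
  ultimately show ?thesis unfolding lifts_def by blast
qed

end

section \<open>Finite saturated fusion systems\<close>

context fusion_system
begin

lemma finite_S: "finite S"
  using p_group by (simp add: finite_p_group_def)

lemma objs_iff: "P \<in> objs F \<longleftrightarrow> subgroup P (fgrp F)"
  using subgroup.subset[of P "fgrp F"] by (auto simp: objs_def discrete)

lemma finite_objs: "P \<in> objs F \<Longrightarrow> finite P"
  using objs_subset finite_S finite_subset by metis

lemma card_objs:
  assumes "prime p" "P \<in> objs F"
  obtains k where "card P = p ^ k"
proof -
  have "card P dvd order (fgrp F)"
    using lagrange[OF objs_subgroup[OF assms(2)]] by (metis dvd_triv_right)
  moreover obtain n where "order (fgrp F) = p ^ n" using p_group by (auto simp: finite_p_group_def)
  ultimately show ?thesis using that divides_primepow_nat[OF assms(1)] by auto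
qed

lemma strongly_closed_fusionI:
  assumes N: "strongly_closed F N"
  shows "strongly_closed_fusion F N"
proof
  show "strongly_closed F N" by (rule N)
  fix P assume P: "P \<in> objs F"
  show "N <#>\<^bsub>fgrp F\<^esub> P \<in> objs F"
    using mult_norm_subgroup[OF strongly_closed_normal[OF N] objs_subgroup[OF P]] by (simp add: objs_iff)
  fix \<phi> assume \<phi>: "\<phi> \<in> fhom F P S" and NP: "N \<subseteq> P"
  have "\<phi> ` N \<subseteq> N" using strongly_closed_mem[OF N P carrier_objs \<phi>] NP by auto
  moreover have "inj_on \<phi> N" using fhom_inj[OF P carrier_objs \<phi>] NP by (rule inj_on_subset)
  moreover have "finite N" using finite_objs[OF strongly_closed_objs[OF N]] .
  ultimately show "\<phi> ` N = N" by (rule endo_inj_surj[rotated 1])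
qed

lemma normalizer_objs: "Q \<in> objs F \<Longrightarrow> normalizer (fgrp F) Q \<in> objs F"
  using normalizer_imp_subgroup[OF objs_subset] by (simp add: objs_iff)

lemma normalizer_iff:
  assumes "Q \<in> objs F"
  shows "x \<in> normalizer (fgrp F) Q \<longleftrightarrow> x \<in> S \<and> (\<forall>u\<in>Q. conj_by (fgrp F) x u \<in> Q)"
  using normalizer_memI[OF objs_subset[OF assms] _ finite_objs[OF assms]]
    normalizer_memD[OF objs_subset[OF assms]] by blast

lemma subset_normalizer: "Q \<in> objs F \<Longrightarrow> Q \<subseteq> normalizer (fgrp F) Q"
  using objs_subgroup objs_mem by (auto simp: normalizer_iff subgroup.m_closed subgroup.m_inv_closed)

lemma conj_conj:
  "x \<in> S \<Longrightarrow> y \<in> S \<Longrightarrow> u \<in> S \<Longrightarrow> conj_by (fgrp F) (x \<cdot> y) u = conj_by (fgrp F) x (conj_by (fgrp F) y u)"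
  by (simp add: m_assoc inv_mult_group)

lemma conj_inv: "x \<in> S \<Longrightarrow> u \<in> S \<Longrightarrow> conj_by (fgrp F) (inv_S x) (conj_by (fgrp F) x u) = u"
  using conj_conj[of "inv_S x" x u] by simp

lemma ext_dom_objs:
  assumes R: "R \<in> objs F" and Q: "Q \<in> objs F" and \<phi>: "\<phi> \<in> fhom F R Q"
  shows "ext_dom F R Q \<phi> \<in> objs F" "R \<subseteq> ext_dom F R Q \<phi>"
proof -
  note NR = objs_subgroup[OF normalizer_objs[OF R]] and NQ = objs_subgroup[OF normalizer_objs[OF Q]]
  note nR = normalizer_iff[OF R] and nQ = normalizer_iff[OF Q]
  note \<phi>Q = fhom_mem[OF R Q \<phi>] and \<phi>S = fhom_memS[OF R Q \<phi>]
  show "R \<subseteq> ext_dom F R Q \<phi>"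
  proof
    fix x assume x: "x \<in> R"
    \<comment> \<open>For \<open>x\<close> in \<open>R\<close> the witness \<open>y\<close> demanded
      by \<open>ext_dom\<close> is \<open>\<phi> x\<close>.\<close>
    have "\<phi> (conj_by (fgrp F) x u) = conj_by (fgrp F) (\<phi> x) (\<phi> u)" if "u \<in> R" for u
      using that x fhom_mult[OF R Q \<phi>] fhom_inv[OF R Q \<phi>] objs_subgroup[OF R]
      by (simp add: subgroup.m_closed subgroup.m_inv_closed)
    then show "x \<in> ext_dom F R Q \<phi>"
      using x \<phi>Q[OF x] subset_normalizer[OF R] subset_normalizer[OF Q] unfolding ext_dom_def by blast
  qed
  have "subgroup (ext_dom F R Q \<phi>) (fgrp F)"
  proof (rule subgroupI)
    show "ext_dom F R Q \<phi> \<subseteq> S" by (auto simp: ext_dom_def nR)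
    show "ext_dom F R Q \<phi> \<noteq> {}"
      using \<open>R \<subseteq> _\<close> subgroup.one_closed[OF objs_subgroup[OF R]] by auto
  next
    fix x assume "x \<in> ext_dom F R Q \<phi>"
    then obtain y where x: "x \<in> normalizer (fgrp F) R" and y: "y \<in> normalizer (fgrp F) Q"
      and xy: "\<And>u. u \<in> R \<Longrightarrow> \<phi> (conj_by (fgrp F) x u) = conj_by (fgrp F) y (\<phi> u)"
      unfolding ext_dom_def by auto
    have x': "inv_S x \<in> normalizer (fgrp F) R" and y': "inv_S y \<in> normalizer (fgrp F) Q"
      using x y NR NQ by (simp_all add: subgroup.m_inv_closed)
    have xyS: "x \<in> S" "y \<in> S" using x y nR nQ by auto
    have "\<phi> (conj_by (fgrp F) (inv_S x) u) = conj_by (fgrp F) (inv_S y) (\<phi> u)" if u: "u \<in> R" for u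
    proof -
      define w where "w = conj_by (fgrp F) (inv_S x) u"
      have w: "w \<in> R" using x' u nR unfolding w_def by blast
      have "conj_by (fgrp F) x w = u"
        using conj_inv[of "inv_S x" u] xyS objs_mem[OF R u] unfolding w_def by simp
      then have "\<phi> u = conj_by (fgrp F) y (\<phi> w)" using xy[OF w] by simp
      then show ?thesis using conj_inv[OF xyS(2) \<phi>S[OF w]] unfolding w_def by simp
    qed
    then show "inv_S x \<in> ext_dom F R Q \<phi>" using x' y' unfolding ext_dom_def by blast
  next
    fix x z assume "x \<in> ext_dom F R Q \<phi>"
    then obtain y where x: "x \<in> normalizer (fgrp F) R" and y: "y \<in> normalizer (fgrp F) Q"
      and xy: "\<And>u. u \<in> R \<Longrightarrow> \<phi> (conj_by (fgrp F) x u) = conj_by (fgrp F) y (\<phi> u)"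
      unfolding ext_dom_def by auto
    assume "z \<in> ext_dom F R Q \<phi>"
    then obtain y' where x': "z \<in> normalizer (fgrp F) R" and y': "y' \<in> normalizer (fgrp F) Q"
      and xy': "\<And>u. u \<in> R \<Longrightarrow> \<phi> (conj_by (fgrp F) z u) = conj_by (fgrp F) y' (\<phi> u)"
      unfolding ext_dom_def by auto
    have S: "x \<in> S" "y \<in> S" "z \<in> S" "y' \<in> S" using x y x' y' nR nQ by auto
    have "\<phi> (conj_by (fgrp F) (x \<cdot> z) u) = conj_by (fgrp F) (y \<cdot> y') (\<phi> u)" if u: "u \<in> R" for u
    proof -
      have zu: "conj_by (fgrp F) z u \<in> R" using x' u nR by blast
      show ?thesis
        using xy[OF zu] xy'[OF u] conj_conj[OF S(1,3) objs_mem[OF R u]] conj_conj[OF S(2,4) \<phi>S[OF u]] by simp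
    qed
    moreover have "x \<cdot> z \<in> normalizer (fgrp F) R" "y \<cdot> y' \<in> normalizer (fgrp F) Q"
      using x x' y y' NR NQ by (simp_all add: subgroup.m_closed)
    ultimately show "x \<cdot> z \<in> ext_dom F R Q \<phi>" unfolding ext_dom_def by blast
  qed
  then show "ext_dom F R Q \<phi> \<in> objs F" by (simp add: objs_iff)
qed

lemma conj_fiso:
  assumes R: "R \<in> objs F" and x: "x \<in> normalizer (fgrp F) R"
  shows "(\<lambda>u\<in>R. conj_by (fgrp F) x u) \<in> fiso F R R"
proof -
  have x': "x \<in> S" "\<And>u. u \<in> R \<Longrightarrow> conj_by (fgrp F) x u \<in> R" using x normalizer_iff[OF R] by auto
  then have f: "(\<lambda>u\<in>R. conj_by (fgrp F) x u) \<in> fhom F R R"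
    by (intro conj_fhom R) auto
  moreover have "(\<lambda>u\<in>R. conj_by (fgrp F) x u) ` R = R"
    using fhom_inj[OF R R f] fhom_mem[OF R R f] finite_objs[OF R] by (intro endo_inj_surj) blast+
  ultimately show ?thesis using fiso_iff[OF R R] by simp
qed

lemma id_fiso: "R \<in> objs F \<Longrightarrow> (\<lambda>u\<in>R. u) \<in> fiso F R R"
  using fiso_iff fhom_id by auto

section \<open>Automorphism groups in a finite fusion system\<close>

context
  fixes Q assumes Q: "Q \<in> objs F"
begin

lemma carrier_Aut: "carrier (Aut_grp F Q) = fiso F Q Q"
  by (simp add: Aut_grp_def)

lemma fiso_Bij: "a \<in> fiso F Q Q \<Longrightarrow> a \<in> Bij Q"
  using fiso_iff[OF Q Q] fhom_extensional[OF Q Q] fhom_inj[OF Q Q]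
  by (auto simp: Bij_def bij_betw_def)

lemma mult_Aut: "a \<in> fiso F Q Q \<Longrightarrow> b \<in> fiso F Q Q \<Longrightarrow> a \<otimes>\<^bsub>Aut_grp F Q\<^esub> b = compose Q a b"
  using fiso_Bij by (simp add: Aut_grp_def BijGroup_def)

lemma group_Aut: "group (Aut_grp F Q)"
proof (rule groupI)
  have one: "\<one>\<^bsub>Aut_grp F Q\<^esub> = (\<lambda>u\<in>Q. u)" by (simp add: Aut_grp_def BijGroup_def)
  show "\<one>\<^bsub>Aut_grp F Q\<^esub> \<in> carrier (Aut_grp F Q)"
    using id_fiso[OF Q] by (simp add: one carrier_Aut)
  fix a b c assume a: "a \<in> carrier (Aut_grp F Q)" and b: "b \<in> carrier (Aut_grp F Q)"
    and c: "c \<in> carrier (Aut_grp F Q)"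
  show "a \<otimes>\<^bsub>Aut_grp F Q\<^esub> b \<in> carrier (Aut_grp F Q)"
    using a b fiso_compose[OF Q Q Q] by (simp add: carrier_Aut mult_Aut)
  have "compose Q (compose Q a b) c = compose Q a (compose Q b c)"
    by (rule compose_assoc[OF Bij_imp_funcset[OF fiso_Bij], symmetric]) (use c in \<open>simp add: carrier_Aut\<close>)
  then show "a \<otimes>\<^bsub>Aut_grp F Q\<^esub> b \<otimes>\<^bsub>Aut_grp F Q\<^esub> c = a \<otimes>\<^bsub>Aut_grp F Q\<^esub> (b \<otimes>\<^bsub>Aut_grp F Q\<^esub> c)"
    using a b c fiso_compose[OF Q Q Q] by (simp add: carrier_Aut mult_Aut)
  show "\<one>\<^bsub>Aut_grp F Q\<^esub> \<otimes>\<^bsub>Aut_grp F Q\<^esub> a = a"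
    using a id_fiso[OF Q] fiso_Bij by (simp add: one carrier_Aut mult_Aut Bij_imp_funcset Bij_imp_extensional)
  obtain \<psi> where "\<psi> \<in> fiso F Q Q" "\<And>u. u \<in> Q \<Longrightarrow> \<psi> (a u) = u"
    by (rule fiso_inverse[OF Q Q a[unfolded carrier_Aut]]) blast
  then have "\<psi> \<in> carrier (Aut_grp F Q)" "\<psi> \<otimes>\<^bsub>Aut_grp F Q\<^esub> a = \<one>\<^bsub>Aut_grp F Q\<^esub>"
    using a by (auto simp: one carrier_Aut mult_Aut compose_def)
  then show "\<exists>\<psi>\<in>carrier (Aut_grp F Q). \<psi> \<otimes>\<^bsub>Aut_grp F Q\<^esub> a = \<one>\<^bsub>Aut_grp F Q\<^esub>" by blast
qed

lemma finite_Aut: "finite (carrier (Aut_grp F Q))"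
proof (rule finite_subset)
  show "carrier (Aut_grp F Q) \<subseteq> Q \<rightarrow>\<^sub>E Q"
    using fiso_Bij by (auto simp: carrier_Aut PiE_def Bij_imp_extensional dest: Bij_imp_funcset)
  show "finite (Q \<rightarrow>\<^sub>E Q)" using finite_objs[OF Q] by (simp add: finite_PiE)
qed

text \<open>Rewrites a conjugation in \<open>Aut_grp\<close> as \<open>ab = ca\<close> evaluated at
  points, the shape in which \<open>ext_dom\<close> compares an isomorphism with
  conjugations.\<close>

lemma Aut_mult_eq_iff:
  assumes "a \<in> fiso F Q Q" "b \<in> fiso F Q Q" "c \<in> fiso F Q Q"
  shows "a \<otimes>\<^bsub>Aut_grp F Q\<^esub> b \<otimes>\<^bsub>Aut_grp F Q\<^esub> inv\<^bsub>Aut_grp F Q\<^esub> a = c \<longleftrightarrow> (\<forall>v\<in>Q. a (b v) = c (a v))"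
proof -
  interpret A: group "Aut_grp F Q" by (rule group_Aut)
  have "a \<otimes>\<^bsub>Aut_grp F Q\<^esub> b \<otimes>\<^bsub>Aut_grp F Q\<^esub> inv\<^bsub>Aut_grp F Q\<^esub> a = c
      \<longleftrightarrow> a \<otimes>\<^bsub>Aut_grp F Q\<^esub> b = c \<otimes>\<^bsub>Aut_grp F Q\<^esub> a"
    using assms by (metis A.inv_solve_right A.m_closed carrier_Aut)
  also have "\<dots> \<longleftrightarrow> compose Q a b = compose Q c a" using assms by (simp add: mult_Aut)
  also have "\<dots> \<longleftrightarrow> (\<forall>v\<in>Q. a (b v) = c (a v))"
    by (auto simp: compose_def fun_eq_iff)
  finally show ?thesis .
qed

end

text \<open>
  Sylow's theorem moves the \<open>\<rho>\<close>-conjugate of \<open>Aut\<^sub>S(R)\<close> into \<open>Aut\<^sub>S(Q)\<close>.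
\<close>

lemma ext_dom_eq_normalizer:
  assumes p: "prime p" and R: "R \<in> objs F" and Q: "Q \<in> objs F" and \<rho>: "\<rho> \<in> fiso F R Q"
    and T: "sylow_subgroup p (Aut_S F Q) (Aut_grp F Q)"
  obtains \<alpha> where "\<alpha> \<in> fiso F Q Q" "ext_dom F R Q (compose R \<alpha> \<rho>) = normalizer (fgrp F) R"
proof -
  interpret A: group "Aut_grp F Q" using group_Aut[OF Q] .
  obtain \<rho>' where \<rho>': "\<rho>' \<in> fiso F Q R" "\<And>u. u \<in> R \<Longrightarrow> \<rho>' (\<rho> u) = u" "\<And>v. v \<in> Q \<Longrightarrow> \<rho> (\<rho>' v) = v"
    by (rule fiso_inverse[OF R Q \<rho>]) blast
  let ?B = "(fgrp F)\<lparr>carrier := normalizer (fgrp F) R\<rparr>"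
  \<comment> \<open>\<open>h x\<close> is conjugation by \<open>x\<close>, transported to
    \<open>Q\<close> along \<open>\<rho>\<close>. On the normalizer of \<open>R\<close> this is a
    homomorphism whose image is the \<open>\<rho>\<close>-conjugate of
    \<open>Aut_S F R\<close>.\<close>
  define h where "h x = compose Q \<rho> (compose Q (\<lambda>u\<in>R. conj_by (fgrp F) x u) \<rho>')" for x
  have h_fiso: "h x \<in> fiso F Q Q" if "x \<in> normalizer (fgrp F) R" for x
    unfolding h_def using fiso_compose[OF Q R Q fiso_compose[OF Q R R \<rho>'(1) conj_fiso[OF R that]] \<rho>] .
  have \<rho>'R: "\<rho>' v \<in> R" if "v \<in> Q" for v using fhom_mem[OF Q R fisoD(1)[OF Q R \<rho>'(1)] that] .
  have \<rho>Q: "\<rho> u \<in> Q" if "u \<in> R" for u using fhom_mem[OF R Q fisoD(1)[OF R Q \<rho>] that] .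
  have h_apply: "h x (\<rho> u) = \<rho> (conj_by (fgrp F) x u)" if "u \<in> R" for x u
    using that \<rho>Q \<rho>' by (simp add: h_def compose_def)
  have h_hom: "h \<in> hom ?B (Aut_grp F Q)"
  proof (rule homI)
    fix x assume "x \<in> carrier ?B"
    then show "h x \<in> carrier (Aut_grp F Q)" using h_fiso by (simp add: carrier_Aut[OF Q])
  next
    fix x y assume "x \<in> carrier ?B" "y \<in> carrier ?B"
    then have xy: "x \<in> normalizer (fgrp F) R" "y \<in> normalizer (fgrp F) R" by auto
    have "h (x \<cdot> y) = compose Q (h x) (h y)"
    proof (rule extensionalityI)
      show "h (x \<cdot> y) \<in> extensional Q" "compose Q (h x) (h y) \<in> extensional Q"
        by (simp_all add: h_def)
      fix v assume "v \<in> Q"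
      then obtain u where u: "u \<in> R" "v = \<rho> u" using \<rho>'(3) \<rho>'R by metis
      then show "h (x \<cdot> y) v = compose Q (h x) (h y) v"
        using h_apply xy \<open>v \<in> Q\<close> normalizer_iff[OF R] conj_conj[of x y u] objs_mem[OF R]
        by (simp add: compose_def)
    qed
    then show "h (x \<otimes>\<^bsub>?B\<^esub> y) = h x \<otimes>\<^bsub>Aut_grp F Q\<^esub> h y"
      using mult_Aut[OF Q] h_fiso xy by simp
  qed
  obtain k where k: "order ?B = p ^ k"
    using card_objs[OF p normalizer_objs[OF R]] by (auto simp: order_def)
  have subT: "subgroup (Aut_S F Q) (Aut_grp F Q)" using T by (simp add: sylow_subgroup_def)
  have "\<not> p dvd card (rcosets\<^bsub>Aut_grp F Q\<^esub> (Aut_S F Q))"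
    using A.sylow_index_in_subgroup[OF p finite_Aut[OF Q] T A.subgroup_self] subgroup.subset[OF subT]
    by simp
  then obtain \<alpha> where \<alpha>: "\<alpha> \<in> fiso F Q Q" and \<alpha>T:
    "\<And>x. x \<in> normalizer (fgrp F) R \<Longrightarrow>
      \<alpha> \<otimes>\<^bsub>Aut_grp F Q\<^esub> h x \<otimes>\<^bsub>Aut_grp F Q\<^esub> inv\<^bsub>Aut_grp F Q\<^esub> \<alpha> \<in> Aut_S F Q"
    using A.p_group_hom_conj_subset[OF p finite_Aut[OF Q]
        subgroup_imp_group[OF objs_subgroup[OF normalizer_objs[OF R]]] k h_hom subT]
    by (auto simp: carrier_Aut[OF Q])
  \<comment> \<open>If \<open>\<alpha>\<close> conjugates \<open>h x\<close> into conjugation by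
    some \<open>y\<close> in the normalizer of \<open>Q\<close>, then this \<open>y\<close> is the
    witness for \<open>x\<close>.\<close>
  have "x \<in> ext_dom F R Q (compose R \<alpha> \<rho>)" if x: "x \<in> normalizer (fgrp F) R" for x
  proof -
    obtain y where y: "y \<in> normalizer (fgrp F) Q"
      "\<alpha> \<otimes>\<^bsub>Aut_grp F Q\<^esub> h x \<otimes>\<^bsub>Aut_grp F Q\<^esub> inv\<^bsub>Aut_grp F Q\<^esub> \<alpha> = (\<lambda>u\<in>Q. conj_by (fgrp F) y u)"
      using \<alpha>T[OF x] unfolding Aut_S_def by auto
    have eq: "\<alpha> (h x v) = (\<lambda>u\<in>Q. conj_by (fgrp F) y u) (\<alpha> v)" if "v \<in> Q" for v
      using y Aut_mult_eq_iff[OF Q \<alpha> h_fiso[OF x] conj_fiso[OF Q y(1)]] that by blast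
    have "compose R \<alpha> \<rho> (conj_by (fgrp F) x u) = conj_by (fgrp F) y (compose R \<alpha> \<rho> u)" if u: "u \<in> R" for u
      using eq[OF \<rho>Q[OF u]] h_apply[OF u] x u normalizer_iff[OF R]
        fhom_mem[OF Q Q fisoD(1)[OF Q Q \<alpha>] \<rho>Q[OF u]] by (simp add: compose_def)
    with x y show ?thesis unfolding ext_dom_def by blast
  qed
  then have "ext_dom F R Q (compose R \<alpha> \<rho>) = normalizer (fgrp F) R"
    by (auto simp: ext_dom_def)
  with \<alpha> that show ?thesis by blast
qed

lemma normalizer_grows:
  assumes p: "prime p" and H: "H \<in> objs F" and K: "K \<in> objs F" and HK: "H \<subset> K"
  obtains x where "x \<in> K - H" "x \<in> normalizer (fgrp F) H"
proof -
  interpret K: group "(fgrp F)\<lparr>carrier := K\<rparr>"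
    using subgroup_imp_group[OF objs_subgroup[OF K]] .
  obtain n where "card K = p ^ n" using card_objs[OF p K] .
  then have "order ((fgrp F)\<lparr>carrier := K\<rparr>) = p ^ n" by (simp add: order_def)
  from K.p_group_normalizer_grows[OF p this subgroup_incl[OF objs_subgroup[OF H] objs_subgroup[OF K]]] HK
  obtain x where "x \<in> K - H" "\<forall>h\<in>H. conj_by ((fgrp F)\<lparr>carrier := K\<rparr>) x h \<in> H" by auto
  moreover from this have "x \<in> normalizer (fgrp F) H"
    using normalizer_iff[OF H] objs_mem[OF K] m_inv_consistent[OF objs_subgroup[OF K]] by auto
  ultimately show ?thesis using that by blast
qed

end

theorem saturated_lifts:
  assumes p: "prime p" and sat: "saturated p F" and N: "strongly_closed F N"
    and P: "P \<in> objs F" and \<phi>: "\<phi> \<in> fhom F P (carrier (fgrp F))"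
  shows "\<exists>\<psi>\<in>fhom F (N <#>\<^bsub>fgrp F\<^esub> P) (carrier (fgrp F)).
    \<forall>u\<in>P. N #>\<^bsub>fgrp F\<^esub> \<psi> u = N #>\<^bsub>fgrp F\<^esub> \<phi> u"
proof -
  interpret fusion_system p F using sat by (simp add: saturated_def)
  interpret strongly_closed_fusion F N using strongly_closed_fusionI[OF N] .
  have "lifts P \<phi>"
    using P \<phi>
  proof (induction "card S - card P" arbitrary: P \<phi> rule: less_induct)
    case less
    note P = less.prems(1) and \<phi> = less.prems(2)
    have IH: "lifts R \<chi>" if "R \<in> objs F" "\<chi> \<in> fhom F R S" "card P < card R" for R \<chi>
    proof -
      have "card R \<le> card S" using objs_subset[OF that(1)] finite_S by (rule card_mono[rotated])
      then show ?thesis using less.hyps[OF _ that(1,2)] that(3) by simp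
    qed
    have iso_card: "card R = card R'" if "R \<in> objs F" "R' \<in> objs F" "\<chi> \<in> fiso F R R'" for R R' \<chi>
      using fisoD[OF that] fhom_inj[OF that(1,2)] card_image by metis
    show ?case
    proof (cases "N \<subseteq> P")
      \<comment> \<open>Here \<open>NP = P\<close>, so \<open>\<phi>\<close> is its own lift. This
        includes \<open>P = S\<close>, where the induction starts.\<close>
      case True
      then have "prod_N P = P" using prod_N_absorb[OF P] by simp
      then show ?thesis using \<phi> unfolding lifts_def by auto
    next
      case False
      obtain Q \<iota> where Q: "Q \<in> objs F" "\<iota> \<in> fiso F P Q" "fully_normalized p F Q"
        using sat P unfolding saturated_def by blast
      have rec: "receptive F Q" and T: "sylow_subgroup p (Aut_S F Q) (Aut_grp F Q)"
        using Q by (auto simp: fully_normalized_def)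
      have cQ: "card Q = card P" using iso_card[OF P Q(1,2)] by simp
      \<comment> \<open>Receptivity extends \<open>\<chi>\<close> to \<open>ext_dom\<close>, which
        is larger than \<open>R\<close>. Since \<open>R\<close>, \<open>Q\<close> and
        \<open>P\<close> have the same order, the induction hypothesis applies to the
        extension.\<close>
      have extends: "lifts R \<chi>"
        if R: "R \<in> objs F" and \<chi>: "\<chi> \<in> fiso F R Q" and big: "R \<subset> ext_dom F R Q \<chi>" for R \<chi>
      proof -
        note E = ext_dom_objs[OF R Q(1) fisoD(1)[OF R Q(1) \<chi>]]
        obtain \<psi> where \<psi>: "\<psi> \<in> fhom F (ext_dom F R Q \<chi>) (normalizer (fgrp F) Q)" "restrict \<psi> R = \<chi>"
          using rec R \<chi> unfolding receptive_def by blast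
        note NQ = normalizer_objs[OF Q(1)]
        have "\<psi> \<in> fhom F (ext_dom F R Q \<chi>) S"
          using fhom_codomain[OF E(1) NQ carrier_objs \<psi>(1)] fhom_memS[OF E(1) NQ \<psi>(1)] by auto
        moreover have "card P < card (ext_dom F R Q \<chi>)"
          using psubset_card_mono[OF finite_objs[OF E(1)] big] iso_card[OF R Q(1) \<chi>] cQ by simp
        ultimately have "lifts (ext_dom F R Q \<chi>) \<psi>" using IH[OF E(1)] by blast
        then show ?thesis
          using lifts_restrict[OF R E(1,2)] \<psi>(2) by (metis restrict_apply')
      qed
      \<comment> \<open>Isomorphisms carry \<open>N\<close> onto \<open>N\<close>, so
        \<open>Q\<close> fails to contain \<open>N\<close> just as \<open>P\<close> does. Hence
        \<open>prod_N Q\<close> is strictly larger than \<open>Q\<close>, and the normalizer of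
        \<open>Q\<close> grows inside it.\<close>
      have NQ: "\<not> N \<subseteq> Q"
      proof
        assume "N \<subseteq> Q"
        obtain \<iota>' where \<iota>': "\<iota>' \<in> fiso F Q P" using fiso_inverse[OF P Q(1,2)] by metis
        note \<iota>'h = fisoD[OF Q(1) P \<iota>']
        have "\<iota>' \<in> fhom F Q S"
          using fhom_codomain[OF Q(1) P carrier_objs \<iota>'h(1)] fhom_memS[OF Q(1) P \<iota>'h(1)] by auto
        then have "\<iota>' ` N = N" using image_N[OF Q(1)] \<open>N \<subseteq> Q\<close> by simp
        then have "N \<subseteq> P" using \<iota>'h(2) \<open>N \<subseteq> Q\<close> by blast
        with False show False by simp
      qed
      have auto_lifts: "lifts Q \<alpha>" if \<alpha>: "\<alpha> \<in> fiso F Q Q" for \<alpha>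
      proof -
        interpret A: group "Aut_grp F Q" using group_Aut[OF Q(1)] .
        \<comment> \<open>\<open>K\<close> is the kernel of the action of the automorphisms of
          \<open>Q\<close> on the cosets of \<open>N\<close> that meet \<open>Q\<close>. That this
          action is well defined is \<open>aN\<close> below, and it yields the normality of
          \<open>K\<close>.\<close>
        define K where "K = {a \<in> fiso F Q Q. \<forall>u\<in>Q. coset_N (a u) = coset_N u}"
        have K_lifts: "lifts Q k" if "k \<in> K" for k
          using that lifts_trivial[OF Q(1)] by (simp add: K_def)
        have aQ: "a u \<in> Q" if "a \<in> fiso F Q Q" "u \<in> Q" for a u
          using fhom_mem[OF Q(1) Q(1) fisoD(1)[OF Q(1) Q(1) that(1)] that(2)] .
        have aN: "coset_N (a u) = coset_N (a v)"
          if a: "a \<in> fiso F Q Q" and u: "u \<in> Q" and v: "v \<in> Q" and uv: "coset_N u = coset_N v" for a u v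
        proof -
          note ah = fisoD(1)[OF Q(1) Q(1) a]
          have v': "inv_S v \<in> Q" using v objs_subgroup[OF Q(1)] by (simp add: subgroup.m_inv_closed)
          have "u \<cdot> inv_S v \<in> N" using uv u v objs_mem[OF Q(1)] coset_eq_iff by simp
          moreover have "u \<cdot> inv_S v \<in> Q" using u v' objs_subgroup[OF Q(1)] by (simp add: subgroup.m_closed)
          ultimately have "a (u \<cdot> inv_S v) \<in> N" using strongly_closed_mem[OF N Q(1) Q(1) ah] by simp
          then have "a u \<cdot> inv_S (a v) \<in> N"
            using fhom_mult[OF Q(1) Q(1) ah u v'] fhom_inv[OF Q(1) Q(1) ah v] by simp
          then show ?thesis using coset_eq_iff u v aQ[OF a] objs_mem[OF Q(1)] by simp
        qed
        have K_normal: "K \<lhd> Aut_grp F Q"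
        proof (rule A.normal_inv_iff[THEN iffD2], intro conjI ballI)
          show "subgroup K (Aut_grp F Q)"
          proof (rule A.subgroupI)
            show "K \<subseteq> carrier (Aut_grp F Q)" by (auto simp: K_def carrier_Aut[OF Q(1)])
            show "K \<noteq> {}" using id_fiso[OF Q(1)] by (force simp: K_def)
          next
            fix a assume "a \<in> K"
            then have a: "a \<in> fiso F Q Q" "\<And>u. u \<in> Q \<Longrightarrow> coset_N (a u) = coset_N u" by (auto simp: K_def)
            let ?a' = "inv\<^bsub>Aut_grp F Q\<^esub> a"
            have a': "?a' \<in> fiso F Q Q" using A.inv_closed[of a] a(1) by (simp add: carrier_Aut[OF Q(1)])
            have "a \<otimes>\<^bsub>Aut_grp F Q\<^esub> ?a' = (\<lambda>u\<in>Q. u)"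
              using a(1) by (simp add: carrier_Aut[OF Q(1)]) (simp add: Aut_grp_def BijGroup_def)
            then have e: "compose Q a ?a' = (\<lambda>u\<in>Q. u)" using mult_Aut[OF Q(1) a(1) a'] by simp
            have "a (?a' u) = u" if "u \<in> Q" for u
              using that fun_cong[OF e, of u] by (simp add: compose_eq)
            then have "coset_N (?a' u) = coset_N u" if "u \<in> Q" for u
              using that a(2)[OF aQ[OF a' that]] by simp
            with a' show "?a' \<in> K" by (simp add: K_def)
          next
            fix a b assume "a \<in> K" "b \<in> K"
            then show "a \<otimes>\<^bsub>Aut_grp F Q\<^esub> b \<in> K"
              using fiso_compose[OF Q(1) Q(1) Q(1)] aQ by (simp add: K_def mult_Aut[OF Q(1)] compose_def)
          qed
        next
          fix a b assume "a \<in> carrier (Aut_grp F Q)" and bK: "b \<in> K"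
          then have a: "a \<in> fiso F Q Q" and b: "b \<in> fiso F Q Q"
            "\<And>u. u \<in> Q \<Longrightarrow> coset_N (b u) = coset_N u" by (auto simp: K_def carrier_Aut[OF Q(1)])
          let ?c = "a \<otimes>\<^bsub>Aut_grp F Q\<^esub> b \<otimes>\<^bsub>Aut_grp F Q\<^esub> inv\<^bsub>Aut_grp F Q\<^esub> a"
          have c: "?c \<in> fiso F Q Q"
            using A.m_closed[OF A.m_closed A.inv_closed] a b(1) by (simp add: carrier_Aut[OF Q(1)])
          have cv: "?c (a v) = a (b v)" if "v \<in> Q" for v
            using Aut_mult_eq_iff[OF Q(1) a b(1) c] that by auto
          have "coset_N (?c u) = coset_N u" if u: "u \<in> Q" for u
          proof -
            obtain v where v: "v \<in> Q" "u = a v" using u fisoD(2)[OF Q(1) Q(1) a] by auto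
            then show ?thesis using cv[OF v(1)] aN[OF a aQ[OF b(1) v(1)] v(1) b(2)[OF v(1)]] by simp
          qed
          with c show "?c \<in> K" by (simp add: K_def)
        qed
        obtain k where k: "k \<in> K" and kT: "\<And>c. c \<in> Aut_S F Q \<inter> K \<Longrightarrow>
          (k \<otimes>\<^bsub>Aut_grp F Q\<^esub> \<alpha>) \<otimes>\<^bsub>Aut_grp F Q\<^esub> c \<otimes>\<^bsub>Aut_grp F Q\<^esub> inv\<^bsub>Aut_grp F Q\<^esub> (k \<otimes>\<^bsub>Aut_grp F Q\<^esub> \<alpha>) \<in> Aut_S F Q"
          using A.frattini_sylow[OF p finite_Aut[OF Q(1)] T K_normal, of \<alpha>] \<alpha> carrier_Aut[OF Q(1)] by blast
        have kf: "k \<in> fiso F Q Q" using k by (simp add: K_def)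
        define \<beta> where "\<beta> = k \<otimes>\<^bsub>Aut_grp F Q\<^esub> \<alpha>"
        have \<beta>: "\<beta> = compose Q k \<alpha>" unfolding \<beta>_def using mult_Aut[OF Q(1) kf \<alpha>] .
        have \<beta>f: "\<beta> \<in> fiso F Q Q" unfolding \<beta> using fiso_compose[OF Q(1) Q(1) Q(1) \<alpha> kf] .
        \<comment> \<open>Conjugation by an element \<open>x\<close> of \<open>N\<close> lies in
          \<open>K\<close>, since commutators with \<open>x\<close> lie in the normal subgroup
          \<open>N\<close>. By the choice of \<open>k\<close>, conjugating it by
          \<open>\<beta>\<close> gives conjugation by some \<open>y\<close>, so \<open>x\<close>
          belongs to the extension domain of \<open>\<beta>\<close>.\<close>
        have N_ext: "x \<in> ext_dom F Q Q \<beta>" if x: "x \<in> N" "x \<in> normalizer (fgrp F) Q" for x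
        proof -
          let ?c = "\<lambda>u\<in>Q. conj_by (fgrp F) x u"
          have c: "?c \<in> fiso F Q Q" using conj_fiso[OF Q(1) x(2)] .
          have "coset_N (conj_by (fgrp F) x u) = coset_N u" if "u \<in> Q" for u
          proof -
            have u: "u \<in> S" using objs_mem[OF Q(1) that] .
            have "x \<cdot> (u \<cdot> inv_S x \<cdot> inv_S u) \<in> N"
              using m_closed[OF x(1) inv_op_closed2[OF u m_inv_closed[OF x(1)]]] .
            then show ?thesis using u N_mem[OF x(1)] coset_eq_iff by (simp add: m_assoc)
          qed
          then have "?c \<in> Aut_S F Q \<inter> K" using c x(2) by (auto simp: K_def Aut_S_def)
          from kT[OF this] obtain y where y: "y \<in> normalizer (fgrp F) Q"
            "\<beta> \<otimes>\<^bsub>Aut_grp F Q\<^esub> ?c \<otimes>\<^bsub>Aut_grp F Q\<^esub> inv\<^bsub>Aut_grp F Q\<^esub> \<beta> = (\<lambda>u\<in>Q. conj_by (fgrp F) y u)"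
            unfolding \<beta>_def[symmetric] Aut_S_def by auto
          have "\<beta> (?c v) = (\<lambda>u\<in>Q. conj_by (fgrp F) y u) (\<beta> v)" if "v \<in> Q" for v
            using y Aut_mult_eq_iff[OF Q(1) \<beta>f c conj_fiso[OF Q(1) y(1)]] that by blast
          then have "\<beta> (conj_by (fgrp F) x v) = conj_by (fgrp F) y (\<beta> v)" if "v \<in> Q" for v
            using that aQ[OF \<beta>f that] by fastforce
          with x y show ?thesis unfolding ext_dom_def by blast
        qed
        \<comment> \<open>A normalizing element of \<open>NQ\<close> outside \<open>Q\<close> has
          the form \<open>n \<cdot> q\<close>. Dropping \<open>q\<close> leaves an element of
          \<open>N\<close> that still normalizes \<open>Q\<close> and lies outside it, so
          \<open>\<beta>\<close> extends beyond \<open>Q\<close>.\<close>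
        obtain x where x: "x \<in> prod_N Q - Q" "x \<in> normalizer (fgrp F) Q"
          using normalizer_grows[OF p Q(1) prod_objs[OF Q(1)]] subset_prod_N[OF Q(1)]
            N_subset_prod_N[OF Q(1)] NQ by blast
        obtain n q where nq: "n \<in> N" "q \<in> Q" "x = n \<cdot> q" using x by (auto simp: prod_N_mem)
        have "n \<in> normalizer (fgrp F) Q"
        proof -
          have "n = x \<cdot> inv_S q" using nq N_mem objs_mem[OF Q(1)] by (simp add: m_assoc)
          then show ?thesis
            using x(2) nq(2) subset_normalizer[OF Q(1)] objs_subgroup[OF normalizer_objs[OF Q(1)]]
            by (auto simp: subgroup.m_closed subgroup.m_inv_closed)
        qed
        moreover have "n \<notin> Q" using x nq objs_subgroup[OF Q(1)] by (auto simp: subgroup.m_closed)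
        ultimately have "Q \<subset> ext_dom F Q Q \<beta>"
          using N_ext[OF nq(1)] ext_dom_objs(2)[OF Q(1) Q(1) fisoD(1)[OF Q(1) Q(1) \<beta>f]] by blast
        then have \<beta>l: "lifts Q \<beta>" using extends[OF Q(1) \<beta>f] by simp
        \<comment> \<open>\<open>\<alpha>\<close> is recovered as the inverse of \<open>k\<close>
          after \<open>\<beta>\<close>, a product of two liftable automorphisms.\<close>
        obtain k' where k': "k' \<in> fiso F Q Q" "\<And>u. u \<in> Q \<Longrightarrow> k' (k u) = u"
          using fiso_inverse[OF Q(1) Q(1) kf] by metis
        have "lifts Q k'" using lifts_inverse[OF Q(1) Q(1) kf K_lifts[OF k] k'] .
        then have "lifts Q (compose Q k' \<beta>)" using lifts_compose[OF Q(1) Q(1) Q(1) \<beta>f \<beta>l k'(1)] by simp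
        then show ?thesis
          using lifts_restrict[OF Q(1) Q(1) subset_refl, of "compose Q k' \<beta>" \<alpha>] k'(2) aQ[OF \<alpha>]
          by (simp add: \<beta> compose_def)
      qed
      \<comment> \<open>Composed with a suitable automorphism \<open>\<alpha>\<close> of
        \<open>Q\<close>, the isomorphism extends to the normalizer of \<open>R\<close>, which is
        larger than \<open>R\<close> because \<open>R \<noteq> S\<close>. The inverse of
        \<open>\<alpha>\<close> lifts by \<open>auto_lifts\<close> and removes
        \<open>\<alpha>\<close> again.\<close>
      have iso_lifts: "lifts R \<rho>" if R: "R \<in> objs F" and \<rho>: "\<rho> \<in> fiso F R Q" for R \<rho>
      proof -
        obtain \<alpha> where \<alpha>: "\<alpha> \<in> fiso F Q Q" "ext_dom F R Q (compose R \<alpha> \<rho>) = normalizer (fgrp F) R"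
          using ext_dom_eq_normalizer[OF p R Q(1) \<rho> T] .
        note \<alpha>\<rho> = fiso_compose[OF R Q(1) Q(1) \<rho> \<alpha>(1)]
        have "R \<noteq> S"
        proof
          assume "R = S"
          then have "card P = card S" using iso_card[OF R Q(1) \<rho>] cQ by simp
          then have "P = S" using card_subset_eq[OF finite_S objs_subset[OF P]] by simp
          with False show False using objs_subset[OF N_objs] by simp
        qed
        then have "R \<subset> S" using objs_subset[OF R] by auto
        obtain x where "x \<in> S - R" "x \<in> normalizer (fgrp F) R"
          by (rule normalizer_grows[OF p R carrier_objs \<open>R \<subset> S\<close>])
        then have "R \<subset> normalizer (fgrp F) R"
          using subset_normalizer[OF R] by auto
        then have l: "lifts R (compose R \<alpha> \<rho>)" using extends[OF R \<alpha>\<rho>] \<alpha>(2) by simp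
        obtain \<alpha>' where \<alpha>': "\<alpha>' \<in> fiso F Q Q" "\<And>u. u \<in> Q \<Longrightarrow> \<alpha>' (\<alpha> u) = u"
          using fiso_inverse[OF Q(1) Q(1) \<alpha>(1)] by metis
        have "lifts R (compose R \<alpha>' (compose R \<alpha> \<rho>))"
          using lifts_compose[OF R Q(1) Q(1) \<alpha>\<rho> l \<alpha>'(1) auto_lifts[OF \<alpha>'(1)]] .
        then show ?thesis
          using lifts_restrict[OF R R subset_refl, of "compose R \<alpha>' (compose R \<alpha> \<rho>)" \<rho>] \<alpha>'(2)
            fhom_mem[OF R Q(1) fisoD(1)[OF R Q(1) \<rho>]] by (simp add: compose_def)
      qed
      note R = fhom_image[OF P carrier_objs \<phi>]
      obtain \<phi>' where \<phi>': "\<phi>' \<in> fiso F (\<phi> ` P) P" "\<And>u. u \<in> P \<Longrightarrow> \<phi>' (\<phi> u) = u"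
        using fiso_inverse[OF P R] by metis
      \<comment> \<open>\<open>\<phi>\<close> is \<open>\<iota>\<close> followed by the inverse of
        \<open>b\<close>, and both \<open>\<iota>\<close> and \<open>b\<close> end in the fully
        normalized \<open>Q\<close>, where \<open>iso_lifts\<close> applies.\<close>
      define b where "b = compose (\<phi> ` P) \<iota> \<phi>'"
      have b: "b \<in> fiso F (\<phi> ` P) Q" unfolding b_def using fiso_compose[OF R(1) P Q(1) \<phi>'(1) Q(2)] .
      obtain b' where b': "b' \<in> fiso F Q (\<phi> ` P)" "\<And>u. u \<in> \<phi> ` P \<Longrightarrow> b' (b u) = u"
        using fiso_inverse[OF R(1) Q(1) b] by metis
      have "lifts Q b'" using lifts_inverse[OF R(1) Q(1) b iso_lifts[OF R(1) b] b'] .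
      then have "lifts P (compose P b' \<iota>)"
        using lifts_compose[OF P Q(1) R(1) Q(2) iso_lifts[OF P Q(2)] b'(1)] by simp
      moreover have "\<phi> u = compose P b' \<iota> u" if "u \<in> P" for u
        using that b'(2)[of "\<phi> u"] \<phi>'(2) by (simp add: b_def compose_def)
      ultimately show ?thesis using lifts_restrict[OF P P subset_refl] by blast
    qed
  qed
  then show ?thesis by (simp add: lifts_def)
qed

section \<open>Inverse limits\<close>

lemma directed_finite_bound:
  assumes "I \<noteq> {}"
    and trans: "\<And>i j k. \<lbrakk>i \<in> I; j \<in> I; k \<in> I; rel i j; rel j k\<rbrakk> \<Longrightarrow> rel i k"
    and dir: "\<And>i j. \<lbrakk>i \<in> I; j \<in> I\<rbrakk> \<Longrightarrow> \<exists>k\<in>I. rel i k \<and> rel j k"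
    and "finite J" "J \<subseteq> I"
  shows "\<exists>k\<in>I. \<forall>j\<in>J. rel j k"
  using assms(4,5)
proof (induction J rule: finite_induct)
  case empty
  then show ?case using assms(1) by auto
next
  case (insert a J)
  then obtain k where k: "k \<in> I" "\<forall>j\<in>J. rel j k" by auto
  obtain l where l: "l \<in> I" "rel k l" "rel a l" using dir[of k a] k insert.prems by auto
  have "rel j l" if "j \<in> J" for j using trans[of j k l] that k l insert.prems by auto
  with l show ?case by auto
qed

text \<open>
  Compactness for finite sets linked by relations instead of maps: \<open>R i j x y\<close> reads
  ``\<open>x\<close> is the image of \<open>y\<close>'', and \<open>comp\<close> replaces functoriality.
\<close>

lemma inverse_limit_nonempty:
  fixes X :: "'i \<Rightarrow> 'b set" and R :: "'i \<Rightarrow> 'i \<Rightarrow> 'b \<Rightarrow> 'b \<Rightarrow> bool"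
  assumes ne: "I \<noteq> {}"
    and trans: "\<And>i j k. \<lbrakk>i \<in> I; j \<in> I; k \<in> I; rel i j; rel j k\<rbrakk> \<Longrightarrow> rel i k"
    and dir: "\<And>i j. \<lbrakk>i \<in> I; j \<in> I\<rbrakk> \<Longrightarrow> \<exists>k\<in>I. rel i k \<and> rel j k"
    and fin: "\<And>i. i \<in> I \<Longrightarrow> finite (X i)" and X_ne: "\<And>i. i \<in> I \<Longrightarrow> X i \<noteq> {}"
    and down: "\<And>i j y. \<lbrakk>i \<in> I; j \<in> I; rel i j; y \<in> X j\<rbrakk> \<Longrightarrow> \<exists>x\<in>X i. R i j x y"
    and comp: "\<And>i j k x y z. \<lbrakk>i \<in> I; j \<in> I; k \<in> I; rel i j; rel j k; x \<in> X i; y \<in> X j; z \<in> X k;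
      R i k x z; R j k y z\<rbrakk> \<Longrightarrow> R i j x y"
  shows "\<exists>x. (\<forall>i\<in>I. x i \<in> X i) \<and> (\<forall>i\<in>I. \<forall>j\<in>I. rel i j \<longrightarrow> R i j (x i) (x j))"
proof -
  let ?T = "product_topology (\<lambda>i. discrete_topology (X i)) I"
  define C where "C ij = {x \<in> \<Pi>\<^sub>E i\<in>I. X i. R (fst ij) (snd ij) (x (fst ij)) (x (snd ij))}" for ij
  define D where "D = {(i, j). i \<in> I \<and> j \<in> I \<and> rel i j}"
  have compact: "compact_space ?T"
    using fin by (simp add: compact_space_product_topology compact_space_discrete_topology)
  have closed_C: "closedin ?T (C ij)" if "ij \<in> D" for ij
  proof -
    obtain i j where ij: "ij = (i, j)" "i \<in> I" "j \<in> I" using \<open>ij \<in> D\<close> by (auto simp: D_def)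
    have "continuous_map ?T (prod_topology (discrete_topology (X i)) (discrete_topology (X j))) (\<lambda>x. (x i, x j))"
      unfolding continuous_map_paired using ij continuous_map_product_projection[of _ I "\<lambda>i. discrete_topology (X i)"] by simp
    then have "continuous_map ?T (discrete_topology (X i \<times> X j)) (\<lambda>x. (x i, x j))"
      by (simp only: prod_topology_discrete_topology)
    then have "closedin ?T {x \<in> topspace ?T. (x i, x j) \<in> {(a, b). a \<in> X i \<and> b \<in> X j \<and> R i j a b}}"
      by (rule closedin_continuous_map_preimage) auto
    also have "{x \<in> topspace ?T. (x i, x j) \<in> {(a, b). a \<in> X i \<and> b \<in> X j \<and> R i j a b}} = C ij"
      using ij by (auto simp: C_def)
    finally show ?thesis .
  qed
  \<comment> \<open>The whole product is a member of the family, so that a common point is a genuine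
    choice from the \<open>X i\<close>.\<close>
  have fip: "\<Inter>\<F> \<noteq> {}" if "finite \<F>" "\<F> \<subseteq> insert (\<Pi>\<^sub>E i\<in>I. X i) (C ` D)" for \<F>
  proof -
    obtain E where E: "finite E" "E \<subseteq> D" "\<F> - {\<Pi>\<^sub>E i\<in>I. X i} = C ` E"
    proof -
      have "finite (\<F> - {\<Pi>\<^sub>E i\<in>I. X i})" "\<F> - {\<Pi>\<^sub>E i\<in>I. X i} \<subseteq> C ` D"
        using \<open>finite \<F>\<close> \<open>\<F> \<subseteq> insert (\<Pi>\<^sub>E i\<in>I. X i) (C ` D)\<close> by blast+
      from finite_subset_image[OF this] obtain E where "E \<subseteq> D \<and> finite E \<and> \<F> - {\<Pi>\<^sub>E i\<in>I. X i} = C ` E" ..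
      with that[of E] show ?thesis by simp
    qed
    let ?J = "fst ` E \<union> snd ` E"
    have J: "finite ?J" "?J \<subseteq> I" using E by (auto simp: D_def)
    have "\<exists>k\<in>I. \<forall>j\<in>?J. rel j k"
      by (rule directed_finite_bound[OF ne _ _ J]) ((rule trans dir; assumption)+)
    then obtain k where k: "k \<in> I" "\<And>j. j \<in> ?J \<Longrightarrow> rel j k" by blast
    obtain z where z: "z \<in> X k" using X_ne[OF k(1)] by blast
    \<comment> \<open>Below \<open>k\<close> the value is an image of \<open>z\<close>. At the other
      indices any element of \<open>X i\<close> will do, since the finitely many conditions at stake
      only involve indices below \<open>k\<close>.\<close>
    have "\<exists>y. i \<in> I \<longrightarrow> y \<in> X i \<and> (rel i k \<longrightarrow> R i k y z)" for i
      using down[of i k z] X_ne[of i] k z by blast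
    then obtain y where y: "\<And>i. i \<in> I \<Longrightarrow> y i \<in> X i" "\<And>i. \<lbrakk>i \<in> I; rel i k\<rbrakk> \<Longrightarrow> R i k (y i) z"
      by metis
    let ?y = "restrict y I"
    have "?y \<in> C ij" if "ij \<in> E" for ij
    proof -
      obtain i j where ij: "ij = (i, j)" "i \<in> I" "j \<in> I" "rel i j"
        using \<open>ij \<in> E\<close> E(2) unfolding D_def by blast
      have "fst ij \<in> ?J" "snd ij \<in> ?J" using that by simp_all
      then have "i \<in> ?J" "j \<in> ?J" using ij(1) by simp_all
      then have "R i j (y i) (y j)"
        using comp[OF ij(2,3) k(1) ij(4) k(2) y(1) y(1) z y(2) y(2)] ij k(2) by blast
      then show ?thesis using ij y by (auto simp: C_def)
    qed
    moreover have "?y \<in> (\<Pi>\<^sub>E i\<in>I. X i)" using y by auto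
    ultimately have "?y \<in> \<Inter>\<F>" using E(3) by blast
    then show ?thesis by auto
  qed
  have "\<Inter>(insert (\<Pi>\<^sub>E i\<in>I. X i) (C ` D)) \<noteq> {}"
  proof (rule compact_space_fip[THEN iffD1, rule_format, OF compact], intro conjI allI impI ballI)
    fix A assume "A \<in> insert (\<Pi>\<^sub>E i\<in>I. X i) (C ` D)"
    then consider "A = (\<Pi>\<^sub>E i\<in>I. X i)" | ij where "ij \<in> D" "A = C ij" by blast
    then show "closedin ?T A"
    proof cases
      case 1
      then show ?thesis using closedin_topspace[of ?T] by simp
    qed (simp add: closed_C)
  next
    fix \<F> assume "finite \<F> \<and> \<F> \<subseteq> insert (\<Pi>\<^sub>E i\<in>I. X i) (C ` D)"
    then show "\<Inter>\<F> \<noteq> {}" by (elim conjE fip)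
  qed
  then obtain x where x0: "x \<in> \<Inter>(insert (\<Pi>\<^sub>E i\<in>I. X i) (C ` D))"
    unfolding ex_in_conv[symmetric] ..
  have x: "x \<in> (\<Pi>\<^sub>E i\<in>I. X i)" by (rule InterD[OF x0 insertI1])
  have xC: "x \<in> C ij" if "ij \<in> D" for ij by (rule InterD[OF x0]) (use that in simp)
  have "R i j (x i) (x j)" if "i \<in> I" "j \<in> I" "rel i j" for i j
    using xC[of "(i, j)"] that by (auto simp: C_def D_def)
  with x show ?thesis by (intro exI[of _ x]) auto
qed

section \<open>Inverse systems of fusion systems and the topology of their limits\<close>

context inverse_system
begin

lemma transition_hom:
  "\<lbrakk>i \<in> I; j \<in> I; rel i j\<rbrakk> \<Longrightarrow> f i j \<in> hom (fgrp (Fs j)) (fgrp (Fs i))"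
  using transition by (simp add: fusion_morphism_def)

lemma group_Fs: "i \<in> I \<Longrightarrow> group (fgrp (Fs i))"
  using fusion_systems[of i] by (simp add: fusion_system_def fusion_category_def)

lemma transition_closed:
  "\<lbrakk>i \<in> I; j \<in> I; rel i j; x \<in> carrier (fgrp (Fs j))\<rbrakk> \<Longrightarrow> f i j x \<in> carrier (fgrp (Fs i))"
  using hom_in_carrier[OF transition_hom] .

lemma transition_mult:
  "\<lbrakk>i \<in> I; j \<in> I; rel i j; x \<in> carrier (fgrp (Fs j)); y \<in> carrier (fgrp (Fs j))\<rbrakk> \<Longrightarrow>
    f i j (x \<otimes>\<^bsub>fgrp (Fs j)\<^esub> y) = f i j x \<otimes>\<^bsub>fgrp (Fs i)\<^esub> f i j y"
  using hom_mult[OF transition_hom] .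

lemma transition_inv:
  assumes "i \<in> I" "j \<in> I" "rel i j" "x \<in> carrier (fgrp (Fs j))"
  shows "f i j (inv\<^bsub>fgrp (Fs j)\<^esub> x) = inv\<^bsub>fgrp (Fs i)\<^esub> (f i j x)"
proof -
  have "group_hom (fgrp (Fs j)) (fgrp (Fs i)) (f i j)"
    using assms group_Fs transition_hom by (simp add: group_hom_def group_hom_axioms_def)
  then show ?thesis using group_hom.hom_inv assms(4) by metis
qed

lemma transition_fhom:
  assumes "i \<in> I" "j \<in> I" "rel i j" "P \<in> objs (Fs j)" "Q \<in> objs (Fs j)" "\<phi> \<in> fhom (Fs j) P Q"
  shows "f i j ` P \<in> objs (Fs i)" "f i j ` Q \<in> objs (Fs i)"
    "\<exists>\<chi>\<in>fhom (Fs i) (f i j ` P) (f i j ` Q). \<forall>u\<in>P. f i j (\<phi> u) = \<chi> (f i j u)"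
proof -
  obtain A where A: "induced_functor (Fs j) (Fs i) (f i j) A"
    using transition[OF assms(1-3)] by (auto simp: fusion_morphism_def)
  show "f i j ` P \<in> objs (Fs i)" "f i j ` Q \<in> objs (Fs i)"
    using A assms(4,5) by (simp_all add: induced_functor_def)
  have "A P Q \<phi> \<in> fhom (Fs i) (f i j ` P) (f i j ` Q) \<and> (\<forall>u\<in>P. f i j (\<phi> u) = A P Q \<phi> (f i j u))"
    using A assms(4-6) by (simp add: induced_functor_def)
  then show "\<exists>\<chi>\<in>fhom (Fs i) (f i j ` P) (f i j ` Q). \<forall>u\<in>P. f i j (\<phi> u) = \<chi> (f i j u)" by blast
qed

lemma finite_bound:
  assumes "finite J" "J \<subseteq> I" shows "\<exists>k\<in>I. \<forall>j\<in>J. rel j k"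
  by (rule directed_finite_bound[OF nonempty _ _ assms]) ((rule rel_trans rel_directed; assumption)+)

lemma lim_carrier_mem: "x \<in> lim_carrier I rel Fs f \<Longrightarrow> i \<in> I \<Longrightarrow> x i \<in> carrier (fgrp (Fs i))"
  by (auto simp: lim_carrier_def)

lemma lim_carrier_compat:
  "x \<in> lim_carrier I rel Fs f \<Longrightarrow> i \<in> I \<Longrightarrow> j \<in> I \<Longrightarrow> rel i j \<Longrightarrow> f i j (x j) = x i"
  by (auto simp: lim_carrier_def)

lemma topspace_Fs: "i \<in> I \<Longrightarrow> topspace (ftop (Fs i)) = carrier (fgrp (Fs i))"
  using fusion_systems fusion_system.discrete by fastforce

text \<open>A basic open set restricts finitely many coordinates; directedness replaces these by a
  single coordinate above them. Conversely, fibres of one coordinate are open because the factors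
  are discrete.\<close>

lemma openin_inverse_limit:
  "openin (ftop (inverse_limit I rel Fs f)) U \<longleftrightarrow>
    U \<subseteq> lim_carrier I rel Fs f \<and>
    (\<forall>y\<in>U. \<exists>i\<in>I. \<forall>x\<in>lim_carrier I rel Fs f. x i = y i \<longrightarrow> x \<in> U)" (is "?L \<longleftrightarrow> ?R")
proof
  let ?T = "product_topology (\<lambda>i. ftop (Fs i)) I" and ?lim = "lim_carrier I rel Fs f"
  have top: "openin (ftop (inverse_limit I rel Fs f)) V \<longleftrightarrow> (\<exists>W. openin ?T W \<and> V = W \<inter> ?lim)" for V
    by (simp add: inverse_limit_def openin_subtopology)
  show ?R if ?L
  proof (intro conjI ballI)
    obtain W where W: "openin ?T W" "U = W \<inter> ?lim" using \<open>?L\<close> top by auto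
    then show "U \<subseteq> ?lim" by auto
    fix y assume y: "y \<in> U"
    obtain V where V: "finite {i \<in> I. V i \<noteq> topspace (ftop (Fs i))}"
      "y \<in> Pi\<^sub>E I V" "Pi\<^sub>E I V \<subseteq> W"
      using W y unfolding openin_product_topology_alt by blast
    obtain k where k: "k \<in> I" "\<And>i. i \<in> I \<Longrightarrow> V i \<noteq> topspace (ftop (Fs i)) \<Longrightarrow> rel i k"
      using finite_bound[OF V(1)] by auto
    have "x \<in> U" if x: "x \<in> ?lim" "x k = y k" for x
    proof -
      have "x i \<in> V i" if i: "i \<in> I" for i
      proof (cases "V i = topspace (ftop (Fs i))")
        case True
        then show ?thesis using lim_carrier_mem[OF x(1) i] topspace_Fs[OF i] by simp
      next
        case False
        then have "rel i k" using k i by auto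
        then have "x i = y i"
          using lim_carrier_compat[OF x(1) i k(1)] lim_carrier_compat[of y i k] x(2) y W i k(1) by auto
        then show ?thesis using V(2) i by auto
      qed
      moreover have "x \<in> extensional I" using x by (auto simp: lim_carrier_def PiE_def)
      ultimately have "x \<in> Pi\<^sub>E I V" by (simp add: PiE_iff)
      then show ?thesis using V W x by auto
    qed
    then show "\<exists>i\<in>I. \<forall>x\<in>?lim. x i = y i \<longrightarrow> x \<in> U" using k by blast
  qed
  show ?L if ?R
  proof (subst openin_subopen, intro ballI)
    fix y assume y: "y \<in> U"
    then obtain i where i: "i \<in> I" "\<And>x. x \<in> ?lim \<Longrightarrow> x i = y i \<Longrightarrow> x \<in> U" using \<open>?R\<close> by blast
    have "openin (ftop (Fs i)) {y i}"
      using fusion_system.discrete[OF fusion_systems[OF i(1)]] lim_carrier_mem[of y i] y \<open>?R\<close> i by auto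
    then have "openin ?T {x \<in> topspace ?T. x i \<in> {y i}}"
      by (rule openin_continuous_map_preimage[OF continuous_map_product_projection[OF i(1)]])
    then have "openin (ftop (inverse_limit I rel Fs f)) ({x \<in> topspace ?T. x i \<in> {y i}} \<inter> ?lim)"
      using top by blast
    moreover have "y \<in> topspace ?T"
      using y \<open>?R\<close> topspace_Fs by (auto simp: lim_carrier_def PiE_iff)
    ultimately show "\<exists>T. openin (ftop (inverse_limit I rel Fs f)) T \<and> y \<in> T \<and> T \<subseteq> U"
      using i y \<open>?R\<close> by (intro exI[of _ "{x \<in> topspace ?T. x i \<in> {y i}} \<inter> ?lim"]) auto
  qed
qed

end

text \<open>
  A fusion category that is an inverse limit up to isomorphism: \<open>g i\<close> is the composite of the
  isomorphism with the projection to the \<open>i\<close>-th fusion system.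
\<close>

locale pro_fusion = fusion_category F + inverse_system p I rel Fs f
  for F :: "'a fusion_data" and p and I :: "'i set" and rel and Fs :: "'i \<Rightarrow> 'g fusion_data" and f +
  fixes g :: "'i \<Rightarrow> 'a \<Rightarrow> 'g"
  assumes g_hom: "i \<in> I \<Longrightarrow> g i \<in> hom (fgrp F) (fgrp (Fs i))"
    and g_compat: "\<lbrakk>i \<in> I; j \<in> I; rel i j; x \<in> carrier (fgrp F)\<rbrakk> \<Longrightarrow> f i j (g j x) = g i x"
    and open_iff: "openin (ftop F) U \<longleftrightarrow> U \<subseteq> carrier (fgrp F) \<and>
      (\<forall>y\<in>U. \<exists>i\<in>I. \<forall>x\<in>carrier (fgrp F). g i x = g i y \<longrightarrow> x \<in> U)"
    and g_eqI: "\<lbrakk>x \<in> carrier (fgrp F); y \<in> carrier (fgrp F); \<And>i. i \<in> I \<Longrightarrow> g i x = g i y\<rbrakk> \<Longrightarrow> x = y"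
    and g_lim: "\<lbrakk>\<And>i. i \<in> I \<Longrightarrow> z i \<in> carrier (fgrp (Fs i));
      \<And>i j. \<lbrakk>i \<in> I; j \<in> I; rel i j\<rbrakk> \<Longrightarrow> f i j (z j) = z i\<rbrakk> \<Longrightarrow> \<exists>y\<in>carrier (fgrp F). \<forall>i\<in>I. g i y = z i"
    and fhom_iff: "\<lbrakk>P \<in> objs F; Q \<in> objs F\<rbrakk> \<Longrightarrow> \<phi> \<in> fhom F P Q \<longleftrightarrow>
      \<phi> \<in> extensional P \<and> \<phi> ` P \<subseteq> Q \<and>
      (\<forall>i\<in>I. \<exists>\<chi>\<in>fhom (Fs i) (g i ` P) (g i ` Q). \<forall>u\<in>P. g i (\<phi> u) = \<chi> (g i u))"
begin

lemma g_group_hom: "i \<in> I \<Longrightarrow> group_hom (fgrp F) (fgrp (Fs i)) (g i)"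
  using group_Fs g_hom is_group by (simp add: group_hom_def group_hom_axioms_def)

lemma g_closed: "i \<in> I \<Longrightarrow> x \<in> S \<Longrightarrow> g i x \<in> carrier (fgrp (Fs i))"
  using g_hom by (rule hom_in_carrier)

lemma g_mult: "i \<in> I \<Longrightarrow> x \<in> S \<Longrightarrow> y \<in> S \<Longrightarrow> g i (x \<cdot> y) = g i x \<otimes>\<^bsub>fgrp (Fs i)\<^esub> g i y"
  using g_hom by (rule hom_mult)

lemma g_one: "i \<in> I \<Longrightarrow> g i \<e> = \<one>\<^bsub>fgrp (Fs i)\<^esub>"
  using group_hom.hom_one[OF g_group_hom] .

lemma g_inv: "i \<in> I \<Longrightarrow> x \<in> S \<Longrightarrow> g i (inv_S x) = inv\<^bsub>fgrp (Fs i)\<^esub> (g i x)"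
  using group_hom.hom_inv[OF g_group_hom] .

lemma g_objs:
  assumes "i \<in> I" "P \<in> objs F" shows "g i ` P \<in> objs (Fs i)"
  using group_hom.subgroup_img_is_subgroup[OF g_group_hom[OF assms(1)] objs_subgroup[OF assms(2)]]
    fusion_system.objs_iff[OF fusion_systems[OF assms(1)]] by simp

lemma g_eq_iff:
  assumes "i \<in> I" "x \<in> S" "y \<in> S"
  shows "g i x = g i y \<longleftrightarrow> g i (x \<cdot> inv_S y) = \<one>\<^bsub>fgrp (Fs i)\<^esub>"
proof -
  interpret G: group "fgrp (Fs i)" using group_Fs[OF assms(1)] .
  show ?thesis using assms g_closed G.inv_solve_right'[of "\<one>\<^bsub>fgrp (Fs i)\<^esub>" "g i x" "g i y"]
    by (auto simp: g_mult g_inv)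
qed

lemma objsI:
  assumes "subgroup P (fgrp F)"
    and "\<And>y. \<lbrakk>y \<in> S; y \<notin> P\<rbrakk> \<Longrightarrow> \<exists>i\<in>I. \<forall>x\<in>S. g i x = g i y \<longrightarrow> x \<notin> P"
  shows "P \<in> objs F"
proof -
  have "openin (ftop F) (S - P)" using assms(2) unfolding open_iff by blast
  then show ?thesis
    using assms(1) subgroup.subset[OF assms(1)] topspace_eq by (simp add: objs_def closedin_def)
qed

text \<open>The complement of \<open>P\<close> is open, so a point outside \<open>P\<close> would be
  separated from \<open>P\<close> by a single \<open>g i\<close>.\<close>

lemma objs_memI:
  assumes P: "P \<in> objs F" and y: "y \<in> S" and "\<And>i. i \<in> I \<Longrightarrow> g i y \<in> g i ` P"
  shows "y \<in> P"
proof (rule ccontr)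
  assume "y \<notin> P"
  have "openin (ftop F) (S - P)" using P topspace_eq by (simp add: objs_def closedin_def)
  then obtain i where "i \<in> I" "\<And>x. x \<in> S \<Longrightarrow> g i x = g i y \<Longrightarrow> x \<in> S - P"
    using y \<open>y \<notin> P\<close> unfolding open_iff by blast
  moreover from assms(3)[OF \<open>i \<in> I\<close>] obtain u where "u \<in> P" "g i y = g i u" by auto
  ultimately show False using objs_mem[OF P] by (metis DiffD2)
qed

lemma fhom_at:
  assumes "P \<in> objs F" "Q \<in> objs F" "\<phi> \<in> fhom F P Q" "i \<in> I"
  obtains \<chi> where "\<chi> \<in> fhom (Fs i) (g i ` P) (g i ` Q)" "\<And>u. u \<in> P \<Longrightarrow> g i (\<phi> u) = \<chi> (g i u)"
proof -
  have "\<exists>\<chi>\<in>fhom (Fs i) (g i ` P) (g i ` Q). \<forall>u\<in>P. g i (\<phi> u) = \<chi> (g i u)"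
    using fhom_iff[OF assms(1,2), THEN iffD1, OF assms(3)] assms(4) by simp
  with that show ?thesis by blast
qed

lemma conj_closed_fhom:
  assumes P: "P \<in> objs F" and Q: "Q \<in> objs F" and x: "x \<in> S" and sub: "conj_by (fgrp F) x ` P \<subseteq> Q"
  shows "(\<lambda>u\<in>P. conj_by (fgrp F) x u) \<in> fhom F P Q"
proof (rule fhom_iff[OF P Q, THEN iffD2], intro conjI ballI)
  show "(\<lambda>u\<in>P. conj_by (fgrp F) x u) ` P \<subseteq> Q" using sub by auto
  fix i assume i: "i \<in> I"
  interpret Fi: fusion_system p "Fs i" using fusion_systems[OF i] .
  have eq: "g i (conj_by (fgrp F) x u) = conj_by (fgrp (Fs i)) (g i x) (g i u)" if "u \<in> P" for u
    using i x objs_mem[OF P that] by (simp add: g_mult g_inv)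
  have "conj_by (fgrp (Fs i)) (g i x) ` (g i ` P) \<subseteq> g i ` Q"
    using sub by (force simp flip: eq)
  then have "(\<lambda>v\<in>g i ` P. conj_by (fgrp (Fs i)) (g i x) v) \<in> fhom (Fs i) (g i ` P) (g i ` Q)"
    using Fi.conj_fhom[OF g_objs[OF i P] g_objs[OF i Q] g_closed[OF i x]] by simp
  moreover have "g i ((\<lambda>u\<in>P. conj_by (fgrp F) x u) u)
      = (\<lambda>v\<in>g i ` P. conj_by (fgrp (Fs i)) (g i x) v) (g i u)" if "u \<in> P" for u
    using that eq by simp
  ultimately show "\<exists>\<chi>\<in>fhom (Fs i) (g i ` P) (g i ` Q). \<forall>u\<in>P. g i ((\<lambda>u\<in>P. conj_by (fgrp F) x u) u) = \<chi> (g i u)"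
    by blast
qed simp

text \<open>This is the factorization axiom in the limit. Each component has it in
  \<open>Fs i\<close>; the point is that the image of \<open>P\<close> is closed and that the
  inverses of the components are the components of the inverse.\<close>

lemma fhom_image_fiso:
  assumes P: "P \<in> objs F" and Q: "Q \<in> objs F" and \<phi>: "\<phi> \<in> fhom F P Q"
  shows "\<phi> ` P \<in> objs F" "\<phi> \<in> fiso F P (\<phi> ` P)"
proof -
  have "\<exists>\<chi>. i \<in> I \<longrightarrow> \<chi> \<in> fhom (Fs i) (g i ` P) (g i ` Q) \<and> (\<forall>u\<in>P. g i (\<phi> u) = \<chi> (g i u))" for i
    using fhom_iff[OF P Q] \<phi> by blast
  then obtain \<chi> where \<chi>: "\<And>i. i \<in> I \<Longrightarrow> \<chi> i \<in> fhom (Fs i) (g i ` P) (g i ` Q)"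
    "\<And>i u. i \<in> I \<Longrightarrow> u \<in> P \<Longrightarrow> g i (\<phi> u) = \<chi> i (g i u)" by metis
  have \<phi>S: "\<phi> u \<in> S" if "u \<in> P" for u using fhom_memS[OF P Q \<phi> that] .
  have \<chi>_im: "\<chi> i ` (g i ` P) = g i ` (\<phi> ` P)" if "i \<in> I" for i using \<chi>(2)[OF that] by force
  have \<chi>_inj: "inj_on (\<chi> i) (g i ` P)" if i: "i \<in> I" for i
  proof -
    interpret Fi: fusion_system p "Fs i" using fusion_systems[OF i] .
    show ?thesis using Fi.fhom_inj[OF g_objs[OF i P] g_objs[OF i Q] \<chi>(1)[OF i]] .
  qed
  show obj: "\<phi> ` P \<in> objs F"
  proof (rule objsI)
    show "subgroup (\<phi> ` P) (fgrp F)"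
      using group_hom.img_is_subgroup[OF fhom_group_hom[OF P Q \<phi>]] by simp
    fix y assume y: "y \<in> S" "y \<notin> \<phi> ` P"
    have "\<exists>i\<in>I. g i y \<notin> g i ` (\<phi> ` P)"
    proof (rule ccontr)
      assume "\<not> ?thesis"
      then have "\<exists>u. i \<in> I \<longrightarrow> u \<in> P \<and> g i y = g i (\<phi> u)" for i by blast
      then obtain u where u: "\<And>i. i \<in> I \<Longrightarrow> u i \<in> P" "\<And>i. i \<in> I \<Longrightarrow> g i y = g i (\<phi> (u i))" by metis
      \<comment> \<open>The \<open>u i\<close> are chosen independently of each other. Injectivity
        of \<open>\<chi> i\<close> makes \<open>g i (u i)\<close> unique, hence compatible, and the
        element \<open>w\<close> glued from these coordinates is mapped to \<open>y\<close>.\<close>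
      have "f i j (g j (u j)) = g i (u i)" if ij: "i \<in> I" "j \<in> I" "rel i j" for i j
      proof -
        have uj: "u j \<in> P" using u(1)[OF ij(2)] .
        have "\<chi> i (g i (u j)) = g i (\<phi> (u j))" using \<chi>(2)[OF ij(1) uj] by simp
        also have "\<dots> = f i j (g j (\<phi> (u j)))" using g_compat[OF ij \<phi>S[OF uj]] by simp
        also have "\<dots> = g i y" using u(2)[OF ij(2)] g_compat[OF ij y(1)] by simp
        also have "\<dots> = \<chi> i (g i (u i))" using u ij \<chi>(2) by simp
        finally have "g i (u j) = g i (u i)"
          using inj_onD[OF \<chi>_inj[OF ij(1)]] uj u(1)[OF ij(1)] by blast
        then show ?thesis using g_compat[OF ij objs_mem[OF P uj]] by simp
      qed
      then obtain w where w: "w \<in> S" "\<And>i. i \<in> I \<Longrightarrow> g i w = g i (u i)"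
        using g_lim[of "\<lambda>i. g i (u i)", OF g_closed[OF _ objs_mem[OF P u(1)]]] by blast
      then have wP: "w \<in> P" using objs_memI[OF P w(1)] u(1) by auto
      have "\<phi> w = y"
      proof (rule g_eqI[OF \<phi>S[OF wP] y(1)])
        show "g i (\<phi> w) = g i y" if i: "i \<in> I" for i
          using \<chi>(2)[OF i wP] \<chi>(2)[OF i u(1)[OF i]] w(2)[OF i] u(2)[OF i] by simp
      qed
      with wP y show False by auto
    qed
    then show "\<exists>i\<in>I. \<forall>x\<in>S. g i x = g i y \<longrightarrow> x \<notin> \<phi> ` P" by (metis imageI)
  qed
  have inj: "inj_on \<phi> P" using fhom_inj[OF P Q \<phi>] .
  have \<chi>_iso: "\<chi> i \<in> fiso (Fs i) (g i ` P) (g i ` (\<phi> ` P))" if i: "i \<in> I" for i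
  proof -
    interpret Fi: fusion_system p "Fs i" using fusion_systems[OF i] .
    show ?thesis
      using Fi.fhom_image(2)[OF g_objs[OF i P] g_objs[OF i Q] \<chi>(1)[OF i]] \<chi>_im[OF i] by simp
  qed
  have fw: "\<phi> \<in> fhom F P (\<phi> ` P)"
  proof (rule fhom_iff[OF P obj, THEN iffD2], intro conjI ballI)
    show "\<phi> \<in> extensional P" using fhom_extensional[OF P Q \<phi>] .
    show "\<exists>\<chi>\<in>fhom (Fs i) (g i ` P) (g i ` \<phi> ` P). \<forall>u\<in>P. g i (\<phi> u) = \<chi> (g i u)" if i: "i \<in> I" for i
      using \<chi>_iso[OF i] \<chi>(2)[OF i] by (auto simp: fiso_def)
  qed simp
  define \<psi> where "\<psi> = restrict (inv_into P \<phi>) (\<phi> ` P)"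
  have \<psi>: "\<psi> (\<phi> u) = u" if "u \<in> P" for u using that inj by (simp add: \<psi>_def)
  have bw: "\<psi> \<in> fhom F (\<phi> ` P) P"
  proof (rule fhom_iff[OF obj P, THEN iffD2], intro conjI ballI)
    show "\<psi> ` \<phi> ` P \<subseteq> P" using \<psi> by auto
    fix i assume i: "i \<in> I"
    interpret Fi: fusion_system p "Fs i" using fusion_systems[OF i] .
    obtain \<theta> where \<theta>: "\<theta> \<in> fiso (Fs i) (g i ` \<phi> ` P) (g i ` P)" "\<And>u. u \<in> g i ` P \<Longrightarrow> \<theta> (\<chi> i u) = u"
      by (rule Fi.fiso_inverse[OF g_objs[OF i P] g_objs[OF i obj] \<chi>_iso[OF i]]) blast
    have "g i (\<psi> v) = \<theta> (g i v)" if "v \<in> \<phi> ` P" for v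
      using that \<psi> \<chi>(2)[OF i] \<theta>(2) by auto
    with \<theta>(1) show "\<exists>\<chi>\<in>fhom (Fs i) (g i ` \<phi> ` P) (g i ` P). \<forall>u\<in>\<phi> ` P. g i (\<psi> u) = \<chi> (g i u)"
      by (auto simp: fiso_def)
  qed (simp add: \<psi>_def)
  have "compose P \<psi> \<phi> = (\<lambda>u\<in>P. u)" "compose (\<phi> ` P) \<phi> \<psi> = (\<lambda>v\<in>\<phi> ` P. v)"
    using \<psi> by (auto simp: compose_def fun_eq_iff)
  with fw bw show "\<phi> \<in> fiso F P (\<phi> ` P)" by (auto simp: fiso_def)
qed

sublocale divisible_fusion F
proof
  show "(\<lambda>u\<in>P. conj_by (fgrp F) x u) \<in> fhom F P Q"
    if "P \<in> objs F" "Q \<in> objs F" "x \<in> S" "conj_by (fgrp F) x ` P \<subseteq> Q" for P Q x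
    using conj_closed_fhom that .
  show "\<exists>R\<in>objs F. R \<subseteq> Q \<and> \<phi> \<in> fiso F P R"
    if "P \<in> objs F" "Q \<in> objs F" "\<phi> \<in> fhom F P Q" for P Q \<phi>
    using fhom_image_fiso[OF that] fhom_mem[OF that] by blast
qed

text \<open>An open neighbourhood of the identity contains the kernel of some \<open>g i\<close>.
  The kernel is expressed by pairs, ready for comparing cosets of \<open>N\<close>.\<close>

lemma open_contains_kernel:
  assumes "openin (ftop F) N" "subgroup N (fgrp F)"
  obtains i where "i \<in> I" "\<And>x y. \<lbrakk>x \<in> S; y \<in> S; g i x = g i y\<rbrakk> \<Longrightarrow> x \<cdot> inv_S y \<in> N"
proof -
  obtain i where i: "i \<in> I" "\<And>x. x \<in> S \<Longrightarrow> g i x = g i \<e> \<Longrightarrow> x \<in> N"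
    using assms subgroup.one_closed[OF assms(2)] unfolding open_iff by blast
  have "x \<cdot> inv_S y \<in> N" if "x \<in> S" "y \<in> S" "g i x = g i y" for x y
    using i that g_eq_iff[OF i(1) that(1,2)] g_one[OF i(1)] by simp
  with i(1) that show ?thesis by blast
qed

lemma strongly_closed_fusion_open:
  assumes "N \<in> open_strongly_closed F"
  shows "strongly_closed_fusion F N"
proof
  show N: "strongly_closed F N" using assms by (simp add: open_strongly_closed_def)
  note Nobj = strongly_closed_objs[OF N]
  interpret N: normal N "fgrp F" using strongly_closed_normal[OF N] .
  obtain i where i: "i \<in> I" "\<And>x y. \<lbrakk>x \<in> S; y \<in> S; g i x = g i y\<rbrakk> \<Longrightarrow> x \<cdot> inv_S y \<in> N"
    using open_contains_kernel[OF _ objs_subgroup[OF Nobj]] assms by (auto simp: open_strongly_closed_def)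
  fix P assume P: "P \<in> objs F"
  have sub: "subgroup (N <#>\<^bsub>fgrp F\<^esub> P) (fgrp F)"
    using mult_norm_subgroup[OF N.normal_axioms objs_subgroup[OF P]] .
  show "N <#>\<^bsub>fgrp F\<^esub> P \<in> objs F"
  proof (rule objsI[OF sub])
    fix y assume y: "y \<in> S" "y \<notin> N <#>\<^bsub>fgrp F\<^esub> P"
    \<comment> \<open>\<open>NP\<close> is a union of cosets of the kernel of \<open>g i\<close>,
      and is therefore closed.\<close>
    have "y \<in> N <#>\<^bsub>fgrp F\<^esub> P" if x: "x \<in> N <#>\<^bsub>fgrp F\<^esub> P" "g i x = g i y" for x
    proof -
      obtain n u where nu: "n \<in> N" "u \<in> P" "x = n \<cdot> u" using x by (auto simp: set_mult_def)
      have c: "n \<in> S" "u \<in> S" using nu N.mem_carrier objs_mem[OF P] by auto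
      have "y \<cdot> inv_S x \<in> N" using i(2)[of y x] y c nu x by simp
      then have "y \<cdot> inv_S x \<cdot> n \<in> N" using nu by simp
      moreover have "y = (y \<cdot> inv_S x \<cdot> n) \<cdot> u"
        using c y nu by (simp add: m_assoc inv_mult_group)
      ultimately show ?thesis using nu unfolding set_mult_def by blast
    qed
    with y i(1) show "\<exists>i\<in>I. \<forall>x\<in>S. g i x = g i y \<longrightarrow> x \<notin> N <#>\<^bsub>fgrp F\<^esub> P" by blast
  qed
  fix \<phi> assume \<phi>: "\<phi> \<in> fhom F P S" and NP: "N \<subseteq> P"
  have sub: "\<phi> ` N \<subseteq> N" using strongly_closed_mem[OF N P carrier_objs \<phi>] NP by auto
  have r: "restrict \<phi> N \<in> fhom F N S" using fhom_restrict[OF P carrier_objs Nobj \<phi> NP] .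
  have im: "\<phi> ` N \<in> objs F" using fhom_image(1)[OF Nobj carrier_objs r] by simp
  \<comment> \<open>\<open>N\<close> may be infinite, so injectivity alone does not give
    surjectivity. Counting at each finite level shows that the images of \<open>\<phi> N\<close> and
    \<open>N\<close> agree there, and the closedness of \<open>\<phi> N\<close> does the
    rest.\<close>
  have "y \<in> \<phi> ` N" if y: "y \<in> N" for y
  proof (rule objs_memI[OF im])
    show "y \<in> S" using y N.mem_carrier by auto
    fix j assume j: "j \<in> I"
    interpret Fj: fusion_system p "Fs j" using fusion_systems[OF j] .
    obtain \<chi> where \<chi>: "\<chi> \<in> fhom (Fs j) (g j ` N) (g j ` S)" "\<And>u. u \<in> N \<Longrightarrow> g j (restrict \<phi> N u) = \<chi> (g j u)"
      by (rule fhom_at[OF Nobj carrier_objs r j]) blast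
    have eq: "\<chi> ` (g j ` N) = g j ` (\<phi> ` N)" using \<chi>(2) by force
    have "\<chi> ` (g j ` N) = g j ` N"
    proof (rule endo_inj_surj)
      show "finite (g j ` N)" using Fj.finite_objs[OF g_objs[OF j Nobj]] .
      show "\<chi> ` (g j ` N) \<subseteq> g j ` N" using eq sub by auto
      show "inj_on \<chi> (g j ` N)"
        using Fj.fhom_inj[OF g_objs[OF j Nobj] g_objs[OF j carrier_objs] \<chi>(1)] .
    qed
    then show "g j y \<in> g j ` (\<phi> ` N)" using y eq by auto
  qed
  with sub show "\<phi> ` N = N" by auto
qed

end

section \<open>Lifting morphisms in pro-saturated fusion systems\<close>

context pro_fusion
begin

text \<open>A relation between elements rather than between subgroups: over a finite group there are
  finitely many such pairs, and they pass along transition maps, so that failures of strong closure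
  are accessible to compactness.\<close>

definition fused :: "'i \<Rightarrow> 'g \<Rightarrow> 'g \<Rightarrow> bool" where
  "fused j x y \<longleftrightarrow> (\<exists>R\<in>objs (Fs j). \<exists>\<theta>\<in>fhom (Fs j) R (carrier (fgrp (Fs j))). x \<in> R \<and> \<theta> x = y)"

lemma fused_transition:
  assumes "i \<in> I" "j \<in> I" "rel i j" "fused j x y"
  shows "fused i (f i j x) (f i j y)"
proof -
  interpret Fi: fusion_system p "Fs i" using fusion_systems[OF assms(1)] .
  interpret Fj: fusion_system p "Fs j" using fusion_systems[OF assms(2)] .
  obtain R \<theta> where R: "R \<in> objs (Fs j)" "\<theta> \<in> fhom (Fs j) R Fj.S" "x \<in> R" "\<theta> x = y"
    using assms(4) by (auto simp: fused_def)
  note t = transition_fhom[OF assms(1-3) R(1) Fj.carrier_objs R(2)]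
  obtain \<chi> where \<chi>: "\<chi> \<in> fhom (Fs i) (f i j ` R) (f i j ` Fj.S)" "\<And>u. u \<in> R \<Longrightarrow> f i j (\<theta> u) = \<chi> (f i j u)"
    using t(3) by blast
  have "\<chi> \<in> fhom (Fs i) (f i j ` R) Fi.S"
    using Fi.fhom_codomain[OF t(1,2) Fi.carrier_objs \<chi>(1)] Fi.fhom_memS[OF t(1,2) \<chi>(1)] by blast
  moreover have "\<chi> (f i j x) = f i j y" using \<chi>(2)[OF R(3)] R(4) by simp
  ultimately show ?thesis using t(1) R(3) unfolding fused_def by blast
qed

text \<open>
  The morphism of \<open>F\<close> carrying \<open>x\<close> to \<open>y\<close> is defined on the subgroup of \<open>N\<close> where the given
  morphisms \<open>\<theta> j\<close> are defined and compatible.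
\<close>

lemma strongly_closed_fused:
  assumes N: "strongly_closed F N" and x: "x \<in> N" and y: "y \<in> S"
    and fused: "\<And>j. j \<in> I \<Longrightarrow> fused j (g j x) (g j y)"
  shows "y \<in> N"
proof -
  note Nobj = strongly_closed_objs[OF N]
  have "\<exists>R \<theta>. j \<in> I \<longrightarrow> R \<in> objs (Fs j) \<and> \<theta> \<in> fhom (Fs j) R (carrier (fgrp (Fs j))) \<and> g j x \<in> R \<and> \<theta> (g j x) = g j y" for j
    using fused[of j] unfolding fused_def by blast
  then obtain R \<theta> where R: "\<And>j. j \<in> I \<Longrightarrow> R j \<in> objs (Fs j)"
    and \<theta>: "\<And>j. j \<in> I \<Longrightarrow> \<theta> j \<in> fhom (Fs j) (R j) (carrier (fgrp (Fs j)))"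
    and xR: "\<And>j. j \<in> I \<Longrightarrow> g j x \<in> R j" and xy: "\<And>j. j \<in> I \<Longrightarrow> \<theta> j (g j x) = g j y" by metis
  have cat: "fusion_category (Fs j)" if "j \<in> I" for j
    using fusion_systems[OF that] by (simp add: fusion_system_def)
  have Sj: "carrier (fgrp (Fs j)) \<in> objs (Fs j)" if "j \<in> I" for j
    using fusion_category.carrier_objs[OF cat[OF that]] .
  have \<theta>_closed: "\<theta> j a \<in> carrier (fgrp (Fs j))" if "j \<in> I" "a \<in> R j" for j a
    using fusion_category.fhom_mem[OF cat R Sj \<theta>] that by blast
  have \<theta>_mult: "\<theta> j (a \<otimes>\<^bsub>fgrp (Fs j)\<^esub> b) = \<theta> j a \<otimes>\<^bsub>fgrp (Fs j)\<^esub> \<theta> j b"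
    if "j \<in> I" "a \<in> R j" "b \<in> R j" for j a b
    using fusion_category.fhom_mult[OF cat R Sj \<theta>] that by blast
  have \<theta>_inv: "\<theta> j (inv\<^bsub>fgrp (Fs j)\<^esub> a) = inv\<^bsub>fgrp (Fs j)\<^esub> (\<theta> j a)"
    if "j \<in> I" "a \<in> R j" for j a
    using fusion_category.fhom_inv[OF cat R Sj \<theta>] that by blast
  have R_sub: "subgroup (R j) (fgrp (Fs j))" if "j \<in> I" for j
    using R[OF that] by (simp add: objs_def)
  define P where "P = {u \<in> N. (\<forall>j\<in>I. g j u \<in> R j) \<and>
    (\<forall>j\<in>I. \<forall>k\<in>I. rel j k \<longrightarrow> f j k (\<theta> k (g k u)) = \<theta> j (g j u))}"
  have NS: "u \<in> S" if "u \<in> N" for u using objs_mem[OF Nobj that] .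
  \<comment> \<open>The compatibility condition holds at \<open>x\<close> because the values
    \<open>\<theta> j (g j x)\<close> are the coordinates of \<open>y\<close>.\<close>
  have xP: "x \<in> P" using x xR xy g_compat y by (simp add: P_def)
  have P: "P \<in> objs F"
  proof (rule objsI)
    show "subgroup P (fgrp F)"
    proof (rule subgroupI)
      show "P \<subseteq> S" using NS by (auto simp: P_def)
      show "P \<noteq> {}" using xP by auto
    next
      fix u assume u: "u \<in> P"
      then have "inv_S u \<in> N" using objs_subgroup[OF Nobj] by (simp add: P_def subgroup.m_inv_closed)
      then show "inv_S u \<in> P" using u NS R_sub
        by (simp add: P_def g_inv \<theta>_inv \<theta>_closed transition_inv subgroup.m_inv_closed)
    next
      fix u v assume u: "u \<in> P" and v: "v \<in> P"
      then have "u \<cdot> v \<in> N" using objs_subgroup[OF Nobj] by (simp add: P_def subgroup.m_closed)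
      then show "u \<cdot> v \<in> P" using u v NS R_sub
        by (simp add: P_def g_mult \<theta>_mult \<theta>_closed transition_mult subgroup.m_closed)
    qed
    fix z assume z: "z \<in> S" "z \<notin> P"
    show "\<exists>i\<in>I. \<forall>x\<in>S. g i x = g i z \<longrightarrow> x \<notin> P"
    proof (cases "z \<in> N")
      case False
      have "openin (ftop F) (S - N)" using Nobj topspace_eq by (simp add: objs_def closedin_def)
      then obtain i where "i \<in> I" "\<And>x. x \<in> S \<Longrightarrow> g i x = g i z \<Longrightarrow> x \<in> S - N"
        using z False unfolding open_iff by blast
      then show ?thesis unfolding P_def by blast
    next
      case True
      with z consider j where "j \<in> I" "g j z \<notin> R j"
        | j k where "j \<in> I" "k \<in> I" "rel j k" "f j k (\<theta> k (g k z)) \<noteq> \<theta> j (g j z)"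
        unfolding P_def by blast
      then show ?thesis
      proof cases
        case 1
        have "x \<notin> P" if "g j x = g j z" for x
        proof
          assume "x \<in> P"
          then have "g j x \<in> R j" using 1(1) by (simp add: P_def)
          with 1(2) that show False by simp
        qed
        then show ?thesis using 1(1) by blast
      next
        case 2
        \<comment> \<open>A failure for \<open>rel j k\<close> is visible at the larger index
          \<open>k\<close> alone, as \<open>g k x\<close> determines \<open>g j x\<close>.\<close>
        have "x \<notin> P" if "x \<in> S" "g k x = g k z" for x
        proof
          assume "x \<in> P"
          then have "f j k (\<theta> k (g k x)) = \<theta> j (g j x)" using 2 by (simp add: P_def)
          moreover have "g j x = g j z"
            using g_compat[OF 2(1-3) that(1)] g_compat[OF 2(1-3) z(1)] that(2) by simp
          ultimately show False using 2(4) that(2) by simp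
        qed
        then show ?thesis using 2(2) by blast
      qed
    qed
  qed
  have "\<exists>w. u \<in> P \<longrightarrow> w \<in> S \<and> (\<forall>j\<in>I. g j w = \<theta> j (g j u))" for u
    using g_lim[of "\<lambda>j. \<theta> j (g j u)"] \<theta>_closed by (fastforce simp: P_def)
  then obtain \<phi> where \<phi>: "\<And>u. u \<in> P \<Longrightarrow> \<phi> u \<in> S" "\<And>u j. u \<in> P \<Longrightarrow> j \<in> I \<Longrightarrow> g j (\<phi> u) = \<theta> j (g j u)"
    by metis
  have "restrict \<phi> P \<in> fhom F P S"
  proof (rule fhom_iff[OF P carrier_objs, THEN iffD2], intro conjI ballI)
    show "restrict \<phi> P ` P \<subseteq> S" using \<phi>(1) by auto
    fix j assume j: "j \<in> I"
    interpret Fj: fusion_system p "Fs j" using fusion_systems[OF j] .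
    note gP = g_objs[OF j P] and gS = g_objs[OF j carrier_objs]
    have "restrict (\<theta> j) (g j ` P) \<in> fhom (Fs j) (g j ` P) Fj.S"
      by (rule Fj.fhom_restrict[OF R[OF j] Fj.carrier_objs gP \<theta>[OF j]]) (use j in \<open>auto simp: P_def\<close>)
    then have "restrict (\<theta> j) (g j ` P) \<in> fhom (Fs j) (g j ` P) (g j ` S)"
      by (rule Fj.fhom_codomain[OF gP Fj.carrier_objs gS]) (use \<phi>(1) \<phi>(2)[OF _ j] in \<open>force simp flip: \<phi>(2)[OF _ j]\<close>)
    moreover have "g j (restrict \<phi> P u) = restrict (\<theta> j) (g j ` P) (g j u)" if "u \<in> P" for u
      using that \<phi>(2)[OF that j] by simp
    ultimately show "\<exists>\<chi>\<in>fhom (Fs j) (g j ` P) (g j ` S). \<forall>u\<in>P. g j (restrict \<phi> P u) = \<chi> (g j u)"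
      by blast
  qed simp
  from strongly_closed_mem[OF N P carrier_objs this xP x] have "\<phi> x \<in> N" using xP by simp
  moreover have "\<phi> x = y" using g_eqI[OF \<phi>(1)[OF xP] y] \<phi>(2)[OF xP] xy by simp
  ultimately show ?thesis by simp
qed

text \<open>Meant for \<open>rel i j\<close>. Membership is tested at the fixed level
  \<open>i\<close>, so an element outside this set stays outside when it is mapped down to other
  levels above \<open>i\<close>; for the images of \<open>N\<close> under the \<open>g j\<close>
  this need not be so.\<close>

definition preimage_N :: "'a set \<Rightarrow> 'i \<Rightarrow> 'i \<Rightarrow> 'g set" where
  "preimage_N N i j = {x \<in> carrier (fgrp (Fs j)). f i j x \<in> g i ` N}"

context
  fixes N i
  assumes N: "strongly_closed F N" and i: "i \<in> I"
    and kernel: "\<And>x y. \<lbrakk>x \<in> S; y \<in> S; g i x = g i y\<rbrakk> \<Longrightarrow> x \<cdot> inv_S y \<in> N"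
begin

lemma preimage_N_objs:
  assumes "j \<in> I" "rel i j"
  shows "preimage_N N i j \<in> objs (Fs j)"
proof -
  interpret Fi: fusion_system p "Fs i" using fusion_systems[OF i] .
  interpret Fj: fusion_system p "Fs j" using fusion_systems[OF assms(1)] .
  have gN: "subgroup (g i ` N) (fgrp (Fs i))"
    using Fi.objs_subgroup[OF g_objs[OF i strongly_closed_objs[OF N]]] .
  have hom: "group_hom (fgrp (Fs j)) (fgrp (Fs i)) (f i j)"
    using i assms group_Fs transition_hom by (simp add: group_hom_def group_hom_axioms_def)
  have "subgroup (preimage_N N i j) (fgrp (Fs j))"
  proof (rule Fj.subgroupI)
    show "preimage_N N i j \<noteq> {}"
      using group_hom.hom_one[OF hom] subgroup.one_closed[OF gN] by (force simp: preimage_N_def)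
  qed (use gN i assms in \<open>auto simp: preimage_N_def transition_inv transition_mult subgroup.m_inv_closed[OF gN]
      subgroup.m_closed[OF gN]\<close>)
  then show ?thesis by (simp add: Fj.objs_iff)
qed

lemma kernel_mem:
  assumes "x \<in> S" "g i x \<in> g i ` N" shows "x \<in> N"
proof -
  note Nobj = strongly_closed_objs[OF N]
  obtain n where n: "n \<in> N" "g i x = g i n" using assms(2) by auto
  then have "x \<cdot> inv_S n \<cdot> n \<in> N"
    using kernel[OF assms(1) objs_mem[OF Nobj n(1)]] subgroup.m_closed[OF objs_subgroup[OF Nobj]] by blast
  then show ?thesis using n assms(1) objs_mem[OF Nobj] by (simp add: m_assoc)
qed

text \<open>Failures at cofinally many levels would form an inverse system of nonempty finite sets
  of pairs. Its limit would contain a pair \<open>x\<close>, \<open>y\<close> fused at every level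
  with \<open>x\<close> in \<open>N\<close> and \<open>y\<close> outside, which
  \<open>strongly_closed_fused\<close> excludes.\<close>

lemma preimage_N_eventually_strongly_closed:
  "\<exists>j\<in>I. rel i j \<and> (\<forall>k\<in>I. rel j k \<longrightarrow> strongly_closed (Fs k) (preimage_N N i k))"
proof (rule ccontr)
  assume contra: "\<not> ?thesis"
  \<comment> \<open>At levels that are not above \<open>i\<close> the preimage makes no sense, and
    \<open>X j\<close> consists of all fused pairs.\<close>
  define X where "X j = {(a, b). a \<in> carrier (fgrp (Fs j)) \<and> b \<in> carrier (fgrp (Fs j)) \<and> fused j a b \<and>
    (rel i j \<longrightarrow> f i j a \<in> g i ` N \<and> f i j b \<notin> g i ` N)}" for j
  have down: "(f j k (fst z), f j k (snd z)) \<in> X j"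
    if "j \<in> I" "k \<in> I" "rel j k" "z \<in> X k" for j k z
  proof -
    have ik: "rel i k" if "rel i j" using rel_trans[OF i \<open>j \<in> I\<close> \<open>k \<in> I\<close> that \<open>rel j k\<close>] .
    obtain a b where z: "z = (a, b)" by force
    then have ab: "a \<in> carrier (fgrp (Fs k))" "b \<in> carrier (fgrp (Fs k))" "fused k a b"
      "rel i j \<Longrightarrow> f i k a \<in> g i ` N" "rel i j \<Longrightarrow> f i k b \<notin> g i ` N" using that ik by (auto simp: X_def)
    have "f i j (f j k c) = f i k c" if "rel i j" "c \<in> carrier (fgrp (Fs k))" for c
      using transition_comp[OF i \<open>j \<in> I\<close> \<open>k \<in> I\<close> that(1) \<open>rel j k\<close> that(2)] .
    then show ?thesis
      using ab z that fused_transition[OF that(1-3) ab(3)] transition_closed[OF that(1-3)] by (simp add: X_def)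
  qed
  have bad: "\<exists>k\<in>I. rel l k \<and> X k \<noteq> {}" if l: "l \<in> I" "rel i l" for l
  proof -
    obtain k where k: "k \<in> I" "rel l k" "\<not> strongly_closed (Fs k) (preimage_N N i k)"
      using contra l by blast
    have ik: "rel i k" using rel_trans[OF i l(1) k(1) l(2) k(2)] .
    obtain R \<theta> x where R: "R \<in> objs (Fs k)" "\<theta> \<in> fhom (Fs k) R (carrier (fgrp (Fs k)))" "R \<subseteq> preimage_N N i k"
      "x \<in> R" "\<theta> x \<notin> preimage_N N i k"
      using k(3) preimage_N_objs[OF k(1) ik] unfolding strongly_closed_def by blast
    interpret Fk: fusion_system p "Fs k" using fusion_systems[OF k(1)] .
    have "\<theta> x \<in> Fk.S" using Fk.fhom_mem[OF R(1) Fk.carrier_objs R(2,4)] .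
    then have "(x, \<theta> x) \<in> X k"
      using R by (auto simp: X_def preimage_N_def fused_def)
    then show ?thesis using k by blast
  qed
  \<comment> \<open>Bad levels are cofinal and bad pairs map down, so every level has one.\<close>
  have X_ne: "X j \<noteq> {}" if j: "j \<in> I" for j
  proof -
    obtain l where l: "l \<in> I" "rel i l" "rel j l" using rel_directed[OF i j] by auto
    obtain k z where k: "k \<in> I" "rel l k" "z \<in> X k" using bad[OF l(1,2)] by blast
    have "rel j k" using rel_trans[OF j l(1) k(1) l(3) k(2)] .
    then show ?thesis using down[OF j k(1) _ k(3)] by blast
  qed
  have "\<exists>z. (\<forall>j\<in>I. z j \<in> X j) \<and>
    (\<forall>j\<in>I. \<forall>k\<in>I. rel j k \<longrightarrow> z j = (f j k (fst (z k)), f j k (snd (z k))))"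
  proof (rule inverse_limit_nonempty)
    show "finite (X j)" if "j \<in> I" for j
    proof (rule finite_subset)
      show "X j \<subseteq> carrier (fgrp (Fs j)) \<times> carrier (fgrp (Fs j))" by (auto simp: X_def)
      show "finite (carrier (fgrp (Fs j)) \<times> carrier (fgrp (Fs j)))"
        using that fusion_system.finite_S[OF fusion_systems, of j] by simp
    qed
    show "\<exists>x\<in>X j. x = (f j k (fst y), f j k (snd y))"
      if "j \<in> I" "k \<in> I" "rel j k" "y \<in> X k" for j k y
      using down[OF that] by simp
    show "x = (f j k (fst y), f j k (snd y))"
      if "j \<in> I" "k \<in> I" "l \<in> I" "rel j k" "rel k l" "z \<in> X l"
        "x = (f j l (fst z), f j l (snd z))" "y = (f k l (fst z), f k l (snd z))" for j k l x y z
      using that transition_comp[OF that(1-5)] by (auto simp: X_def)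
  qed (fact nonempty rel_directed X_ne | erule (4) rel_trans)+
  then obtain z where z: "\<And>j. j \<in> I \<Longrightarrow> z j \<in> X j"
    "\<And>j k. \<lbrakk>j \<in> I; k \<in> I; rel j k\<rbrakk> \<Longrightarrow> z j = (f j k (fst (z k)), f j k (snd (z k)))" by blast
  have zS: "fst (z j) \<in> carrier (fgrp (Fs j))" "snd (z j) \<in> carrier (fgrp (Fs j))"
    "fused j (fst (z j)) (snd (z j))" if "j \<in> I" for j
    using z(1)[OF that] by (auto simp: X_def)
  obtain x where x: "x \<in> S" "\<And>j. j \<in> I \<Longrightarrow> g j x = fst (z j)"
    using g_lim[of "\<lambda>j. fst (z j)"] zS(1) z(2) by (metis fst_conv)
  obtain y where y: "y \<in> S" "\<And>j. j \<in> I \<Longrightarrow> g j y = snd (z j)"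
    using g_lim[of "\<lambda>j. snd (z j)"] zS(2) z(2) by (metis snd_conv)
  \<comment> \<open>At level \<open>i\<close> itself the condition on the pair speaks of its own
    entries, since \<open>f i i\<close> is the identity there.\<close>
  have "g i x \<in> g i ` N" "g i y \<notin> g i ` N"
    using z(1)[OF i] rel_refl[OF i] transition_id[OF i] zS(1,2)[OF i] x(2)[OF i] y(2)[OF i]
    by (auto simp: X_def)
  moreover have "y \<in> N"
    using strongly_closed_fused[OF N kernel_mem y(1)] calculation(1) x y(2) zS(3) by simp
  ultimately show False by auto
qed

end

theorem pro_saturated_lifts:
  assumes p: "prime p" and sat: "\<And>i. i \<in> I \<Longrightarrow> saturated p (Fs i)" and N: "N \<in> open_strongly_closed F"
    and P: "P \<in> objs F" and \<phi>: "\<phi> \<in> fhom F P S"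
  shows "\<exists>\<psi>\<in>fhom F (N <#>\<^bsub>fgrp F\<^esub> P) S. \<forall>u\<in>P. N #>\<^bsub>fgrp F\<^esub> \<psi> u = N #>\<^bsub>fgrp F\<^esub> \<phi> u"
proof -
  interpret N: strongly_closed_fusion F N using strongly_closed_fusion_open[OF N] .
  have NS: "openin (ftop F) N" using N by (simp add: open_strongly_closed_def)
  note Nobj = N.N_objs
  obtain i where i: "i \<in> I" and ker: "\<And>x y. \<lbrakk>x \<in> S; y \<in> S; g i x = g i y\<rbrakk> \<Longrightarrow> x \<cdot> inv_S y \<in> N"
    by (rule open_contains_kernel[OF NS objs_subgroup[OF Nobj]]) blast
  let ?M = "preimage_N N i"
  obtain j0 where j0: "j0 \<in> I" "rel i j0" and M: "\<And>k. \<lbrakk>k \<in> I; rel j0 k\<rbrakk> \<Longrightarrow> strongly_closed (Fs k) (?M k)"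
    using preimage_N_eventually_strongly_closed[OF N.N i ker] by blast
  let ?NP = "N.prod_N P"
  note NP = N.prod_objs[OF P]
  note \<phi>S = fhom_memS[OF P carrier_objs \<phi>]
  have NPS: "u \<in> S" if "u \<in> ?NP" for u using objs_mem[OF NP that] .
  \<comment> \<open>Congruence to \<open>\<phi>\<close> modulo \<open>N\<close> is expressed at
    level \<open>i\<close>, which loses nothing because the kernel of \<open>g i\<close> lies in
    \<open>N\<close>. It is imposed only above \<open>j0\<close>, where the preimages are strongly
    closed; elsewhere \<open>E l\<close> contains all morphisms.\<close>
  define E where "E l = {\<psi> \<in> fhom (Fs l) (g l ` ?NP) (carrier (fgrp (Fs l))).
    rel j0 l \<longrightarrow> (\<forall>u\<in>P. \<exists>n\<in>N. f i l (\<psi> (g l u)) = g i (n \<cdot> \<phi> u))}" for l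
  have down: "\<exists>\<chi>\<in>E l. \<forall>u\<in>?NP. \<chi> (g l u) = f l k (\<psi> (g k u))"
    if l: "l \<in> I" and k: "k \<in> I" and lk: "rel l k" and \<psi>: "\<psi> \<in> E k" for l k \<psi>
  proof -
    interpret Fl: fusion_system p "Fs l" using fusion_systems[OF l] .
    interpret Fk: fusion_system p "Fs k" using fusion_systems[OF k] .
    note gk = g_objs[OF k NP]
    have \<psi>h: "\<psi> \<in> fhom (Fs k) (g k ` ?NP) Fk.S" using \<psi> by (simp add: E_def)
    have im: "f l k ` g k ` ?NP = g l ` ?NP"
      unfolding image_image using g_compat[OF l k lk] NPS by simp
    note t = transition_fhom[OF l k lk gk Fk.carrier_objs \<psi>h]
    obtain \<chi> where \<chi>: "\<chi> \<in> fhom (Fs l) (g l ` ?NP) (f l k ` Fk.S)"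
      "\<And>u. u \<in> g k ` ?NP \<Longrightarrow> f l k (\<psi> u) = \<chi> (f l k u)" using t(3) im by auto
    have "\<chi> \<in> fhom (Fs l) (g l ` ?NP) Fl.S"
      using Fl.fhom_codomain[OF g_objs[OF l NP] t(2) Fl.carrier_objs \<chi>(1)]
        Fl.fhom_memS[OF g_objs[OF l NP] t(2) \<chi>(1)] by blast
    moreover have eq: "\<chi> (g l u) = f l k (\<psi> (g k u))" if "u \<in> ?NP" for u
      using \<chi>(2)[of "g k u"] that g_compat[OF l k lk NPS[OF that]] by simp
    moreover have "\<exists>n\<in>N. f i l (\<chi> (g l u)) = g i (n \<cdot> \<phi> u)" if j0l: "rel j0 l" and u: "u \<in> P" for u
    proof -
      have uNP: "u \<in> ?NP" using N.subset_prod_N[OF P] u by auto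
      have "rel j0 k" "rel i l" using rel_trans[OF j0(1) l k j0l lk] rel_trans[OF i j0(1) l j0(2) j0l] .
      moreover have "\<psi> (g k u) \<in> Fk.S" using Fk.fhom_mem[OF gk Fk.carrier_objs \<psi>h] uNP by blast
      ultimately show ?thesis
        using eq[OF uNP] \<psi> u transition_comp[OF i l k _ lk, of "\<psi> (g k u)"] by (simp add: E_def)
    qed
    ultimately show ?thesis by (intro bexI[of _ \<chi>]) (auto simp: E_def)
  qed
  \<comment> \<open>The finite theorem lifts modulo the preimage \<open>?M k\<close> of
    \<open>N\<close>. The lift is defined on a subgroup containing the image of \<open>NP\<close>,
    and its restriction to that image is the desired element.\<close>
  have E_top: "E k \<noteq> {}" if k: "k \<in> I" "rel j0 k" for k
  proof -
    interpret Fk: fusion_system p "Fs k" using fusion_systems[OF k(1)] .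
    interpret Gi: group "fgrp (Fs i)" using group_Fs[OF i] .
    interpret Mk: strongly_closed_fusion "Fs k" "?M k"
      using Fk.strongly_closed_fusionI[OF M[OF k]] .
    have ik: "rel i k" using rel_trans[OF i j0(1) k(1) j0(2) k(2)] .
    note gP = g_objs[OF k(1) P] and gS = g_objs[OF k(1) carrier_objs] and gNP = g_objs[OF k(1) NP]
    obtain \<chi> where \<chi>: "\<chi> \<in> fhom (Fs k) (g k ` P) (g k ` S)" "\<And>u. u \<in> P \<Longrightarrow> g k (\<phi> u) = \<chi> (g k u)"
      by (rule fhom_at[OF P carrier_objs \<phi> k(1)]) blast
    have "\<chi> \<in> fhom (Fs k) (g k ` P) Fk.S"
      using Fk.fhom_codomain[OF gP gS Fk.carrier_objs \<chi>(1)] Fk.fhom_memS[OF gP gS \<chi>(1)] by blast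
    from saturated_lifts[OF p sat[OF k(1)] M[OF k] gP this]
    obtain \<psi> where \<psi>: "\<psi> \<in> fhom (Fs k) (Mk.prod_N (g k ` P)) Fk.S"
      "\<forall>w\<in>g k ` P. Mk.coset_N (\<psi> w) = Mk.coset_N (\<chi> w)" ..
    have MP: "Mk.prod_N (g k ` P) \<in> objs (Fs k)" using Mk.prod_objs[OF gP] .
    have sub: "g k ` ?NP \<subseteq> Mk.prod_N (g k ` P)"
    proof
      fix w assume "w \<in> g k ` ?NP"
      then obtain n u where nu: "n \<in> N" "u \<in> P" "w = g k (n \<cdot> u)" by (auto simp: N.prod_N_mem)
      have nS: "n \<in> S" using N.N_mem[OF nu(1)] .
      have "g k n \<in> ?M k"
        unfolding preimage_N_def mem_Collect_eq g_compat[OF i k(1) ik nS]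
        using nu(1) g_closed[OF k(1) nS] by blast
      moreover have "w = g k n \<otimes>\<^bsub>fgrp (Fs k)\<^esub> g k u"
        unfolding nu(3) using g_mult[OF k(1) nS objs_mem[OF P nu(2)]] .
      ultimately show "w \<in> Mk.prod_N (g k ` P)" using nu(2) unfolding Mk.prod_N_mem by blast
    qed
    let ?\<psi> = "restrict \<psi> (g k ` ?NP)"
    have r: "?\<psi> \<in> fhom (Fs k) (g k ` ?NP) Fk.S"
      using Fk.fhom_restrict[OF MP Fk.carrier_objs gNP \<psi>(1) sub] .
    have "\<exists>n\<in>N. f i k (?\<psi> (g k u)) = g i (n \<cdot> \<phi> u)" if u: "u \<in> P" for u
    proof -
      have uNP: "g k u \<in> g k ` ?NP" using N.subset_prod_N[OF P] u by auto
      have \<psi>S: "\<psi> (g k u) \<in> Fk.S" using Fk.fhom_memS[OF MP Fk.carrier_objs \<psi>(1)] sub uNP by blast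
      have "Mk.coset_N (\<psi> (g k u)) = Mk.coset_N (g k (\<phi> u))" using bspec[OF \<psi>(2), of "g k u"] \<chi>(2)[OF u] u by simp
      then obtain m where m: "m \<in> ?M k" "\<psi> (g k u) = m \<otimes>\<^bsub>fgrp (Fs k)\<^esub> g k (\<phi> u)"
        by (rule Mk.coset_eqE[OF \<psi>S g_closed[OF k(1) \<phi>S[OF u]]]) blast
      obtain n where n: "n \<in> N" "f i k m = g i n" using m(1) unfolding preimage_N_def by blast
      have "f i k (\<psi> (g k u)) = f i k m \<otimes>\<^bsub>fgrp (Fs i)\<^esub> f i k (g k (\<phi> u))"
        unfolding m(2) using transition_mult[OF i k(1) ik Mk.N_mem[OF m(1)] g_closed[OF k(1) \<phi>S[OF u]]] .
      also have "\<dots> = g i (n \<cdot> \<phi> u)"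
        unfolding n(2) g_compat[OF i k(1) ik \<phi>S[OF u]] g_mult[OF i N.N_mem[OF n(1)] \<phi>S[OF u]] ..
      finally show ?thesis unfolding restrict_apply'[OF uNP] using n(1) by blast
    qed
    with r have "?\<psi> \<in> E k" by (simp add: E_def)
    then show ?thesis by blast
  qed
  \<comment> \<open>Compatibility of the lifts is a relation on the points of \<open>NP\<close>:
    passing to a lower level is given by the existence of \<open>\<chi>\<close> in
    \<open>down\<close> and not by a chosen map, hence the relational form of the compactness
    argument.\<close>
  have "\<exists>\<psi>. (\<forall>l\<in>I. \<psi> l \<in> E l) \<and>
    (\<forall>l\<in>I. \<forall>k\<in>I. rel l k \<longrightarrow> (\<forall>u\<in>?NP. \<psi> l (g l u) = f l k (\<psi> k (g k u))))"
  proof (rule inverse_limit_nonempty)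
    show "finite (E l)" if "l \<in> I" for l
    proof -
      interpret Fl: fusion_system p "Fs l" using fusion_systems[OF that] .
      note gl = g_objs[OF that NP]
      have "E l \<subseteq> g l ` ?NP \<rightarrow>\<^sub>E Fl.S"
      proof
        fix \<psi> assume "\<psi> \<in> E l"
        then have h: "\<psi> \<in> fhom (Fs l) (g l ` ?NP) Fl.S" unfolding E_def by blast
        show "\<psi> \<in> g l ` ?NP \<rightarrow>\<^sub>E Fl.S"
          using Fl.fhom_mem[OF gl Fl.carrier_objs h] Fl.fhom_extensional[OF gl Fl.carrier_objs h]
          unfolding PiE_def Pi_def by blast
      qed
      moreover have "finite (g l ` ?NP \<rightarrow>\<^sub>E Fl.S)"
        using Fl.finite_objs[OF gl] Fl.finite_S by (simp add: finite_PiE)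
      ultimately show ?thesis by (rule finite_subset)
    qed
    show "E l \<noteq> {}" if l: "l \<in> I" for l
    proof -
      obtain k where k: "k \<in> I" "rel l k" "rel j0 k" using rel_directed[OF l j0(1)] by auto
      then show ?thesis using E_top[OF k(1,3)] down[OF l k(1,2)] by blast
    qed
    show "\<exists>\<chi>\<in>E l. \<forall>u\<in>?NP. \<chi> (g l u) = f l k (\<psi> (g k u))"
      if "l \<in> I" "k \<in> I" "rel l k" "\<psi> \<in> E k" for l k \<psi> using down[OF that] .
    show "\<forall>u\<in>?NP. \<chi> (g l u) = f l k (\<psi> (g k u))"
      if "l \<in> I" "k \<in> I" "m \<in> I" "rel l k" "rel k m" "\<chi> \<in> E l" "\<psi> \<in> E k" "\<theta> \<in> E m"
        "\<forall>u\<in>?NP. \<chi> (g l u) = f l m (\<theta> (g m u))" "\<forall>u\<in>?NP. \<psi> (g k u) = f k m (\<theta> (g m u))" for l k m \<chi> \<psi> \<theta>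
    proof
      fix u assume u: "u \<in> ?NP"
      interpret Fm: fusion_system p "Fs m" using fusion_systems[OF that(3)] .
      have "\<theta> (g m u) \<in> Fm.S"
        using Fm.fhom_mem[OF g_objs[OF that(3) NP] Fm.carrier_objs] that(8) u by (auto simp: E_def)
      then show "\<chi> (g l u) = f l k (\<psi> (g k u))"
        using that(9,10) u transition_comp[OF that(1-5)] by simp
    qed
  qed (fact nonempty rel_directed | erule (4) rel_trans)+
  then obtain \<psi> where \<psi>0: "(\<forall>l\<in>I. \<psi> l \<in> E l) \<and>
    (\<forall>l\<in>I. \<forall>k\<in>I. rel l k \<longrightarrow> (\<forall>u\<in>?NP. \<psi> l (g l u) = f l k (\<psi> k (g k u))))" ..
  have \<psi>: "l \<in> I \<Longrightarrow> \<psi> l \<in> E l"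
    "\<lbrakk>l \<in> I; k \<in> I; rel l k; u \<in> ?NP\<rbrakk> \<Longrightarrow> f l k (\<psi> k (g k u)) = \<psi> l (g l u)" for l k u
    using \<psi>0 by simp_all
  have \<psi>h: "\<psi> l \<in> fhom (Fs l) (g l ` ?NP) (carrier (fgrp (Fs l)))" if "l \<in> I" for l
    using \<psi>(1)[OF that] by (simp add: E_def)
  have \<psi>S: "\<psi> l (g l u) \<in> carrier (fgrp (Fs l))" if "l \<in> I" "u \<in> ?NP" for l u
  proof -
    interpret Fl: fusion_system p "Fs l" using fusion_systems[OF that(1)] .
    show ?thesis using Fl.fhom_mem[OF g_objs[OF that(1) NP] Fl.carrier_objs \<psi>h[OF that(1)]] that(2) by blast
  qed
  have "\<exists>w. u \<in> ?NP \<longrightarrow> w \<in> S \<and> (\<forall>l\<in>I. g l w = \<psi> l (g l u))" for u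
    using g_lim[of "\<lambda>l. \<psi> l (g l u)"] \<psi>S \<psi>(2) by blast
  then obtain \<Psi> where \<Psi>: "\<And>u. u \<in> ?NP \<Longrightarrow> \<Psi> u \<in> S"
    "\<And>u l. u \<in> ?NP \<Longrightarrow> l \<in> I \<Longrightarrow> g l (\<Psi> u) = \<psi> l (g l u)" by metis
  have "restrict \<Psi> ?NP \<in> fhom F ?NP S"
  proof (rule fhom_iff[OF NP carrier_objs, THEN iffD2], intro conjI ballI)
    show "restrict \<Psi> ?NP ` ?NP \<subseteq> S" using \<Psi>(1) by auto
    fix l assume l: "l \<in> I"
    interpret Fl: fusion_system p "Fs l" using fusion_systems[OF l] .
    have "\<psi> l ` g l ` ?NP \<subseteq> g l ` S" using \<Psi>(1) by (auto simp flip: \<Psi>(2)[OF _ l])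
    then have "\<psi> l \<in> fhom (Fs l) (g l ` ?NP) (g l ` S)"
      using Fl.fhom_codomain[OF g_objs[OF l NP] Fl.carrier_objs g_objs[OF l carrier_objs] \<psi>h[OF l]] by simp
    then show "\<exists>\<chi>\<in>fhom (Fs l) (g l ` ?NP) (g l ` S). \<forall>u\<in>?NP. g l (restrict \<Psi> ?NP u) = \<chi> (g l u)"
      using \<Psi>(2)[OF _ l] by (intro bexI[of _ "\<psi> l"]) auto
  qed simp
  moreover have "N.coset_N (restrict \<Psi> ?NP u) = N.coset_N (\<phi> u)" if u: "u \<in> P" for u
  proof -
    have uNP: "u \<in> ?NP" using N.subset_prod_N[OF P] u by auto
    \<comment> \<open>By reflexivity \<open>E j0\<close> itself records the congruence to
      \<open>\<phi>\<close>; level \<open>j0\<close> is above \<open>i\<close>, so it yields the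
      congruence at level \<open>i\<close> for the glued map.\<close>
    obtain n where n: "n \<in> N" "f i j0 (\<psi> j0 (g j0 u)) = g i (n \<cdot> \<phi> u)"
      using \<psi>(1)[OF j0(1)] rel_refl[OF j0(1)] u unfolding E_def by blast
    have n\<phi>: "n \<cdot> \<phi> u \<in> S" using N.N_mem[OF n(1)] \<phi>S[OF u] by simp
    have "g i (\<Psi> u) = g i (n \<cdot> \<phi> u)"
      using n(2) \<Psi>(2)[OF uNP j0(1)] g_compat[OF i j0 \<Psi>(1)[OF uNP]] by simp
    then have "N.coset_N (\<Psi> u) = N.coset_N (n \<cdot> \<phi> u)"
      using ker[OF \<Psi>(1)[OF uNP] n\<phi>] N.coset_eq_iff[OF \<Psi>(1)[OF uNP] n\<phi>] by simp
    then show ?thesis using uNP N.coset_mult_N[OF n(1) \<phi>S[OF u]] by simp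
  qed
  ultimately show ?thesis by blast
qed

end

section \<open>Quotients and isomorphisms\<close>

text \<open>The equation determines \<open>\<chi>\<close> on the image of \<open>P\<close> and
  extensionality determines it elsewhere. Morphisms picked by choice therefore respect identities
  and composition automatically.\<close>

lemma induced_functor_exI:
  assumes F: "fusion_category F"
    and objs: "\<And>P. P \<in> objs F \<Longrightarrow> \<alpha> ` P \<in> objs G"
    and ext: "\<And>X Y \<chi>. \<lbrakk>X \<in> objs G; Y \<in> objs G; \<chi> \<in> fhom G X Y\<rbrakk> \<Longrightarrow> \<chi> \<in> extensional X"
    and ex: "\<And>P Q \<phi>. \<lbrakk>P \<in> objs F; Q \<in> objs F; \<phi> \<in> fhom F P Q\<rbrakk> \<Longrightarrow>
      \<exists>\<chi>\<in>fhom G (\<alpha> ` P) (\<alpha> ` Q). \<forall>u\<in>P. \<alpha> (\<phi> u) = \<chi> (\<alpha> u)"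
  shows "\<exists>A. induced_functor F G \<alpha> A"
proof -
  interpret fusion_category F by (rule F)
  define A where "A P Q \<phi> = (SOME \<chi>. \<chi> \<in> fhom G (\<alpha> ` P) (\<alpha> ` Q) \<and> (\<forall>u\<in>P. \<alpha> (\<phi> u) = \<chi> (\<alpha> u)))" for P Q \<phi>
  have A: "A P Q \<phi> \<in> fhom G (\<alpha> ` P) (\<alpha> ` Q) \<and> (\<forall>u\<in>P. \<alpha> (\<phi> u) = A P Q \<phi> (\<alpha> u))"
    if "P \<in> objs F" "Q \<in> objs F" "\<phi> \<in> fhom F P Q" for P Q \<phi>
  proof -
    have "\<exists>\<chi>. \<chi> \<in> fhom G (\<alpha> ` P) (\<alpha> ` Q) \<and> (\<forall>u\<in>P. \<alpha> (\<phi> u) = \<chi> (\<alpha> u))" using ex[OF that] by blast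
    from someI_ex[OF this] show ?thesis unfolding A_def .
  qed
  have A_ext: "A P Q \<phi> \<in> extensional (\<alpha> ` P)"
    if "P \<in> objs F" "Q \<in> objs F" "\<phi> \<in> fhom F P Q" for P Q \<phi>
    using ext[OF objs objs] that A[OF that] by blast
  have "A P P (\<lambda>u\<in>P. u) = (\<lambda>v\<in>\<alpha> ` P. v)" if P: "P \<in> objs F" for P
  proof (rule extensionalityI[OF A_ext[OF P P fhom_id[OF P]] restrict_extensional])
    fix v assume "v \<in> \<alpha> ` P"
    then obtain u where u: "u \<in> P" "v = \<alpha> u" ..
    have "A P P (\<lambda>u\<in>P. u) (\<alpha> u) = \<alpha> ((\<lambda>u\<in>P. u) u)" using A[OF P P fhom_id[OF P]] u(1) by metis
    then show "A P P (\<lambda>u\<in>P. u) v = (\<lambda>v\<in>\<alpha> ` P. v) v" using u by simp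
  qed
  moreover have "A P R (compose P \<psi> \<phi>) = compose (\<alpha> ` P) (A Q R \<psi>) (A P Q \<phi>)"
    if P: "P \<in> objs F" and Q: "Q \<in> objs F" and R: "R \<in> objs F"
      and \<phi>: "\<phi> \<in> fhom F P Q" and \<psi>: "\<psi> \<in> fhom F Q R" for P Q R \<phi> \<psi>
  proof (rule extensionalityI[OF A_ext[OF P R fhom_compose[OF P Q R \<phi> \<psi>]] compose_extensional])
    fix v assume "v \<in> \<alpha> ` P"
    then obtain u where u: "u \<in> P" "v = \<alpha> u" ..
    have "A P R (compose P \<psi> \<phi>) (\<alpha> u) = \<alpha> (compose P \<psi> \<phi> u)"
      using A[OF P R fhom_compose[OF P Q R \<phi> \<psi>]] u(1) by metis
    also have "\<dots> = A Q R \<psi> (\<alpha> (\<phi> u))"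
      using A[OF Q R \<psi>] fhom_mem[OF P Q \<phi> u(1)] u(1) by (simp add: compose_eq)
    also have "\<dots> = A Q R \<psi> (A P Q \<phi> (\<alpha> u))" using A[OF P Q \<phi>] u(1) by simp
    finally show "A P R (compose P \<psi> \<phi>) v = compose (\<alpha> ` P) (A Q R \<psi>) (A P Q \<phi>) v"
      using u by (simp add: compose_eq)
  qed
  ultimately show ?thesis
    unfolding induced_functor_def using A objs by (intro exI[of _ A]) blast
qed

text \<open>The assumptions are what openness of \<open>N\<close> provides. The second one makes the
  preimage \<open>\<Union>X\<close> of every subgroup \<open>X\<close> of \<open>S/N\<close> an
  object of \<open>F\<close>.\<close>

locale quotient_fusion = strongly_closed_fusion F N for F :: "'a fusion_data" and N +
  fixes p :: nat
  assumes p_quotient: "finite_p_group p (fgrp F Mod N)"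
    and objs_above: "\<lbrakk>subgroup H (fgrp F); N \<subseteq> H\<rbrakk> \<Longrightarrow> H \<in> objs F"
begin

abbreviation FN where "FN \<equiv> fusion_quotient F N"

lemma fgrp_FN: "fgrp FN = fgrp F Mod N"
  by (simp add: fusion_quotient_def)

lemma carrier_FN: "carrier (fgrp FN) = coset_N ` S"
  by (simp add: fgrp_FN carrier_FactGroup)

lemma group_FN: "group (fgrp FN)"
  unfolding fgrp_FN by (rule factorgroup_is_group)

lemma ftop_FN: "ftop FN = discrete_topology (carrier (fgrp FN))"
  by (simp add: fusion_quotient_def)

lemma objs_FN_iff: "X \<in> objs FN \<longleftrightarrow> subgroup X (fgrp FN)"
  using subgroup.subset[of X "fgrp FN"] by (auto simp: objs_def ftop_FN)

text \<open>The correspondence between subgroups of \<open>S/N\<close> and subgroups of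
  \<open>S\<close> that contain \<open>N\<close>.\<close>

lemma objs_FN_union:
  assumes "X \<in> objs FN"
  shows "\<Union>X \<in> objs F" "N \<subseteq> \<Union>X" "X = coset_N ` \<Union>X" "\<And>u. u \<in> S \<Longrightarrow> u \<in> \<Union>X \<longleftrightarrow> coset_N u \<in> X"
proof -
  have X: "subgroup X (fgrp F Mod N)" using assms by (simp add: objs_FN_iff fgrp_FN)
  have coset: "C \<in> coset_N ` S" if "C \<in> X" for C
    using subgroup.mem_carrier[OF X that] by (simp add: carrier_FactGroup)
  show mem: "u \<in> \<Union>X \<longleftrightarrow> coset_N u \<in> X" if u: "u \<in> S" for u
  proof
    assume "u \<in> \<Union>X"
    then obtain C where C: "C \<in> X" "u \<in> C" by auto
    then obtain x where x: "x \<in> S" "C = coset_N x" using coset by auto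
    then have "C = coset_N u" using C repr_independence[OF _ x(1) subgroup_axioms] by auto
    then show "coset_N u \<in> X" using C by simp
  qed (use rcos_self[OF u subgroup_axioms] in blast)
  have XS: "\<Union>X \<subseteq> S"
    using coset r_coset_subset_G[OF subset] by fastforce
  show X_eq: "X = coset_N ` \<Union>X"
  proof (intro equalityI subsetI)
    fix C assume C: "C \<in> X"
    then obtain x where x: "x \<in> S" "C = coset_N x" using coset by auto
    then have "x \<in> \<Union>X" using mem C by blast
    then show "C \<in> coset_N ` \<Union>X" using x by blast
  qed (use mem XS in blast)
  have one: "N \<in> X" using subgroup.one_closed[OF X] by simp
  then show NX: "N \<subseteq> \<Union>X" by blast
  have "subgroup (\<Union>X) (fgrp F)"
  proof (rule subgroupI[OF XS])
    show "\<Union>X \<noteq> {}" using NX one_closed by blast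
    fix u assume u: "u \<in> \<Union>X"
    have uS: "u \<in> S" using XS u by blast
    have uX: "coset_N u \<in> X" using mem[OF uS] u by simp
    have "inv\<^bsub>fgrp F Mod N\<^esub> (coset_N u) \<in> X" using subgroup.m_inv_closed[OF X uX] .
    also have "inv\<^bsub>fgrp F Mod N\<^esub> (coset_N u) = coset_N (inv_S u)"
      using inv_FactGroup[of "coset_N u"] rcos_inv[OF uS] uS by (simp add: carrier_FactGroup)
    finally show "inv_S u \<in> \<Union>X" using mem uS by simp
    fix v assume v: "v \<in> \<Union>X"
    have vS: "v \<in> S" using XS v by blast
    have "coset_N u \<otimes>\<^bsub>fgrp F Mod N\<^esub> coset_N v \<in> X"
      using subgroup.m_closed[OF X uX] mem[OF vS] v by simp
    also have "coset_N u \<otimes>\<^bsub>fgrp F Mod N\<^esub> coset_N v = coset_N (u \<cdot> v)"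
      using coset_mult[OF uS vS] by simp
    finally show "u \<cdot> v \<in> \<Union>X" using mem uS vS by simp
  qed
  then show "\<Union>X \<in> objs F" using objs_above NX by blast
qed

lemma coset_hom: "coset_N \<in> hom (fgrp F) (fgrp FN)"
  unfolding fgrp_FN by (rule r_coset_hom_Mod)

lemma coset_image_objs: "P \<in> objs F \<Longrightarrow> coset_N ` P \<in> objs FN"
  using group_hom.subgroup_img_is_subgroup[of "fgrp F" "fgrp FN" coset_N P] objs_subgroup[of P]
    coset_hom group_FN is_group
  by (simp add: objs_FN_iff group_hom_def group_hom_axioms_def)

lemma union_coset_image: "\<Union>(coset_N ` P) = prod_N P"
  by (auto simp: r_coset_def set_mult_def)

text \<open>A lift already forces \<open>\<phi>\<close> to be multiplicative, so the homomorphism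
  condition of \<open>fusion_quotient\<close> reduces to mapping \<open>X\<close> into
  \<open>Y\<close>.\<close>

lemma fhom_FN_iff:
  assumes X: "X \<in> objs FN" and Y: "Y \<in> objs FN"
  shows "\<phi> \<in> fhom FN X Y \<longleftrightarrow> \<phi> \<in> extensional X \<and> \<phi> ` X \<subseteq> Y \<and>
    (\<exists>\<psi>\<in>fhom F (\<Union>X) S. \<forall>u\<in>\<Union>X. \<phi> (coset_N u) = coset_N (\<psi> u))" (is "?L \<longleftrightarrow> ?R")
proof
  assume ?L
  then show ?R by (auto simp: fusion_quotient_def hom_def)
next
  assume ?R
  then obtain \<psi> where \<psi>: "\<psi> \<in> fhom F (\<Union>X) S" "\<And>u. u \<in> \<Union>X \<Longrightarrow> \<phi> (coset_N u) = coset_N (\<psi> u)"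
    by (elim conjE bexE) metis
  note X' = objs_FN_union[OF X]
  have "\<phi> \<in> hom ((fgrp F Mod N)\<lparr>carrier := X\<rparr>) ((fgrp F Mod N)\<lparr>carrier := Y\<rparr>)"
  proof (rule homI)
    fix C D assume "C \<in> carrier ((fgrp F Mod N)\<lparr>carrier := X\<rparr>)" "D \<in> carrier ((fgrp F Mod N)\<lparr>carrier := X\<rparr>)"
    then have "C \<in> coset_N ` \<Union>X" "D \<in> coset_N ` \<Union>X" using X'(3) by auto
    then obtain u v where uv: "u \<in> \<Union>X" "C = coset_N u" "v \<in> \<Union>X" "D = coset_N v" by blast
    have S: "u \<in> S" "v \<in> S" using objs_mem[OF X'(1)] uv by auto
    have "\<phi> (coset_N (u \<cdot> v)) = coset_N (\<psi> u \<cdot> \<psi> v)"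
      using \<psi>(2)[OF subgroup.m_closed[OF objs_subgroup[OF X'(1)] uv(1,3)]]
        fhom_mult[OF X'(1) carrier_objs \<psi>(1) uv(1,3)] by simp
    then show "\<phi> (C \<otimes>\<^bsub>(fgrp F Mod N)\<lparr>carrier := X\<rparr>\<^esub> D) = \<phi> C \<otimes>\<^bsub>(fgrp F Mod N)\<lparr>carrier := Y\<rparr>\<^esub> \<phi> D"
      using uv \<psi>(2)[OF uv(1)] \<psi>(2)[OF uv(3)] coset_mult[OF S]
        coset_mult[OF fhom_memS[OF X'(1) carrier_objs \<psi>(1) uv(1)] fhom_memS[OF X'(1) carrier_objs \<psi>(1) uv(3)]]
      by simp
  qed (use \<open>?R\<close> in auto)
  with \<open>?R\<close> show ?L by (auto simp: fusion_quotient_def)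
qed

text \<open>Liftability is what lets a morphism of \<open>F\<close> pass to \<open>F/N\<close>; this
  is the effect of the projection to \<open>F/N\<close> on morphisms.\<close>

lemma quotient_lift:
  assumes P: "P \<in> objs F" and R: "R \<in> objs F" and \<phi>: "\<phi> \<in> fhom F P R" and "lifts P \<phi>"
  shows "\<exists>\<chi>\<in>fhom FN (coset_N ` P) (coset_N ` R). \<forall>u\<in>P. coset_N (\<phi> u) = \<chi> (coset_N u)"
proof -
  obtain \<psi> where \<psi>: "\<psi> \<in> fhom F (prod_N P) S" "\<And>u. u \<in> P \<Longrightarrow> coset_N (\<psi> u) = coset_N (\<phi> u)"
    using \<open>lifts P \<phi>\<close> unfolding lifts_def by auto
  note NP = prod_objs[OF P]
  \<comment> \<open>Representatives are taken from all of \<open>NP\<close>. The coset of the value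
    does not depend on them, because \<open>\<psi>\<close> maps \<open>N\<close> into
    \<open>N\<close>.\<close>
  define \<chi> where "\<chi> = (\<lambda>C\<in>coset_N ` P. coset_N (\<psi> (SOME u. u \<in> prod_N P \<and> C = coset_N u)))"
  have \<chi>: "\<chi> (coset_N u) = coset_N (\<psi> u)" if u: "u \<in> prod_N P" for u
  proof -
    define v where "v = (SOME v. v \<in> prod_N P \<and> coset_N u = coset_N v)"
    have "v \<in> prod_N P \<and> coset_N u = coset_N v" unfolding v_def by (rule someI[of _ u]) (use u in simp)
    then have v: "v \<in> prod_N P" "coset_N u = coset_N v" by auto
    obtain m where m: "m \<in> N" "u = m \<cdot> v"
      using coset_eqE[OF objs_mem[OF NP u] objs_mem[OF NP v(1)] v(2)] .
    have mNP: "m \<in> prod_N P" using N_subset_prod_N[OF P] m(1) by blast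
    have "\<psi> u = \<psi> m \<cdot> \<psi> v" using m fhom_mult[OF NP carrier_objs \<psi>(1) mNP v(1)] by simp
    moreover have "\<psi> m \<in> N" using strongly_closed_mem[OF N NP carrier_objs \<psi>(1) mNP m(1)] .
    ultimately have "coset_N (\<psi> u) = coset_N (\<psi> v)"
      using coset_mult_N[OF _ fhom_memS[OF NP carrier_objs \<psi>(1) v(1)]] by simp
    moreover have "coset_N u \<in> coset_N ` P"
    proof -
      obtain n w where "n \<in> N" "w \<in> P" "u = n \<cdot> w" using u by (auto simp: prod_N_mem)
      then show ?thesis using coset_mult_N[of n w] objs_mem[OF P] by simp
    qed
    ultimately show ?thesis by (simp add: \<chi>_def v_def)
  qed
  have \<chi>P: "coset_N (\<phi> u) = \<chi> (coset_N u)" if "u \<in> P" for u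
    using that \<psi>(2) \<chi> subset_prod_N[OF P] by auto
  have "\<chi> \<in> fhom FN (coset_N ` P) (coset_N ` R)"
  proof (rule fhom_FN_iff[OF coset_image_objs[OF P] coset_image_objs[OF R], THEN iffD2], intro conjI)
    show "\<chi> \<in> extensional (coset_N ` P)" by (simp add: \<chi>_def)
    show "\<chi> ` coset_N ` P \<subseteq> coset_N ` R"
      using \<chi>P fhom_mem[OF P R \<phi>] by (auto simp flip: \<chi>P)
    show "\<exists>\<psi>\<in>fhom F (\<Union> (coset_N ` P)) S. \<forall>u\<in>\<Union> (coset_N ` P). \<chi> (coset_N u) = coset_N (\<psi> u)"
      unfolding union_coset_image using \<psi>(1) \<chi> by blast
  qed
  with \<chi>P show ?thesis by blast
qed

lemma fhom_FN_lift:
  assumes X: "X \<in> objs FN" and Y: "Y \<in> objs FN" and \<phi>: "\<phi> \<in> fhom FN X Y"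
  obtains \<psi> where "\<psi> \<in> fhom F (\<Union>X) (\<Union>Y)" "\<And>u. u \<in> \<Union>X \<Longrightarrow> \<phi> (coset_N u) = coset_N (\<psi> u)"
proof -
  note X' = objs_FN_union[OF X] and Y' = objs_FN_union[OF Y]
  obtain \<psi> where \<psi>: "\<psi> \<in> fhom F (\<Union>X) S" "\<And>u. u \<in> \<Union>X \<Longrightarrow> \<phi> (coset_N u) = coset_N (\<psi> u)"
    using fhom_FN_iff[OF X Y, THEN iffD1, OF \<phi>] by metis
  have "\<psi> u \<in> \<Union>Y" if u: "u \<in> \<Union>X" for u
  proof -
    have "u \<in> S" using objs_mem[OF X'(1) u] .
    then have "coset_N u \<in> X" using X'(4) u by blast
    then have "coset_N (\<psi> u) \<in> Y" using \<psi>(2)[OF u] \<phi> fhom_FN_iff[OF X Y] by auto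
    then show ?thesis using Y'(4)[OF fhom_memS[OF X'(1) carrier_objs \<psi>(1) u]] by blast
  qed
  then have "\<psi> \<in> fhom F (\<Union>X) (\<Union>Y)"
    using fhom_codomain[OF X'(1) carrier_objs Y'(1) \<psi>(1)] by blast
  then show ?thesis using that \<psi>(2) by blast
qed

lemma fhom_FN_I:
  assumes X: "X \<in> objs FN" and Y: "Y \<in> objs FN" and "\<phi> \<in> extensional X"
    and \<psi>: "\<psi> \<in> fhom F (\<Union>X) (\<Union>Y)" and eq: "\<And>u. u \<in> \<Union>X \<Longrightarrow> \<phi> (coset_N u) = coset_N (\<psi> u)"
  shows "\<phi> \<in> fhom FN X Y"
proof (rule fhom_FN_iff[OF X Y, THEN iffD2], intro conjI)
  note X' = objs_FN_union[OF X] and Y' = objs_FN_union[OF Y]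
  show "\<phi> ` X \<subseteq> Y"
  proof
    fix D assume "D \<in> \<phi> ` X"
    then obtain C where C: "C \<in> X" "D = \<phi> C" ..
    from C(1) have "C \<in> coset_N ` \<Union>X" using X'(3) by simp
    then obtain u where u: "u \<in> \<Union>X" "C = coset_N u" ..
    have "\<psi> u \<in> \<Union>Y" using fhom_mem[OF X'(1) Y'(1) \<psi> u(1)] .
    then have "coset_N (\<psi> u) \<in> Y" using Y'(4)[OF objs_mem[OF Y'(1)]] by blast
    then show "D \<in> Y" using C u eq[OF u(1)] by simp
  qed
  have "\<psi> \<in> fhom F (\<Union>X) S"
    using fhom_codomain[OF X'(1) Y'(1) carrier_objs \<psi>] fhom_memS[OF X'(1) Y'(1) \<psi>] by blast
  then show "\<exists>\<psi>\<in>fhom F (\<Union>X) S. \<forall>u\<in>\<Union>X. \<phi> (coset_N u) = coset_N (\<psi> u)" using eq by blast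
qed fact

lemma fusion_system_FN: "fusion_system p FN"
proof -
  have cat: "fusion_category FN"
  proof (intro fusion_category.intro fusion_category_axioms.intro)
    show "group (fgrp FN)" by (rule group_FN)
    show "topspace (ftop FN) = carrier (fgrp FN)" by (simp add: ftop_FN)
    fix X Y \<phi> assume X: "X \<in> objs FN" and Y: "Y \<in> objs FN" and \<phi>: "\<phi> \<in> fhom FN X Y"
    note X' = objs_FN_union[OF X] and Y' = objs_FN_union[OF Y]
    show "\<phi> \<in> hom ((fgrp FN)\<lparr>carrier := X\<rparr>) ((fgrp FN)\<lparr>carrier := Y\<rparr>)"
      "\<phi> \<in> extensional X" using \<phi> by (simp_all add: fusion_quotient_def)
    have XY: "X \<subseteq> carrier (fgrp FN)" "Y \<subseteq> carrier (fgrp FN)"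
      using X Y by (auto simp: objs_FN_iff dest: subgroup.subset)
    have "\<phi> ` X \<subseteq> Y" using \<phi> fhom_FN_iff[OF X Y] by blast
    then show "continuous_map (subtopology (ftop FN) X) (subtopology (ftop FN) Y) \<phi>"
      using XY by (auto simp: ftop_FN subtopology_discrete_topology Int_absorb1)
    obtain \<psi> where \<psi>: "\<psi> \<in> fhom F (\<Union>X) (\<Union>Y)" "\<And>u. u \<in> \<Union>X \<Longrightarrow> \<phi> (coset_N u) = coset_N (\<psi> u)"
      by (rule fhom_FN_lift[OF X Y \<phi>]) blast
    note \<psi>S = fhom_memS[OF X'(1) Y'(1) \<psi>(1)]
    \<comment> \<open>Injectivity modulo \<open>N\<close> is the reflection property: a morphism
      sends only elements of \<open>N\<close> into \<open>N\<close>.\<close>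
    have inj: "coset_N u = coset_N v"
      if u: "u \<in> \<Union>X" and v: "v \<in> \<Union>X" and uv: "\<phi> (coset_N u) = \<phi> (coset_N v)" for u v
    proof -
      have v': "inv_S v \<in> \<Union>X" using subgroup.m_inv_closed[OF objs_subgroup[OF X'(1)] v] .
      have "\<psi> (u \<cdot> inv_S v) = \<psi> u \<cdot> inv_S (\<psi> v)"
        using fhom_mult[OF X'(1) Y'(1) \<psi>(1) u v'] fhom_inv[OF X'(1) Y'(1) \<psi>(1) v] by simp
      moreover have "\<psi> u \<cdot> inv_S (\<psi> v) \<in> N"
        using uv \<psi>(2)[OF u] \<psi>(2)[OF v] coset_eq_iff[OF \<psi>S[OF u] \<psi>S[OF v]] by simp
      ultimately have "u \<cdot> inv_S v \<in> N"
        using strongly_closed_reflect[OF N X'(1) Y'(1) \<psi>(1)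
            subgroup.m_closed[OF objs_subgroup[OF X'(1)] u v']] by simp
      then show ?thesis using coset_eq_iff objs_mem[OF X'(1)] u v by simp
    qed
    show "inj_on \<phi> X"
    proof (rule inj_onI)
      fix C D assume "C \<in> X" "D \<in> X" and eq: "\<phi> C = \<phi> D"
      then have "C \<in> coset_N ` \<Union>X" "D \<in> coset_N ` \<Union>X" using X'(3) by simp_all
      then show "C = D" using inj eq by blast
    qed
    fix Z \<chi> assume Z: "Z \<in> objs FN" and \<chi>: "\<chi> \<in> fhom FN Y Z"
    note Z' = objs_FN_union[OF Z]
    obtain \<theta> where \<theta>: "\<theta> \<in> fhom F (\<Union>Y) (\<Union>Z)" "\<And>u. u \<in> \<Union>Y \<Longrightarrow> \<chi> (coset_N u) = coset_N (\<theta> u)"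
      by (rule fhom_FN_lift[OF Y Z \<chi>]) blast
    show "compose X \<chi> \<phi> \<in> fhom FN X Z"
    proof (rule fhom_FN_I[OF X Z compose_extensional fhom_compose[OF X'(1) Y'(1) Z'(1) \<psi>(1) \<theta>(1)]])
      fix u assume u: "u \<in> \<Union>X"
      have "coset_N u \<in> X" using X'(4)[OF objs_mem[OF X'(1) u]] u by blast
      then show "compose X \<chi> \<phi> (coset_N u) = coset_N (compose (\<Union>X) \<theta> \<psi> u)"
        using \<psi>(2)[OF u] \<theta>(2)[OF fhom_mem[OF X'(1) Y'(1) \<psi>(1) u]] compose_eq[of "coset_N u" X \<chi> \<phi>]
          compose_eq[of u "\<Union>X" \<theta> \<psi>] u by simp
    qed
  next
    fix X assume X: "X \<in> objs FN"
    note X' = objs_FN_union[OF X]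
    show "(\<lambda>u\<in>X. u) \<in> fhom FN X X"
    proof (rule fhom_FN_I[OF X X restrict_extensional fhom_id[OF X'(1)]])
      fix u assume u: "u \<in> \<Union>X"
      have "coset_N u \<in> X" using X'(4)[OF objs_mem[OF X'(1) u]] u by blast
      then show "(\<lambda>u\<in>X. u) (coset_N u) = coset_N ((\<lambda>u\<in>\<Union>X. u) u)"
        using restrict_apply'[OF u, of "\<lambda>u. u"] by simp
    qed
  qed
  show ?thesis
  proof (intro fusion_system.intro[OF cat] fusion_system_axioms.intro)
    show "finite_p_group p (fgrp FN)" unfolding fgrp_FN by (rule p_quotient)
    show "ftop FN = discrete_topology (carrier (fgrp FN))" by (rule ftop_FN)
  next
    fix X Y C assume X: "X \<in> objs FN" and Y: "Y \<in> objs FN" and C: "C \<in> carrier (fgrp FN)"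
      and sub: "conj_by (fgrp FN) C ` X \<subseteq> Y"
    note X' = objs_FN_union[OF X] and Y' = objs_FN_union[OF Y]
    obtain x where x: "x \<in> S" "C = coset_N x" using C by (auto simp: carrier_FN)
    have conj: "conj_by (fgrp FN) C (coset_N u) = coset_N (conj_by (fgrp F) x u)" if u: "u \<in> S" for u
    proof -
      have "inv\<^bsub>fgrp FN\<^esub> C = coset_N (inv_S x)"
        using inv_FactGroup[of C] C rcos_inv[OF x(1)] x by (simp add: fgrp_FN)
      then show ?thesis using x u coset_mult by (simp add: fgrp_FN)
    qed
    have "conj_by (fgrp F) x u \<in> \<Union>Y" if u: "u \<in> \<Union>X" for u
    proof -
      have uS: "u \<in> S" using objs_mem[OF X'(1) u] .
      have "coset_N u \<in> X" using X'(4)[OF uS] u by blast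
      then have "coset_N (conj_by (fgrp F) x u) \<in> Y" using sub conj[OF uS] by auto
      then show ?thesis using Y'(4)[of "conj_by (fgrp F) x u"] x uS by blast
    qed
    then have "(\<lambda>u\<in>\<Union>X. conj_by (fgrp F) x u) \<in> fhom F (\<Union>X) (\<Union>Y)"
      by (intro conj_fhom[OF X'(1) Y'(1) x(1)]) blast
    then show "(\<lambda>u\<in>X. conj_by (fgrp FN) C u) \<in> fhom FN X Y"
    proof (rule fhom_FN_I[OF X Y restrict_extensional])
      fix u assume u: "u \<in> \<Union>X"
      have uS: "u \<in> S" using objs_mem[OF X'(1) u] .
      then have "coset_N u \<in> X" using X'(4) u by blast
      then show "(\<lambda>u\<in>X. conj_by (fgrp FN) C u) (coset_N u) = coset_N ((\<lambda>u\<in>\<Union>X. conj_by (fgrp F) x u) u)"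
        using conj[OF uS] restrict_apply'[OF u, of "conj_by (fgrp F) x"] by simp
    qed
  next
    fix X Y \<phi> assume X: "X \<in> objs FN" and Y: "Y \<in> objs FN" and \<phi>: "\<phi> \<in> fhom FN X Y"
    note X' = objs_FN_union[OF X] and Y' = objs_FN_union[OF Y]
    have sub: "\<phi> ` X \<subseteq> Y" and \<phi>e: "\<phi> \<in> extensional X" using \<phi> fhom_FN_iff[OF X Y] by blast+
    obtain \<psi> where \<psi>: "\<psi> \<in> fhom F (\<Union>X) (\<Union>Y)" "\<And>u. u \<in> \<Union>X \<Longrightarrow> \<phi> (coset_N u) = coset_N (\<psi> u)"
      by (rule fhom_FN_lift[OF X Y \<phi>]) blast
    note im = fhom_image[OF X'(1) Y'(1) \<psi>(1)]
    obtain \<theta> where \<theta>: "\<theta> \<in> fiso F (\<psi> ` \<Union>X) (\<Union>X)" "\<And>u. u \<in> \<Union>X \<Longrightarrow> \<theta> (\<psi> u) = u"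
      by (rule fiso_inverse[OF X'(1) im]) blast
    have \<phi>X: "\<phi> ` X = coset_N ` (\<psi> ` \<Union>X)"
    proof -
      have "\<phi> ` X = \<phi> ` (coset_N ` \<Union>X)" using X'(3) by simp
      also have "\<dots> = coset_N ` (\<psi> ` \<Union>X)" unfolding image_image by (rule image_cong[OF refl]) (rule \<psi>(2))
      finally show ?thesis .
    qed
    have R: "\<phi> ` X \<in> objs FN" unfolding \<phi>X using coset_image_objs[OF im(1)] .
    have "\<psi> \<in> fhom F (\<Union>X) S"
      using fhom_codomain[OF X'(1) Y'(1) carrier_objs \<psi>(1)] fhom_memS[OF X'(1) Y'(1) \<psi>(1)] by blast
    \<comment> \<open>Since the lift maps \<open>N\<close> onto \<open>N\<close>, its image is the
      full preimage of the image of \<open>\<phi>\<close>. The inverse of the lift is then a lift of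
      the inverse of \<open>\<phi>\<close>.\<close>
    then have "N \<subseteq> \<psi> ` \<Union>X" using image_N[OF X'(1) _ X'(2)] X'(2) by blast
    then have U: "\<Union>(\<phi> ` X) = \<psi> ` \<Union>X"
      unfolding \<phi>X union_coset_image using prod_N_absorb[OF im(1)] by blast
    have fw: "\<phi> \<in> fhom FN X (\<phi> ` X)"
    proof (rule fhom_FN_I[OF X R \<phi>e])
      show "\<psi> \<in> fhom F (\<Union>X) (\<Union>(\<phi> ` X))" unfolding U using fisoD(1)[OF X'(1) im] .
    qed (rule \<psi>(2))
    have inj: "inj_on \<phi> X" using fusion_category.fhom_inj[OF cat X Y \<phi>] .
    let ?\<chi> = "restrict (inv_into X \<phi>) (\<phi> ` X)"
    have bw: "?\<chi> \<in> fhom FN (\<phi> ` X) X"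
    proof (rule fhom_FN_I[OF R X restrict_extensional])
      show "\<theta> \<in> fhom F (\<Union>(\<phi> ` X)) (\<Union>X)" unfolding U using fisoD(1)[OF im(1) X'(1) \<theta>(1)] .
      fix w assume "w \<in> \<Union>(\<phi> ` X)"
      then obtain u where u: "u \<in> \<Union>X" "w = \<psi> u" unfolding U ..
      have "coset_N u \<in> X" using X'(4)[OF objs_mem[OF X'(1) u(1)]] u(1) by blast
      then show "?\<chi> (coset_N w) = coset_N (\<theta> w)"
        using inj \<theta>(2)[OF u(1)] u(2) by (simp flip: \<psi>(2)[OF u(1)])
    qed
    have "compose X ?\<chi> \<phi> = (\<lambda>u\<in>X. u)" "compose (\<phi> ` X) \<phi> ?\<chi> = (\<lambda>v\<in>\<phi> ` X. v)"
      using inj by (auto simp: compose_def fun_eq_iff f_inv_into_f)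
    with fw bw have "\<phi> \<in> fiso FN X (\<phi> ` X)" unfolding fiso_def by blast
    with R sub show "\<exists>R\<in>objs FN. R \<subseteq> Y \<and> \<phi> \<in> fiso FN X R" by blast
  qed
qed

end

text \<open>The condition on \<open>fhom\<close> says that \<open>\<alpha>\<close> transports the
  morphisms of \<open>F\<close> bijectively to those of \<open>G\<close> between image subgroups,
  and by the condition on open sets every object of \<open>G\<close> is such an image.\<close>

lemma fusion_isomorphicI:
  assumes F: "fusion_category F" and G: "group (fgrp G)" and topG: "topspace (ftop G) = carrier (fgrp G)"
    and bij: "bij_betw \<alpha> (carrier (fgrp F)) (carrier (fgrp G))"
    and hom: "\<alpha> \<in> hom (fgrp F) (fgrp G)"
    and openin_iff: "\<And>U. U \<subseteq> carrier (fgrp F) \<Longrightarrow> openin (ftop G) (\<alpha> ` U) \<longleftrightarrow> openin (ftop F) U"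
    and fhom: "\<And>P Q \<chi>. \<lbrakk>P \<in> objs F; Q \<in> objs F\<rbrakk> \<Longrightarrow> \<chi> \<in> fhom G (\<alpha> ` P) (\<alpha> ` Q) \<longleftrightarrow>
      \<chi> \<in> extensional (\<alpha> ` P) \<and> (\<exists>\<phi>\<in>fhom F P Q. \<forall>u\<in>P. \<chi> (\<alpha> u) = \<alpha> (\<phi> u))"
  shows "F \<cong>\<^sub>f G"
proof -
  interpret fusion_category F by (rule F)
  let ?T = "carrier (fgrp G)"
  define \<beta> where "\<beta> = inv_into S \<alpha>"
  have \<beta>\<alpha>: "\<beta> (\<alpha> x) = x" if "x \<in> S" for x
    using bij that by (simp add: \<beta>_def bij_betw_def)
  have \<alpha>\<beta>: "\<alpha> (\<beta> y) = y" if "y \<in> ?T" for y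
    using bij that by (simp add: \<beta>_def bij_betw_inv_into_right)
  have \<beta>S: "\<beta> y \<in> S" if "y \<in> ?T" for y
    using bij that by (metis \<beta>_def bij_betw_def inv_into_into)
  have \<alpha>T: "\<alpha> x \<in> ?T" if "x \<in> S" for x
    using bij that by (auto simp: bij_betw_def)
  have im_\<beta>: "{x \<in> S. \<alpha> x \<in> V} = \<beta> ` V" if "V \<subseteq> ?T" for V
    using that \<beta>\<alpha> \<alpha>\<beta> \<beta>S by (auto simp: image_iff) (metis subsetD)+
  have im_\<alpha>: "{y \<in> ?T. \<beta> y \<in> U} = \<alpha> ` U" if "U \<subseteq> S" for U
    using that \<beta>\<alpha> \<alpha>\<beta> \<alpha>T by (auto simp: image_iff) (metis subsetD)+
  have \<alpha>\<beta>_image: "\<alpha> ` \<beta> ` V = V" if "V \<subseteq> ?T" for V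
    using that \<alpha>\<beta> by (force simp: image_iff)
  have open_\<beta>: "openin (ftop F) (\<beta> ` V) \<longleftrightarrow> openin (ftop G) V" if V: "V \<subseteq> ?T" for V
    using openin_iff[of "\<beta> ` V"] \<alpha>\<beta>_image[OF V] \<beta>S V by (metis image_subset_iff subsetD)
  have cont_\<alpha>: "continuous_map (ftop F) (ftop G) \<alpha>"
    unfolding continuous_map_def topspace_eq topG
    using im_\<beta> open_\<beta> \<alpha>T openin_subset[of "ftop G"] topG by auto
  have cont_\<beta>: "continuous_map (ftop G) (ftop F) \<beta>"
    unfolding continuous_map_def topspace_eq topG
    using im_\<alpha> openin_iff \<beta>S openin_subset[of "ftop F"] topspace_eq by auto
  have hom_\<beta>: "\<beta> \<in> hom (fgrp G) (fgrp F)"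
  proof (rule homI)
    fix x y assume xy: "x \<in> ?T" "y \<in> ?T"
    then have "\<alpha> (\<beta> x \<cdot> \<beta> y) = x \<otimes>\<^bsub>fgrp G\<^esub> y" using hom_mult[OF hom \<beta>S \<beta>S] \<alpha>\<beta> by simp
    then show "\<beta> (x \<otimes>\<^bsub>fgrp G\<^esub> y) = \<beta> x \<cdot> \<beta> y" using \<beta>\<alpha>[of "\<beta> x \<cdot> \<beta> y"] \<beta>S xy by simp
  qed (rule \<beta>S)
  have objs_\<alpha>: "\<alpha> ` P \<in> objs G" if P: "P \<in> objs F" for P
  proof -
    have "subgroup (\<alpha> ` P) (fgrp G)"
      using group_hom.subgroup_img_is_subgroup[of "fgrp F" "fgrp G" \<alpha> P] objs_subgroup[OF P] hom G is_group
      by (simp add: group_hom_def group_hom_axioms_def)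
    moreover have "?T - \<alpha> ` P = \<alpha> ` (S - P)"
      using inj_on_image_set_diff[of \<alpha> S S P] bij objs_subset[OF P] by (simp add: bij_betw_def)
    moreover have "openin (ftop F) (S - P)" using P topspace_eq by (simp add: objs_def closedin_def)
    moreover have "\<alpha> ` P \<subseteq> ?T" using \<alpha>T objs_mem[OF P] by auto
    ultimately show ?thesis using openin_iff[of "S - P"] topG by (simp add: objs_def closedin_def)
  qed
  have objs_\<beta>: "\<beta> ` X \<in> objs F" "\<alpha> ` \<beta> ` X = X" if X: "X \<in> objs G" for X
  proof -
    have XT: "X \<subseteq> ?T" using X subgroup.subset by (auto simp: objs_def)
    show "\<alpha> ` \<beta> ` X = X" using \<alpha>\<beta>_image[OF XT] .
    have "subgroup (\<beta> ` X) (fgrp F)"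
      using group_hom.subgroup_img_is_subgroup[of "fgrp G" "fgrp F" \<beta> X] X hom_\<beta> G is_group
      by (simp add: group_hom_def group_hom_axioms_def objs_def)
    moreover have "S - \<beta> ` X = \<beta> ` (?T - X)"
      unfolding im_\<beta>[OF Diff_subset, symmetric] im_\<beta>[OF XT, symmetric] using \<alpha>T by auto
    moreover have "openin (ftop G) (?T - X)" using X topG by (simp add: objs_def closedin_def)
    moreover have "\<beta> ` X \<subseteq> S" using \<beta>S XT by auto
    ultimately show "\<beta> ` X \<in> objs F"
      using open_\<beta>[of "?T - X"] topspace_eq by (simp add: objs_def closedin_def)
  qed
  have "\<exists>A. induced_functor F G \<alpha> A"
  proof (rule induced_functor_exI[OF F objs_\<alpha>])
    show "\<chi> \<in> extensional X" if "X \<in> objs G" "Y \<in> objs G" "\<chi> \<in> fhom G X Y" for X Y \<chi>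
      using fhom[OF objs_\<beta>(1)[OF that(1)] objs_\<beta>(1)[OF that(2)], of \<chi>] objs_\<beta>(2) that by simp
    show "\<exists>\<chi>\<in>fhom G (\<alpha> ` P) (\<alpha> ` Q). \<forall>u\<in>P. \<alpha> (\<phi> u) = \<chi> (\<alpha> u)"
      if P: "P \<in> objs F" and Q: "Q \<in> objs F" and \<phi>: "\<phi> \<in> fhom F P Q" for P Q \<phi>
    proof -
      let ?\<chi> = "\<lambda>v\<in>\<alpha> ` P. \<alpha> (\<phi> (\<beta> v))"
      have eq: "?\<chi> (\<alpha> u) = \<alpha> (\<phi> u)" if "u \<in> P" for u
        using that \<beta>\<alpha>[OF objs_mem[OF P that]] by simp
      then have "?\<chi> \<in> fhom G (\<alpha> ` P) (\<alpha> ` Q)" using fhom[OF P Q, of ?\<chi>] \<phi> by auto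
      then show ?thesis using eq by metis
    qed
  qed
  moreover have "\<exists>B. induced_functor G F \<beta> B"
  proof -
    \<comment> \<open>\<open>induced_functor_exI\<close> wants a fusion category as its source, and
      \<open>G\<close> is not yet known to be one; so the functor of \<open>\<beta>\<close> is
      written down as transport along \<open>\<beta>\<close>.\<close>
    define B where "B X Y \<chi> = (\<lambda>u\<in>\<beta> ` X. \<beta> (\<chi> (\<alpha> u)))" for X Y :: "'b set" and \<chi>
    have XT: "v \<in> ?T" if "X \<in> objs G" "v \<in> X" for X v
      using that subgroup.mem_carrier by (auto simp: objs_def)
    have B: "B X Y \<chi> \<in> fhom F (\<beta> ` X) (\<beta> ` Y) \<and> (\<forall>v\<in>X. \<chi> v \<in> Y)"
      if X: "X \<in> objs G" and Y: "Y \<in> objs G" and \<chi>: "\<chi> \<in> fhom G X Y" for X Y \<chi>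
    proof -
      note X' = objs_\<beta>[OF X] and Y' = objs_\<beta>[OF Y]
      obtain \<phi> where \<phi>: "\<phi> \<in> fhom F (\<beta> ` X) (\<beta> ` Y)" "\<And>u. u \<in> \<beta> ` X \<Longrightarrow> \<chi> (\<alpha> u) = \<alpha> (\<phi> u)"
        using fhom[OF X'(1) Y'(1), of \<chi>, THEN iffD1] \<chi> unfolding X'(2) Y'(2) by metis
      have "B X Y \<chi> = \<phi>"
      proof (rule extensionalityI[of _ "\<beta> ` X"])
        show "B X Y \<chi> \<in> extensional (\<beta> ` X)" by (simp add: B_def)
        show "\<phi> \<in> extensional (\<beta> ` X)" using fhom_extensional[OF X'(1) Y'(1) \<phi>(1)] .
        show "B X Y \<chi> u = \<phi> u" if "u \<in> \<beta> ` X" for u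
          using that \<phi>(2)[OF that] \<beta>\<alpha>[OF fhom_memS[OF X'(1) Y'(1) \<phi>(1) that]] by (simp add: B_def)
      qed
      moreover have "\<chi> v \<in> Y" if v: "v \<in> X" for v
      proof -
        have "\<chi> v = \<alpha> (\<phi> (\<beta> v))" using \<phi>(2)[of "\<beta> v"] v \<alpha>\<beta>[OF XT[OF X v]] by simp
        then show ?thesis using fhom_mem[OF X'(1) Y'(1) \<phi>(1), of "\<beta> v"] v Y'(2) by blast
      qed
      ultimately show ?thesis using \<phi>(1) by simp
    qed
    have Bv: "\<beta> (\<chi> v) = B X Y \<chi> (\<beta> v)" if "X \<in> objs G" "v \<in> X" for X Y v \<chi>
      using that \<alpha>\<beta>[OF XT[OF that]] by (simp add: B_def)
    have "induced_functor G F \<beta> B"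
      unfolding induced_functor_def
    proof (intro conjI ballI)
      fix X assume X: "X \<in> objs G"
      show "\<beta> ` X \<in> objs F" using objs_\<beta>[OF X] by simp
      show "B X X (\<lambda>u\<in>X. u) = (\<lambda>v\<in>\<beta> ` X. v)"
        using \<alpha>\<beta>[OF XT[OF X]] by (auto simp: B_def fun_eq_iff)
      fix Y \<phi> assume Y: "Y \<in> objs G" and \<phi>: "\<phi> \<in> fhom G X Y"
      show "B X Y \<phi> \<in> fhom F (\<beta> ` X) (\<beta> ` Y)" using B[OF X Y \<phi>] by blast
      show "\<beta> (\<phi> u) = B X Y \<phi> (\<beta> u)" if "u \<in> X" for u using Bv[OF X that] .
      fix Z \<psi> assume Z: "Z \<in> objs G" and \<psi>: "\<psi> \<in> fhom G Y Z"
      show "B X Z (compose X \<psi> \<phi>) = compose (\<beta> ` X) (B Y Z \<psi>) (B X Y \<phi>)"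
      proof (rule extensionalityI[of _ "\<beta> ` X"])
        fix u assume "u \<in> \<beta> ` X"
        then obtain v where v: "v \<in> X" "u = \<beta> v" ..
        have "compose (\<beta> ` X) (B Y Z \<psi>) (B X Y \<phi>) u = B Y Z \<psi> (\<beta> (\<phi> v))"
          using v Bv[OF X v(1)] by (simp add: compose_eq)
        also have "\<dots> = \<beta> (\<psi> (\<phi> v))" using Bv[OF Y] B[OF X Y \<phi>] v(1) by simp
        also have "\<dots> = B X Z (compose X \<psi> \<phi>) u"
          using v Bv[OF X v(1), of "compose X \<psi> \<phi>" Z] by (simp add: compose_eq)
        finally show "B X Z (compose X \<psi> \<phi>) u = compose (\<beta> ` X) (B Y Z \<psi>) (B X Y \<phi>) u" ..
      qed (simp_all add: B_def)
    qed
    then show ?thesis by blast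
  qed
  ultimately show ?thesis
    unfolding fusion_isomorphic_def fusion_morphism_def
    using hom hom_\<beta> cont_\<alpha> cont_\<beta> \<alpha>\<beta> \<beta>\<alpha> by blast
qed

section \<open>Comparison with the limit of the quotients\<close>

lemma (in inverse_system) lim_carrier_subgroup:
  "subgroup (lim_carrier I rel Fs f) (product_group I (\<lambda>i. fgrp (Fs i)))"
proof -
  interpret Pr: group "product_group I (\<lambda>i. fgrp (Fs i))" using group_Fs by (rule product_group)
  let ?L = "lim_carrier I rel Fs f"
  have hom: "group_hom (fgrp (Fs j)) (fgrp (Fs i)) (f i j)" if "i \<in> I" "j \<in> I" "rel i j" for i j
    using that group_Fs transition_hom by (simp add: group_hom_def group_hom_axioms_def)
  note L = lim_carrier_mem lim_carrier_compat
  show ?thesis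
  proof (rule Pr.subgroupI)
    show sub: "?L \<subseteq> carrier (product_group I (\<lambda>i. fgrp (Fs i)))" by (auto simp: lim_carrier_def)
    have "(\<lambda>i\<in>I. \<one>\<^bsub>fgrp (Fs i)\<^esub>) \<in> ?L"
      using group_hom.hom_one[OF hom] group.is_monoid[OF group_Fs]
      by (auto simp: lim_carrier_def intro: monoid.one_closed)
    then show "?L \<noteq> {}" by blast
    fix x assume x: "x \<in> ?L"
    have "(\<lambda>i\<in>I. inv\<^bsub>fgrp (Fs i)\<^esub> x i) \<in> ?L"
      using L[OF x] group_hom.hom_inv[OF hom] group.inv_closed[OF group_Fs]
      by (auto simp: lim_carrier_def)
    then show "inv\<^bsub>product_group I (\<lambda>i. fgrp (Fs i))\<^esub> x \<in> ?L"
      using inv_product_group[of x I "\<lambda>i. fgrp (Fs i)"] x sub group_Fs by auto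
    fix y assume y: "y \<in> ?L"
    show "x \<otimes>\<^bsub>product_group I (\<lambda>i. fgrp (Fs i))\<^esub> y \<in> ?L"
      using L[OF x] L[OF y] group_hom.hom_mult[OF hom] monoid.m_closed[OF group.is_monoid[OF group_Fs]]
      by (auto simp: lim_carrier_def)
  qed
qed

section \<open>Group and underlying space of an inverse limit\<close>

context inverse_system
begin

abbreviation L where "L \<equiv> inverse_limit I rel Fs f"

lemma carrier_lim: "carrier (fgrp L) = lim_carrier I rel Fs f"
  by (simp add: inverse_limit_def)

lemma group_lim: "group (fgrp L)"
  using group.subgroup_imp_group[OF product_group[of I "\<lambda>i. fgrp (Fs i)"] lim_carrier_subgroup] group_Fs
  by (simp add: inverse_limit_def)

lemma mult_lim: "i \<in> I \<Longrightarrow> (x \<otimes>\<^bsub>fgrp L\<^esub> y) i = x i \<otimes>\<^bsub>fgrp (Fs i)\<^esub> y i"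
  by (simp add: inverse_limit_def)

lemma topspace_lim: "topspace (ftop L) = carrier (fgrp L)"
proof -
  have "lim_carrier I rel Fs f \<subseteq> topspace (product_topology (\<lambda>i. ftop (Fs i)) I)"
    using topspace_Fs by (auto simp: lim_carrier_def PiE_iff extensional_def)
  then show ?thesis by (simp add: inverse_limit_def Int_absorb1)
qed

lemma lim_eqI:
  "\<lbrakk>x \<in> lim_carrier I rel Fs f; y \<in> lim_carrier I rel Fs f; \<And>i. i \<in> I \<Longrightarrow> x i = y i\<rbrakk> \<Longrightarrow> x = y"
  by (rule PiE_ext[of x I "\<lambda>i. carrier (fgrp (Fs i))" y]) (auto simp: lim_carrier_def)

end

text \<open>The two functors of the isomorphism enter through their equations only: \<open>A\<close>
  turns a morphism of \<open>F\<close> into a family of morphisms, and \<open>B\<close> turns a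
  family back into a morphism of \<open>F\<close>.\<close>

lemma isomorphic_pro_fusion:
  assumes F: "fusion_category F" and inv: "inverse_system p I rel Fs f"
    and iso: "F \<cong>\<^sub>f inverse_limit I rel Fs f"
  shows "\<exists>g. pro_fusion F p I rel Fs f g"
proof -
  interpret fusion_category F by (rule F)
  interpret inverse_system p I rel Fs f by (rule inv)
  let ?lim = "lim_carrier I rel Fs f"
  obtain \<alpha> \<beta> A B where hom: "\<alpha> \<in> hom (fgrp F) (fgrp L)" and hom_\<beta>: "\<beta> \<in> hom (fgrp L) (fgrp F)"
    and cont: "continuous_map (ftop F) (ftop L) \<alpha>" and cont_\<beta>: "continuous_map (ftop L) (ftop F) \<beta>"
    and A: "induced_functor F L \<alpha> A" and B: "induced_functor L F \<beta> B"
    and \<beta>\<alpha>: "\<And>x. x \<in> S \<Longrightarrow> \<beta> (\<alpha> x) = x" and \<alpha>\<beta>: "\<And>y. y \<in> carrier (fgrp L) \<Longrightarrow> \<alpha> (\<beta> y) = y"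
    using iso unfolding fusion_isomorphic_def fusion_morphism_def by metis
  define g where "g i x = \<alpha> x i" for i x
  have \<alpha>L: "\<alpha> x \<in> ?lim" if "x \<in> S" for x
    using hom_in_carrier[OF hom that] by (simp add: carrier_lim)
  have \<beta>S: "\<beta> y \<in> S" if "y \<in> ?lim" for y
    using hom_in_carrier[OF hom_\<beta>, of y] that by (simp add: carrier_lim)
  have g_\<beta>: "g i (\<beta> y) = y i" if "y \<in> ?lim" for i y
    using \<alpha>\<beta>[of y] that by (simp add: g_def carrier_lim)
  have g_compat: "f i j (g j x) = g i x" if "i \<in> I" "j \<in> I" "rel i j" "x \<in> S" for i j x
    using lim_carrier_compat[OF \<alpha>L[OF that(4)] that(1-3)] by (simp add: g_def)
  have g_eqI: "x = y" if "x \<in> S" "y \<in> S" "\<And>i. i \<in> I \<Longrightarrow> g i x = g i y" for x y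
    using lim_eqI[OF \<alpha>L[OF that(1)] \<alpha>L[OF that(2)]] \<beta>\<alpha> that by (metis g_def)
  have "pro_fusion F p I rel Fs f g"
  proof
    fix i assume i: "i \<in> I"
    show "g i \<in> hom (fgrp F) (fgrp (Fs i))"
    proof (rule homI)
      show "g i x \<in> carrier (fgrp (Fs i))" if "x \<in> S" for x
        using lim_carrier_mem[OF \<alpha>L[OF that] i] by (simp add: g_def)
      show "g i (x \<cdot> y) = g i x \<otimes>\<^bsub>fgrp (Fs i)\<^esub> g i y" if "x \<in> S" "y \<in> S" for x y
        using hom_mult[OF hom that] mult_lim[OF i] by (simp add: g_def)
    qed
  next
    show "f i j (g j x) = g i x" if "i \<in> I" "j \<in> I" "rel i j" "x \<in> S" for i j x
      using g_compat that .
    show "x = y" if "x \<in> S" "y \<in> S" "\<And>i. i \<in> I \<Longrightarrow> g i x = g i y" for x y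
      using g_eqI that .
  next
    fix U
    show "openin (ftop F) U \<longleftrightarrow> U \<subseteq> S \<and> (\<forall>y\<in>U. \<exists>i\<in>I. \<forall>x\<in>S. g i x = g i y \<longrightarrow> x \<in> U)" (is "?l \<longleftrightarrow> ?r")
    proof
      assume U: ?l
      have US: "U \<subseteq> S" using openin_subset[OF U] topspace_eq by simp
      have "openin (ftop L) {y \<in> topspace (ftop L). \<beta> y \<in> U}"
        using openin_continuous_map_preimage[OF cont_\<beta> U] .
      then have V: "openin (ftop L) {y \<in> ?lim. \<beta> y \<in> U}" by (simp add: topspace_lim carrier_lim)
      have "\<exists>i\<in>I. \<forall>x\<in>S. g i x = g i y \<longrightarrow> x \<in> U" if y: "y \<in> U" for y
      proof -
        have "\<alpha> y \<in> {y \<in> ?lim. \<beta> y \<in> U}" using y US \<alpha>L \<beta>\<alpha> by auto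
        then obtain i where "i \<in> I" "\<And>x. x \<in> ?lim \<Longrightarrow> x i = \<alpha> y i \<Longrightarrow> \<beta> x \<in> U"
          using V unfolding openin_inverse_limit by blast
        then show ?thesis using \<alpha>L \<beta>\<alpha> unfolding g_def by metis
      qed
      with US show ?r by blast
    next
      assume U: ?r
      have "openin (ftop L) {y \<in> ?lim. \<beta> y \<in> U}"
        unfolding openin_inverse_limit
      proof (intro conjI ballI)
        fix y assume "y \<in> {y \<in> ?lim. \<beta> y \<in> U}"
        then have y: "y \<in> ?lim" "\<beta> y \<in> U" by auto
        obtain i where "i \<in> I" "\<And>x. x \<in> S \<Longrightarrow> g i x = g i (\<beta> y) \<Longrightarrow> x \<in> U" using U y(2) by blast
        then show "\<exists>i\<in>I. \<forall>x\<in>?lim. x i = y i \<longrightarrow> x \<in> {y \<in> ?lim. \<beta> y \<in> U}"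
          using g_\<beta> \<beta>S y(1) by (intro bexI[of _ i]) auto
      qed auto
      then have "openin (ftop F) {x \<in> topspace (ftop F). \<alpha> x \<in> {y \<in> ?lim. \<beta> y \<in> U}}"
        by (rule openin_continuous_map_preimage[OF cont])
      also have "{x \<in> topspace (ftop F). \<alpha> x \<in> {y \<in> ?lim. \<beta> y \<in> U}} = U"
        using U \<alpha>L \<beta>\<alpha> topspace_eq by auto
      finally show ?l .
    qed
  next
    fix z assume z: "\<And>i. i \<in> I \<Longrightarrow> z i \<in> carrier (fgrp (Fs i))"
      "\<And>i j. \<lbrakk>i \<in> I; j \<in> I; rel i j\<rbrakk> \<Longrightarrow> f i j (z j) = z i"
    then have "restrict z I \<in> ?lim" by (auto simp: lim_carrier_def)
    then show "\<exists>y\<in>S. \<forall>i\<in>I. g i y = z i"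
      using \<beta>S g_\<beta> by (intro bexI[of _ "\<beta> (restrict z I)"]) auto
  next
    fix P Q \<phi> assume P: "P \<in> objs F" and Q: "Q \<in> objs F"
    have \<alpha>P: "\<alpha> ` P \<in> objs L" and \<alpha>Q: "\<alpha> ` Q \<in> objs L"
      using A P Q by (auto simp: induced_functor_def)
    have \<beta>P: "\<beta> ` \<alpha> ` P = P" "\<beta> ` \<alpha> ` Q = Q"
      using \<beta>\<alpha> objs_mem[OF P] objs_mem[OF Q] by (force simp: image_iff)+
    have im: "(\<lambda>x. x i) ` \<alpha> ` P = g i ` P" for i P by (auto simp: g_def)
    show "\<phi> \<in> fhom F P Q \<longleftrightarrow> \<phi> \<in> extensional P \<and> \<phi> ` P \<subseteq> Q \<and>
      (\<forall>i\<in>I. \<exists>\<chi>\<in>fhom (Fs i) (g i ` P) (g i ` Q). \<forall>u\<in>P. g i (\<phi> u) = \<chi> (g i u))" (is "?l \<longleftrightarrow> ?r")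
    proof
      assume \<phi>: ?l
      have "A P Q \<phi> \<in> fhom L (\<alpha> ` P) (\<alpha> ` Q)" and \<alpha>\<phi>: "\<And>u. u \<in> P \<Longrightarrow> \<alpha> (\<phi> u) = A P Q \<phi> (\<alpha> u)"
        using A P Q \<phi> by (auto simp: induced_functor_def)
      then obtain c where c: "c \<in> lim_families I rel Fs f (\<alpha> ` P) (\<alpha> ` Q)"
        "A P Q \<phi> = (\<lambda>x\<in>\<alpha> ` P. \<lambda>i\<in>I. c i (x i))"
        by (auto simp: inverse_limit_def)
      have "\<exists>\<chi>\<in>fhom (Fs i) (g i ` P) (g i ` Q). \<forall>u\<in>P. g i (\<phi> u) = \<chi> (g i u)" if i: "i \<in> I" for i
      proof (intro bexI ballI)
        show "c i \<in> fhom (Fs i) (g i ` P) (g i ` Q)"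
          using c(1) i by (auto simp: lim_families_def im)
        show "g i (\<phi> u) = c i (g i u)" if "u \<in> P" for u
          using \<alpha>\<phi>[OF that] c(2) that i by (simp add: g_def)
      qed
      then show ?r using fhom_extensional[OF P Q \<phi>] fhom_mem[OF P Q \<phi>] by blast
    next
      assume r: ?r
      then have "\<exists>c. \<forall>i\<in>I. c i \<in> fhom (Fs i) (g i ` P) (g i ` Q) \<and> (\<forall>u\<in>P. g i (\<phi> u) = c i (g i u))"
        by (intro bchoice) blast
      then obtain c where c: "\<And>i. i \<in> I \<Longrightarrow> c i \<in> fhom (Fs i) (g i ` P) (g i ` Q)"
        "\<And>i u. i \<in> I \<Longrightarrow> u \<in> P \<Longrightarrow> g i (\<phi> u) = c i (g i u)" by blast
      have \<phi>S: "\<phi> u \<in> S" if "u \<in> P" for u using r that objs_mem[OF Q] by blast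
      \<comment> \<open>The \<open>c i\<close> are chosen separately, but all are induced by the
        same \<open>\<phi>\<close>, and this makes them a compatible family.\<close>
      have compat: "f i j (c j (g j u)) = c i (f i j (g j u))" if ij: "i \<in> I" "j \<in> I" "rel i j" and u: "u \<in> P" for i j u
        using c(2)[OF ij(1) u] g_compat[OF ij \<phi>S[OF u]] g_compat[OF ij objs_mem[OF P u]]
        by (simp flip: c(2)[OF ij(2) u])
      have "restrict c I \<in> lim_families I rel Fs f (\<alpha> ` P) (\<alpha> ` Q)"
        unfolding lim_families_def im using c(1) compat by auto
      then have \<chi>: "(\<lambda>x\<in>\<alpha> ` P. \<lambda>i\<in>I. restrict c I i (x i)) \<in> fhom L (\<alpha> ` P) (\<alpha> ` Q)" (is "?\<chi> \<in> _")
        unfolding inverse_limit_def fusion_data.simps by (rule imageI)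
      have Bh: "B (\<alpha> ` P) (\<alpha> ` Q) ?\<chi> \<in> fhom F (\<beta> ` \<alpha> ` P) (\<beta> ` \<alpha> ` Q)"
        and B\<chi>: "\<And>v. v \<in> \<alpha> ` P \<Longrightarrow> \<beta> (?\<chi> v) = B (\<alpha> ` P) (\<alpha> ` Q) ?\<chi> (\<beta> v)"
        using B \<alpha>P \<alpha>Q \<chi> unfolding induced_functor_def by blast+
      have "B (\<alpha> ` P) (\<alpha> ` Q) ?\<chi> u = \<phi> u" if u: "u \<in> P" for u
      proof -
        have "?\<chi> (\<alpha> u) = \<alpha> (\<phi> u)"
        proof -
          have "?\<chi> (\<alpha> u) = (\<lambda>i\<in>I. g i (\<phi> u))" using u c(2) by (auto simp: g_def)
          also have "\<dots> = \<alpha> (\<phi> u)"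
            using \<alpha>L[OF \<phi>S[OF u]] by (auto simp: g_def lim_carrier_def PiE_def extensional_def)
          finally show ?thesis .
        qed
        then show ?thesis
          using B\<chi>[of "\<alpha> u"] u \<beta>\<alpha>[OF objs_mem[OF P u]] \<beta>\<alpha>[OF \<phi>S[OF u]] by simp
      qed
      then have "B (\<alpha> ` P) (\<alpha> ` Q) ?\<chi> = \<phi>"
        using r fhom_extensional[OF P Q] Bh unfolding \<beta>P by (intro extensionalityI[of _ P]) blast+
      then show ?l using Bh unfolding \<beta>P by simp
    qed
  qed
  then show ?thesis by blast
qed

locale pro_saturated_fusion = pro_fusion +
  assumes prime: "prime p" and saturated: "i \<in> I \<Longrightarrow> saturated p (Fs i)"
begin

abbreviation OSC where "OSC \<equiv> open_strongly_closed F"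

lemma OSC_D: "N \<in> OSC \<Longrightarrow> strongly_closed F N" "N \<in> OSC \<Longrightarrow> openin (ftop F) N"
  by (simp_all add: open_strongly_closed_def)

lemma OSC_contains_kernel:
  assumes "N \<in> OSC"
  obtains i where "i \<in> I" "\<And>x y. \<lbrakk>x \<in> S; y \<in> S; g i x = g i y\<rbrakk> \<Longrightarrow> x \<cdot> inv_S y \<in> N"
  using open_contains_kernel[OF OSC_D(2)[OF assms] objs_subgroup[OF strongly_closed_objs[OF OSC_D(1)[OF assms]]]]
  by blast

text \<open>\<open>N\<close> contains the kernel of some \<open>g i\<close>, so taking images under
  \<open>g i\<close> matches the cosets of \<open>N\<close> in \<open>S\<close> with the cosets of
  the image of \<open>N\<close> in the image of \<open>S\<close>, which is a finite
  \<open>p\<close>-group. Subgroups above \<open>N\<close> contain the same kernel and are therefore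
  closed.\<close>

lemma quotient_fusion_open:
  assumes "N \<in> OSC"
  shows "quotient_fusion F N p"
proof -
  interpret strongly_closed_fusion F N using strongly_closed_fusion_open[OF assms] .
  obtain i where i: "i \<in> I" and ker: "\<And>x y. \<lbrakk>x \<in> S; y \<in> S; g i x = g i y\<rbrakk> \<Longrightarrow> x \<cdot> inv_S y \<in> N"
    by (rule OSC_contains_kernel[OF assms]) blast
  show ?thesis
  proof
    interpret Fi: fusion_system p "Fs i" using fusion_systems[OF i] .
    let ?H = "(fgrp (Fs i))\<lparr>carrier := g i ` S\<rparr>" and ?K = "g i ` N"
    have HS: "subgroup (g i ` S) (fgrp (Fs i))" using Fi.objs_subgroup[OF g_objs[OF i carrier_objs]] .
    have KS: "subgroup ?K (fgrp (Fs i))" using Fi.objs_subgroup[OF g_objs[OF i N_objs]] .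
    have KH: "subgroup ?K ?H" using Fi.subgroup_incl[OF KS HS] objs_subset[OF N_objs] by blast
    interpret H: group ?H using Fi.subgroup_imp_group[OF HS] .
    have img: "g i ` coset_N x = ?K #>\<^bsub>?H\<^esub> g i x" if "x \<in> S" for x
    proof -
      have "g i ` coset_N x = (\<lambda>n. g i (n \<cdot> x)) ` N" unfolding r_coset_def by blast
      also have "\<dots> = (\<lambda>n. g i n \<otimes>\<^bsub>fgrp (Fs i)\<^esub> g i x) ` N"
        by (rule image_cong[OF refl]) (rule g_mult[OF i N_mem \<open>x \<in> S\<close>])
      also have "\<dots> = ?K #>\<^bsub>?H\<^esub> g i x" by (auto simp: r_coset_def)
      finally show ?thesis .
    qed
    have "bij_betw (\<lambda>C. g i ` C) (carrier (fgrp F Mod N)) (rcosets\<^bsub>?H\<^esub> ?K)"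
    proof (rule bij_betwI')
      fix C D assume "C \<in> carrier (fgrp F Mod N)" "D \<in> carrier (fgrp F Mod N)"
      then obtain x y where xy: "x \<in> S" "C = coset_N x" "y \<in> S" "D = coset_N y"
        by (auto simp: carrier_FactGroup)
      show "g i ` C = g i ` D \<longleftrightarrow> C = D"
      proof
        assume eq: "g i ` C = g i ` D"
        have "x \<in> C" using xy rcos_self subgroup_axioms by simp
        then have "g i x \<in> g i ` D" using eq by blast
        then obtain n where n: "n \<in> N" "g i x = g i (n \<cdot> y)" using xy by (auto simp: r_coset_def)
        have nyS: "n \<cdot> y \<in> S" using N_mem[OF n(1)] xy by simp
        have "coset_N x = coset_N (n \<cdot> y)" using ker[OF xy(1) nyS n(2)] coset_eq_iff[OF xy(1) nyS] by simp
        then show "C = D" using xy coset_mult_N[OF n(1) xy(3)] by simp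
      qed simp
    next
      fix C assume "C \<in> carrier (fgrp F Mod N)"
      then show "g i ` C \<in> rcosets\<^bsub>?H\<^esub> ?K" using img by (auto simp: carrier_FactGroup RCOSETS_def)
    next
      fix X assume "X \<in> rcosets\<^bsub>?H\<^esub> ?K"
      then obtain x where "x \<in> S" "X = ?K #>\<^bsub>?H\<^esub> g i x" by (auto simp: RCOSETS_def)
      then show "\<exists>C\<in>carrier (fgrp F Mod N). X = g i ` C"
        using img by (auto simp: carrier_FactGroup)
    qed
    then have card: "card (carrier (fgrp F Mod N)) = card (rcosets\<^bsub>?H\<^esub> ?K)"
      and fin: "finite (carrier (fgrp F Mod N)) \<longleftrightarrow> finite (rcosets\<^bsub>?H\<^esub> ?K)"
      by (simp_all add: bij_betw_same_card bij_betw_finite)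
    obtain k where k: "card (g i ` S) = p ^ k" using Fi.card_objs[OF prime g_objs[OF i carrier_objs]] .
    have "card (rcosets\<^bsub>?H\<^esub> ?K) * card ?K = p ^ k" using H.lagrange[OF KH] k by (simp add: order_def)
    then obtain l where l: "card (rcosets\<^bsub>?H\<^esub> ?K) = p ^ l"
      using divides_primepow_nat[OF prime] by (metis dvd_triv_left)
    have "finite (rcosets\<^bsub>?H\<^esub> ?K)"
      by (rule card_ge_0_finite) (simp add: l prime_gt_0_nat[OF prime])
    then show "finite_p_group p (fgrp F Mod N)"
      using factorgroup_is_group fin card l by (auto simp: finite_p_group_def order_def)
  next
    fix H assume H: "subgroup H (fgrp F)" and NH: "N \<subseteq> H"
    show "H \<in> objs F"
    proof (rule objsI[OF H])
      fix y assume y: "y \<in> S" "y \<notin> H"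
      have "x \<notin> H" if x: "x \<in> S" "g i x = g i y" for x
      proof
        assume xH: "x \<in> H"
        have "y \<cdot> inv_S x \<in> H" using subsetD[OF NH ker[OF y(1) x(1) x(2)[symmetric]]] .
        then have "y \<cdot> inv_S x \<cdot> x \<in> H" using subgroup.m_closed[OF H _ xH] by blast
        moreover have "y \<cdot> inv_S x \<cdot> x = y" using x(1) y(1) by (simp add: m_assoc)
        ultimately show False using y(2) by simp
      qed
      then show "\<exists>i\<in>I. \<forall>x\<in>S. g i x = g i y \<longrightarrow> x \<notin> H" using i by blast
    qed
  qed
qed

lemma fhom_lifts:
  assumes N: "N \<in> OSC" and P: "P \<in> objs F" and R: "R \<in> objs F" and \<phi>: "\<phi> \<in> fhom F P R"
  shows "strongly_closed_fusion.lifts F N P \<phi>"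
proof -
  interpret N: strongly_closed_fusion F N using strongly_closed_fusion_open[OF N] .
  have "\<phi> \<in> fhom F P S" using fhom_codomain[OF P R carrier_objs \<phi>] fhom_memS[OF P R \<phi>] by blast
  then show ?thesis
    using pro_saturated_lifts[OF prime saturated N P] by (simp add: N.lifts_def)
qed

text \<open>Makes the index set of the quotients directed.\<close>

lemma OSC_Int:
  assumes "N \<in> OSC" "M \<in> OSC" shows "N \<inter> M \<in> OSC"
proof -
  note h = OSC_D(1)[OF assms(1)] OSC_D(1)[OF assms(2)]
  have "\<phi> ` R \<subseteq> N \<inter> M" if R: "R \<in> objs F" and \<phi>: "\<phi> \<in> fhom F R S" and sub: "R \<subseteq> N \<inter> M" for R \<phi>
  proof
    fix v assume "v \<in> \<phi> ` R"
    then obtain u where u: "u \<in> R" "v = \<phi> u" ..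
    have "u \<in> N" "u \<in> M" using u(1) sub by auto
    then show "v \<in> N \<inter> M"
      using strongly_closed_mem[OF h(1) R carrier_objs \<phi> u(1)]
        strongly_closed_mem[OF h(2) R carrier_objs \<phi> u(1)] u(2) by simp
  qed
  moreover have "N \<inter> M \<in> objs F" using objs_Int[OF strongly_closed_objs[OF h(1)] strongly_closed_objs[OF h(2)]] .
  moreover have "openin (ftop F) (N \<inter> M)" using openin_Int[OF OSC_D(2)[OF assms(1)] OSC_D(2)[OF assms(2)]] .
  ultimately show ?thesis by (simp add: open_strongly_closed_def strongly_closed_def)
qed

lemma S_OSC: "S \<in> OSC"
proof -
  have "\<phi> ` R \<subseteq> S" if "R \<in> objs F" "\<phi> \<in> fhom F R S" for R \<phi>
    using fhom_mem[OF that(1) carrier_objs that(2)] by blast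
  moreover have "openin (ftop F) S" using openin_topspace[of "ftop F"] topspace_eq by simp
  ultimately show ?thesis
    using carrier_objs by (simp add: open_strongly_closed_def strongly_closed_def)
qed

definition kernel_g where "kernel_g i = {x \<in> S. g i x = \<one>\<^bsub>fgrp (Fs i)\<^esub>}"

lemma kernel_g_coset:
  assumes i: "i \<in> I" and x: "x \<in> S" and y: "y \<in> S"
  shows "x \<cdot> inv_S y \<in> kernel_g i \<longleftrightarrow> g i x = g i y"
  using g_eq_iff[OF i x y] x y by (simp add: kernel_g_def)

text \<open>At level \<open>i\<close> a morphism of \<open>F\<close> is accompanied by a
  homomorphism, which preserves the identity. Every member of \<open>OSC\<close> contains one of
  these kernels, so elements, open sets and morphisms can be compared at the kernels.\<close>

lemma kernel_g_OSC:
  assumes i: "i \<in> I" shows "kernel_g i \<in> OSC"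
proof -
  interpret Fi: fusion_system p "Fs i" using fusion_systems[OF i] .
  have sub: "subgroup (kernel_g i) (fgrp F)"
    using group_hom.subgroup_kernel[OF g_group_hom[OF i]] by (simp add: kernel_g_def kernel_def)
  have obj: "kernel_g i \<in> objs F"
    by (rule objsI[OF sub]) (intro bexI[OF _ i], auto simp: kernel_g_def)
  have "openin (ftop F) (kernel_g i)"
    unfolding open_iff by (intro conjI ballI bexI[OF _ i]) (auto simp: kernel_g_def)
  moreover have "\<phi> ` R \<subseteq> kernel_g i"
    if R: "R \<in> objs F" and \<phi>: "\<phi> \<in> fhom F R S" and RK: "R \<subseteq> kernel_g i" for R \<phi>
  proof -
    obtain \<chi> where \<chi>: "\<chi> \<in> fhom (Fs i) (g i ` R) (g i ` S)" "\<And>u. u \<in> R \<Longrightarrow> g i (\<phi> u) = \<chi> (g i u)"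
      by (rule fhom_at[OF R carrier_objs \<phi> i]) blast
    have "g i (\<phi> u) = \<one>\<^bsub>fgrp (Fs i)\<^esub>" if "u \<in> R" for u
      using \<chi>(2)[OF that] that RK Fi.fhom_one[OF g_objs[OF i R] g_objs[OF i carrier_objs] \<chi>(1)]
      by (auto simp: kernel_g_def)
    then show ?thesis using fhom_memS[OF R carrier_objs \<phi>] by (auto simp: kernel_g_def)
  qed
  ultimately show ?thesis using obj by (simp add: open_strongly_closed_def strongly_closed_def)
qed

lemma quotient_map_coset:
  assumes N: "N \<in> OSC" and M: "M \<in> OSC" and "M \<subseteq> N" and x: "x \<in> S"
  shows "fusion_quotient_map F N M (M #>\<^bsub>fgrp F\<^esub> x) = N #>\<^bsub>fgrp F\<^esub> x"
proof -
  interpret N: strongly_closed_fusion F N using strongly_closed_fusion_open[OF N] .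
  interpret M: strongly_closed_fusion F M using strongly_closed_fusion_open[OF M] .
  have "N <#>\<^bsub>fgrp F\<^esub> M = N"
  proof (intro equalityI subsetI)
    fix u assume "u \<in> N <#>\<^bsub>fgrp F\<^esub> M"
    then obtain n m where nm: "n \<in> N" "m \<in> M" "u = n \<cdot> m" unfolding N.prod_N_mem by blast
    have "m \<in> N" using nm(2) \<open>M \<subseteq> N\<close> ..
    then show "u \<in> N" unfolding nm(3) by (rule N.m_closed[OF nm(1)])
  qed (use N.N_subset_prod_N[OF M.N_objs] in blast)
  then show ?thesis
    using setmult_rcos_assoc[OF N.subset M.subset x] by (simp add: fusion_quotient_map_def)
qed

lemma quotient_system:
  "inverse_system p OSC (\<lambda>N M. M \<subseteq> N) (fusion_quotient F) (fusion_quotient_map F)"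
proof (rule inverse_system.intro)
  show "OSC \<noteq> {}" using S_OSC by blast
  show "\<exists>K\<in>OSC. K \<subseteq> N \<and> K \<subseteq> M" if "N \<in> OSC" "M \<in> OSC" for N M
    using OSC_Int[OF that] by blast
  show "fusion_system p (fusion_quotient F N)" if N: "N \<in> OSC" for N
    using quotient_fusion.fusion_system_FN[OF quotient_fusion_open[OF N]] .
  show "fusion_quotient_map F N N x = x" if N: "N \<in> OSC" and x: "x \<in> carrier (fgrp (fusion_quotient F N))" for N x
  proof -
    interpret N: quotient_fusion F N p using quotient_fusion_open[OF N] .
    show ?thesis using x quotient_map_coset[OF N N subset_refl] by (auto simp: N.carrier_FN)
  qed
  show "fusion_quotient_map F N M (fusion_quotient_map F M K x) = fusion_quotient_map F N K x"
    if N: "N \<in> OSC" and M: "M \<in> OSC" and K: "K \<in> OSC" and sub: "M \<subseteq> N" "K \<subseteq> M"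
      and x: "x \<in> carrier (fgrp (fusion_quotient F K))" for N M K x
  proof -
    interpret K: quotient_fusion F K p using quotient_fusion_open[OF K] .
    show ?thesis
      using x quotient_map_coset[OF M K sub(2)] quotient_map_coset[OF N M sub(1)]
        quotient_map_coset[OF N K subset_trans[OF sub(2,1)]] by (auto simp: K.carrier_FN)
  qed
  show "fusion_morphism (fusion_quotient F M) (fusion_quotient F N) (fusion_quotient_map F N M)"
    if N: "N \<in> OSC" and M: "M \<in> OSC" and sub: "M \<subseteq> N" for N M
  proof -
    interpret N: quotient_fusion F N p using quotient_fusion_open[OF N] .
    interpret M: quotient_fusion F M p using quotient_fusion_open[OF M] .
    interpret FN: fusion_system p "fusion_quotient F N" using N.fusion_system_FN .
    interpret FM: fusion_system p "fusion_quotient F M" using M.fusion_system_FN .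
    let ?f = "fusion_quotient_map F N M"
    note f = quotient_map_coset[OF N M sub]
    have f_objs: "?f ` X = N.coset_N ` \<Union>X" if X: "X \<in> objs (fusion_quotient F M)" for X
    proof -
      note X' = M.objs_FN_union[OF X]
      have "?f ` X = ?f ` M.coset_N ` \<Union>X" using X'(3) by simp
      also have "\<dots> = N.coset_N ` \<Union>X"
        unfolding image_image by (rule image_cong[OF refl]) (rule f[OF objs_mem[OF X'(1)]])
      finally show ?thesis .
    qed
    have hom: "?f \<in> hom (fgrp (fusion_quotient F M)) (fgrp (fusion_quotient F N))"
    proof (rule homI)
      fix x assume "x \<in> carrier (fgrp (fusion_quotient F M))"
      then show "?f x \<in> carrier (fgrp (fusion_quotient F N))"
        using f by (auto simp: M.carrier_FN N.carrier_FN)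
      fix y assume "y \<in> carrier (fgrp (fusion_quotient F M))"
      with \<open>x \<in> _\<close> obtain a b where ab: "a \<in> S" "x = M.coset_N a" "b \<in> S" "y = M.coset_N b"
        by (auto simp: M.carrier_FN)
      show "?f (x \<otimes>\<^bsub>fgrp (fusion_quotient F M)\<^esub> y) = ?f x \<otimes>\<^bsub>fgrp (fusion_quotient F N)\<^esub> ?f y"
        using ab f M.coset_mult[OF ab(1,3)] N.coset_mult[OF ab(1,3)] f[OF m_closed[OF ab(1,3)]]
        by (simp add: M.fgrp_FN N.fgrp_FN)
    qed
    then have "continuous_map (ftop (fusion_quotient F M)) (ftop (fusion_quotient F N)) ?f"
      using hom_in_carrier[OF hom] by (auto simp: M.ftop_FN N.ftop_FN)
    moreover have "\<exists>A. induced_functor (fusion_quotient F M) (fusion_quotient F N) ?f A"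
    proof (rule induced_functor_exI[OF FM.fusion_category_axioms])
      show "?f ` X \<in> objs (fusion_quotient F N)" if X: "X \<in> objs (fusion_quotient F M)" for X
        unfolding f_objs[OF X] using N.coset_image_objs[OF M.objs_FN_union(1)[OF X]] .
      show "\<chi> \<in> extensional X" if "X \<in> objs (fusion_quotient F N)" "Y \<in> objs (fusion_quotient F N)"
        "\<chi> \<in> fhom (fusion_quotient F N) X Y" for X Y \<chi> using FN.fhom_extensional[OF that] .
      show "\<exists>\<chi>\<in>fhom (fusion_quotient F N) (?f ` X) (?f ` Y). \<forall>u\<in>X. ?f (\<phi> u) = \<chi> (?f u)"
        if X: "X \<in> objs (fusion_quotient F M)" and Y: "Y \<in> objs (fusion_quotient F M)"
          and \<phi>: "\<phi> \<in> fhom (fusion_quotient F M) X Y" for X Y \<phi>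
      proof -
        note X' = M.objs_FN_union[OF X] and Y' = M.objs_FN_union[OF Y]
        obtain \<psi> where \<psi>: "\<psi> \<in> fhom F (\<Union>X) (\<Union>Y)" "\<And>u. u \<in> \<Union>X \<Longrightarrow> \<phi> (M.coset_N u) = M.coset_N (\<psi> u)"
          by (rule M.fhom_FN_lift[OF X Y \<phi>]) blast
        \<comment> \<open>A morphism of \<open>F/M\<close> lifts to preimages that contain
          \<open>M\<close> but perhaps not \<open>N\<close>. Passing on to \<open>F/N\<close> takes
          a second lift, modulo \<open>N\<close>, and this is where saturation is used.\<close>
        obtain \<chi> where \<chi>: "\<chi> \<in> fhom (fusion_quotient F N) (N.coset_N ` \<Union>X) (N.coset_N ` \<Union>Y)"
          "\<forall>u\<in>\<Union>X. N.coset_N (\<psi> u) = \<chi> (N.coset_N u)"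
          using N.quotient_lift[OF X'(1) Y'(1) \<psi>(1) fhom_lifts[OF N X'(1) Y'(1) \<psi>(1)]] ..
        have "?f (\<phi> C) = \<chi> (?f C)" if "C \<in> X" for C
        proof -
          have "C \<in> M.coset_N ` \<Union>X" using that X'(3) by simp
          then obtain u where u: "u \<in> \<Union>X" "C = M.coset_N u" ..
          show ?thesis
            using u \<psi>(2)[OF u(1)] f[OF fhom_memS[OF X'(1) Y'(1) \<psi>(1) u(1)]] f[OF objs_mem[OF X'(1) u(1)]]
              bspec[OF \<chi>(2) u(1)] by simp
        qed
        with \<chi>(1) show ?thesis unfolding f_objs[OF X] f_objs[OF Y] by blast
      qed
    qed
    ultimately show ?thesis using hom by (simp add: fusion_morphism_def)
  qed
qed blast+

text \<open>
  A compatible family of morphisms of the quotients glues to a homomorphism \<open>\<phi>\<close>; applied to the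
  kernels of the projections \<open>g i\<close>, it shows that \<open>\<phi>\<close> is a morphism of \<open>F\<close>.
\<close>

lemma fhom_of_quotients:
  assumes P: "P \<in> objs F" and Q: "Q \<in> objs F" and ext: "\<phi> \<in> extensional P"
    and \<phi>S: "\<And>u. u \<in> P \<Longrightarrow> \<phi> u \<in> S"
    and ex: "\<And>N. N \<in> OSC \<Longrightarrow>
      \<exists>\<chi>\<in>fhom (fusion_quotient F N) ((\<lambda>x. N #>\<^bsub>fgrp F\<^esub> x) ` P) ((\<lambda>x. N #>\<^bsub>fgrp F\<^esub> x) ` Q).
        \<forall>u\<in>P. N #>\<^bsub>fgrp F\<^esub> \<phi> u = \<chi> (N #>\<^bsub>fgrp F\<^esub> u)"
  shows "\<phi> \<in> fhom F P Q"
proof -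
  have key: "(\<forall>u\<in>P. g i (\<phi> u) \<in> g i ` Q) \<and> (\<exists>\<chi>\<in>fhom (Fs i) (g i ` P) (g i ` Q). \<forall>u\<in>P. g i (\<phi> u) = \<chi> (g i u))"
    if i: "i \<in> I" for i
  proof -
    interpret Fi: fusion_system p "Fs i" using fusion_systems[OF i] .
    interpret K: quotient_fusion F "kernel_g i" p using quotient_fusion_open[OF kernel_g_OSC[OF i]] .
    have K_eq: "K.coset_N x = K.coset_N y \<longleftrightarrow> g i x = g i y" if "x \<in> S" "y \<in> S" for x y
      using K.coset_eq_iff[OF that] kernel_g_coset[OF i that] by simp
    have KP: "K.coset_N ` P \<in> objs K.FN" and KQ: "K.coset_N ` Q \<in> objs K.FN"
      using K.coset_image_objs P Q by auto
    obtain \<chi> where \<chi>: "\<chi> \<in> fhom K.FN (K.coset_N ` P) (K.coset_N ` Q)"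
      "\<forall>u\<in>P. K.coset_N (\<phi> u) = \<chi> (K.coset_N u)"
      using ex[OF kernel_g_OSC[OF i]] ..
    obtain \<psi> where \<psi>: "\<psi> \<in> fhom F (\<Union>(K.coset_N ` P)) (\<Union>(K.coset_N ` Q))"
      "\<And>u. u \<in> \<Union>(K.coset_N ` P) \<Longrightarrow> \<chi> (K.coset_N u) = K.coset_N (\<psi> u)"
      by (rule K.fhom_FN_lift[OF KP KQ \<chi>(1)]) blast
    note \<psi>' = \<psi>[unfolded K.union_coset_image]
    note KPo = K.prod_objs[OF P] and KQo = K.prod_objs[OF Q]
    \<comment> \<open>Multiplying by the kernel does not change images under \<open>g i\<close>, so
      the component at \<open>i\<close> of a morphism on the enlarged subgroup has the required
      source and target.\<close>
    have g_prod: "g i ` K.prod_N R = g i ` R" if R: "R \<in> objs F" for R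
    proof (intro equalityI subsetI)
      fix w assume "w \<in> g i ` K.prod_N R"
      then obtain v where v: "w = g i v" "v \<in> K.prod_N R" ..
      obtain n u where nu: "n \<in> kernel_g i" "u \<in> R" "v = n \<cdot> u"
        using v(2) unfolding K.prod_N_mem by blast
      note uS = objs_mem[OF R nu(2)]
      have "g i (n \<cdot> u) = g i u"
        using K_eq[OF m_closed[OF K.N_mem[OF nu(1)] uS] uS] K.coset_mult_N[OF nu(1) uS] by simp
      then show "w \<in> g i ` R" using nu(2) unfolding v(1) nu(3) by simp
    qed (use K.subset_prod_N[OF R] in blast)
    have eq: "g i (\<phi> u) = g i (\<psi> u)" if u: "u \<in> P" for u
    proof -
      have uK: "u \<in> K.prod_N P" using K.subset_prod_N[OF P] u by blast
      have "K.coset_N (\<phi> u) = K.coset_N (\<psi> u)" using \<psi>'(2)[OF uK] bspec[OF \<chi>(2) u] by simp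
      then show ?thesis using K_eq[OF \<phi>S[OF u] fhom_memS[OF KPo KQo \<psi>'(1) uK]] by blast
    qed
    obtain \<theta> where \<theta>: "\<theta> \<in> fhom (Fs i) (g i ` K.prod_N P) (g i ` K.prod_N Q)"
      "\<And>u. u \<in> K.prod_N P \<Longrightarrow> g i (\<psi> u) = \<theta> (g i u)"
      by (rule fhom_at[OF KPo KQo \<psi>'(1) i]) blast
    have \<theta>': "\<theta> \<in> fhom (Fs i) (g i ` P) (g i ` Q)" using \<theta>(1) unfolding g_prod[OF P] g_prod[OF Q] .
    have \<theta>\<phi>: "g i (\<phi> u) = \<theta> (g i u)" if u: "u \<in> P" for u
    proof -
      have uK: "u \<in> K.prod_N P" using K.subset_prod_N[OF P] u by blast
      show ?thesis using eq[OF u] \<theta>(2)[OF uK] by simp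
    qed
    moreover have "g i (\<phi> u) \<in> g i ` Q" if u: "u \<in> P" for u
      using \<theta>\<phi>[OF u] Fi.fhom_mem[OF g_objs[OF i P] g_objs[OF i Q] \<theta>' imageI[OF u]] by simp
    ultimately show ?thesis using \<theta>' by blast
  qed
  \<comment> \<open>Only values in \<open>S\<close> are assumed. They lie in \<open>Q\<close>
    because they do so at every level and \<open>Q\<close> is closed.\<close>
  then have "\<phi> u \<in> Q" if "u \<in> P" for u using objs_memI[OF Q \<phi>S[OF that]] that by blast
  then show ?thesis using key ext fhom_iff[OF P Q] by blast
qed

theorem quotient_limit:
  "F \<cong>\<^sub>f inverse_limit OSC (\<lambda>N M. M \<subseteq> N) (fusion_quotient F) (fusion_quotient_map F)"
proof -
  interpret Q: inverse_system p OSC "\<lambda>N M. M \<subseteq> N" "fusion_quotient F" "fusion_quotient_map F"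
    by (rule quotient_system)
  let ?lim = "lim_carrier OSC (\<lambda>N M. M \<subseteq> N) (fusion_quotient F) (fusion_quotient_map F)"
  define \<alpha> where "\<alpha> x = (\<lambda>N\<in>OSC. N #>\<^bsub>fgrp F\<^esub> x)" for x
  have \<alpha>N: "\<alpha> x N = N #>\<^bsub>fgrp F\<^esub> x" if "N \<in> OSC" for x N using that by (simp add: \<alpha>_def)
  have coset_eq: "N #>\<^bsub>fgrp F\<^esub> x = N #>\<^bsub>fgrp F\<^esub> y \<longleftrightarrow> x \<cdot> inv_S y \<in> N"
    if "N \<in> OSC" "x \<in> S" "y \<in> S" for N x y
    using rcos_eq_iff[OF objs_subgroup[OF strongly_closed_objs[OF OSC_D(1)[OF that(1)]]] that(2,3)] .
  have kernel_eq: "\<alpha> x (kernel_g i) = \<alpha> y (kernel_g i) \<longleftrightarrow> g i x = g i y"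
    if "i \<in> I" "x \<in> S" "y \<in> S" for i x y
    using coset_eq[OF kernel_g_OSC[OF that(1)] that(2,3)] kernel_g_coset[OF that] \<alpha>N[OF kernel_g_OSC[OF that(1)]]
    by simp
  have carrier_Q: "carrier (fgrp (fusion_quotient F N)) = (\<lambda>x. N #>\<^bsub>fgrp F\<^esub> x) ` S" if "N \<in> OSC" for N
    using quotient_fusion.carrier_FN[OF quotient_fusion_open[OF that]] .
  have \<alpha>_lim: "\<alpha> x \<in> ?lim" if x: "x \<in> S" for x
    using carrier_Q quotient_map_coset x by (auto simp: \<alpha>_def lim_carrier_def)
  \<comment> \<open>A point of the limit is read off at the kernels: its representatives there have
    compatible images under the \<open>g i\<close> and so come from one \<open>x\<close>. Any other
    \<open>N\<close> contains such a kernel, which determines \<open>z N\<close>.\<close>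
  have surj: "\<exists>x\<in>S. z = \<alpha> x" if z: "z \<in> ?lim" for z
  proof -
    have zN: "z N \<in> (\<lambda>x. N #>\<^bsub>fgrp F\<^esub> x) ` S" if "N \<in> OSC" for N
      using Q.lim_carrier_mem[OF z that] carrier_Q[OF that] by simp
    have "\<exists>y. \<forall>i\<in>I. y i \<in> S \<and> z (kernel_g i) = kernel_g i #>\<^bsub>fgrp F\<^esub> y i"
      using zN[OF kernel_g_OSC] by (intro bchoice) blast
    then obtain y where y: "\<And>i. i \<in> I \<Longrightarrow> y i \<in> S" "\<And>i. i \<in> I \<Longrightarrow> z (kernel_g i) = kernel_g i #>\<^bsub>fgrp F\<^esub> y i"
      by blast
    have sub: "kernel_g j \<subseteq> kernel_g i" if ij: "i \<in> I" "j \<in> I" "rel i j" for i j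
    proof
      fix x assume "x \<in> kernel_g j"
      then have x: "x \<in> S" "g j x = g j \<e>" using g_one[OF ij(2)] by (auto simp: kernel_g_def)
      then have "g i x = g i \<e>" using g_compat[OF ij x(1)] g_compat[OF ij one_closed] by simp
      then show "x \<in> kernel_g i" using x(1) g_one[OF ij(1)] by (simp add: kernel_g_def)
    qed
    have "f i j (g j (y j)) = g i (y i)" if ij: "i \<in> I" "j \<in> I" "rel i j" for i j
    proof -
      have "z (kernel_g i) = kernel_g i #>\<^bsub>fgrp F\<^esub> y j"
        using Q.lim_carrier_compat[OF z kernel_g_OSC[OF ij(1)] kernel_g_OSC[OF ij(2)] sub[OF ij]] y(2)[OF ij(2)]
          quotient_map_coset[OF kernel_g_OSC[OF ij(1)] kernel_g_OSC[OF ij(2)] sub[OF ij] y(1)[OF ij(2)]] by simp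
      then have "g i (y j) = g i (y i)"
        using y(2)[OF ij(1)] kernel_eq[OF ij(1) y(1)[OF ij(2)] y(1)[OF ij(1)]] \<alpha>N[OF kernel_g_OSC[OF ij(1)]] by simp
      then show ?thesis using g_compat[OF ij y(1)[OF ij(2)]] by simp
    qed
    then obtain x where x: "x \<in> S" "\<And>i. i \<in> I \<Longrightarrow> g i x = g i (y i)"
      using g_lim[of "\<lambda>i. g i (y i)", OF g_closed[OF _ y(1)]] by blast
    have "z N = \<alpha> x N" if N: "N \<in> OSC" for N
    proof -
      obtain i where i: "i \<in> I" "\<And>x y. \<lbrakk>x \<in> S; y \<in> S; g i x = g i y\<rbrakk> \<Longrightarrow> x \<cdot> inv_S y \<in> N"
        by (rule OSC_contains_kernel[OF N]) blast
      have sub: "kernel_g i \<subseteq> N"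
      proof
        fix x assume "x \<in> kernel_g i"
        then have "x \<in> S" "g i x = g i \<e>" using g_one[OF i(1)] by (auto simp: kernel_g_def)
        then show "x \<in> N" using i(2)[of x \<e>] by simp
      qed
      note K = kernel_g_OSC[OF i(1)]
      have "z (kernel_g i) = kernel_g i #>\<^bsub>fgrp F\<^esub> x"
        using y(2)[OF i(1)] kernel_eq[OF i(1) x(1) y(1)[OF i(1)]] x(2)[OF i(1)] \<alpha>N[OF K] by simp
      then show ?thesis
        using Q.lim_carrier_compat[OF z N K sub] quotient_map_coset[OF N K sub x(1)] \<alpha>N[OF N] by simp
    qed
    then have "z = \<alpha> x" using Q.lim_eqI[OF z \<alpha>_lim[OF x(1)]] by blast
    with x(1) show ?thesis by blast
  qed
  have inj: "inj_on \<alpha> S"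
  proof (rule inj_onI)
    fix x y assume xy: "x \<in> S" "y \<in> S" "\<alpha> x = \<alpha> y"
    show "x = y"
    proof (rule g_eqI[OF xy(1,2)])
      show "g i x = g i y" if "i \<in> I" for i using kernel_eq[OF that xy(1,2)] xy(3) by simp
    qed
  qed
  show ?thesis
  proof (rule fusion_isomorphicI[where \<alpha> = \<alpha>, OF fusion_category_axioms Q.group_lim Q.topspace_lim])
    have "\<alpha> ` S = carrier (fgrp Q.L)" using \<alpha>_lim surj unfolding Q.carrier_lim by blast
    with inj show "bij_betw \<alpha> S (carrier (fgrp Q.L))" by (simp add: bij_betw_def)
    show "\<alpha> \<in> hom (fgrp F) (fgrp Q.L)"
    proof (rule homI)
      show "\<alpha> x \<in> carrier (fgrp Q.L)" if "x \<in> S" for x using \<alpha>_lim[OF that] by (simp add: Q.carrier_lim)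
      fix x y assume xy: "x \<in> S" "y \<in> S"
      show "\<alpha> (x \<cdot> y) = \<alpha> x \<otimes>\<^bsub>fgrp Q.L\<^esub> \<alpha> y"
      proof (rule Q.lim_eqI)
        show "\<alpha> (x \<cdot> y) \<in> ?lim" using \<alpha>_lim xy by simp
        show "\<alpha> x \<otimes>\<^bsub>fgrp Q.L\<^esub> \<alpha> y \<in> ?lim"
          using monoid.m_closed[OF group.is_monoid[OF Q.group_lim]] \<alpha>_lim xy by (simp add: Q.carrier_lim)
        fix N assume N: "N \<in> OSC"
        interpret N: quotient_fusion F N p using quotient_fusion_open[OF N] .
        show "\<alpha> (x \<cdot> y) N = (\<alpha> x \<otimes>\<^bsub>fgrp Q.L\<^esub> \<alpha> y) N"
          using Q.mult_lim[OF N] \<alpha>N[OF N] N.coset_mult[OF xy] by (simp add: N.fgrp_FN)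
      qed
    qed
  next
    fix U assume U: "U \<subseteq> S"
    \<comment> \<open>Openness is decided by single coordinates on both sides. The topologies agree
      because each \<open>N\<close> contains the kernel of some \<open>g i\<close> and each such
      kernel is itself one of the \<open>N\<close>.\<close>
    show "openin (ftop Q.L) (\<alpha> ` U) \<longleftrightarrow> openin (ftop F) U"
    proof
      assume op: "openin (ftop Q.L) (\<alpha> ` U)"
      have "\<exists>i\<in>I. \<forall>x\<in>S. g i x = g i y \<longrightarrow> x \<in> U" if y: "y \<in> U" for y
      proof -
        have yS: "y \<in> S" using y U ..
        have "\<exists>N\<in>OSC. \<forall>x\<in>?lim. x N = \<alpha> y N \<longrightarrow> x \<in> \<alpha> ` U"
          using op[unfolded Q.openin_inverse_limit, THEN conjunct2] imageI[OF y] by (rule bspec)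
        then obtain N where N: "N \<in> OSC" and NU: "\<forall>x\<in>?lim. x N = \<alpha> y N \<longrightarrow> x \<in> \<alpha> ` U" ..
        obtain i where i: "i \<in> I" "\<And>x y. \<lbrakk>x \<in> S; y \<in> S; g i x = g i y\<rbrakk> \<Longrightarrow> x \<cdot> inv_S y \<in> N"
          by (rule OSC_contains_kernel[OF N]) blast
        have "x \<in> U" if x: "x \<in> S" "g i x = g i y" for x
        proof -
          have "\<alpha> x N = \<alpha> y N" using \<alpha>N[OF N] coset_eq[OF N x(1) yS] i(2)[OF x(1) yS x(2)] by simp
          then have "\<alpha> x \<in> \<alpha> ` U" using bspec[OF NU \<alpha>_lim[OF x(1)]] by simp
          then show ?thesis using inj_on_image_mem_iff[OF inj x(1) U] by blast
        qed
        then show ?thesis using i(1) by blast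
      qed
      with U show "openin (ftop F) U" unfolding open_iff by blast
    next
      assume op: "openin (ftop F) U"
      show "openin (ftop Q.L) (\<alpha> ` U)"
        unfolding Q.openin_inverse_limit
      proof (intro conjI ballI)
        show "\<alpha> ` U \<subseteq> ?lim" using \<alpha>_lim U by blast
        fix z assume "z \<in> \<alpha> ` U"
        then obtain y where y: "y \<in> U" "z = \<alpha> y" ..
        have yS: "y \<in> S" using y(1) U ..
        obtain i where i: "i \<in> I" "\<And>x. x \<in> S \<Longrightarrow> g i x = g i y \<Longrightarrow> x \<in> U"
          using op y(1) unfolding open_iff by blast
        have "w \<in> \<alpha> ` U" if w: "w \<in> ?lim" "w (kernel_g i) = z (kernel_g i)" for w
        proof -
          obtain x where x: "x \<in> S" "w = \<alpha> x" using surj[OF w(1)] by blast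
          then show ?thesis using i(2)[OF x(1)] kernel_eq[OF i(1) x(1) yS] w(2) y(2) by blast
        qed
        then show "\<exists>N\<in>OSC. \<forall>x\<in>?lim. x N = z N \<longrightarrow> x \<in> \<alpha> ` U" using kernel_g_OSC[OF i(1)] by blast
      qed
    qed
  next
    fix P R \<chi> assume P: "P \<in> objs F" and R: "R \<in> objs F"
    have im: "(\<lambda>x. x N) ` \<alpha> ` T = (\<lambda>x. N #>\<^bsub>fgrp F\<^esub> x) ` T" if "N \<in> OSC" for N T
      unfolding image_image using \<alpha>N[OF that] by simp
    show "\<chi> \<in> fhom Q.L (\<alpha> ` P) (\<alpha> ` R) \<longleftrightarrow>
      \<chi> \<in> extensional (\<alpha> ` P) \<and> (\<exists>\<phi>\<in>fhom F P R. \<forall>u\<in>P. \<chi> (\<alpha> u) = \<alpha> (\<phi> u))" (is "?l \<longleftrightarrow> ?r")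
    proof
      assume ?l
      then obtain c where c: "c \<in> lim_families OSC (\<lambda>N M. M \<subseteq> N) (fusion_quotient F) (fusion_quotient_map F) (\<alpha> ` P) (\<alpha> ` R)"
        "\<chi> = (\<lambda>x\<in>\<alpha> ` P. \<lambda>N\<in>OSC. c N (x N))"
        unfolding inverse_limit_def fusion_data.simps by blast
      have c_hom: "c N \<in> fhom (fusion_quotient F N) ((\<lambda>x. N #>\<^bsub>fgrp F\<^esub> x) ` P) ((\<lambda>x. N #>\<^bsub>fgrp F\<^esub> x) ` R)"
        if N: "N \<in> OSC" for N
        using c(1) N PiE_mem[of c OSC _ N] unfolding lim_families_def im[OF N, symmetric] by blast
      have c_compat: "fusion_quotient_map F N M (c M (\<alpha> u M)) = c N (\<alpha> u N)"
        if NM: "N \<in> OSC" "M \<in> OSC" "M \<subseteq> N" and u: "u \<in> P" for N M u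
      proof -
        have "fusion_quotient_map F N M (c M (\<alpha> u M)) = c N (fusion_quotient_map F N M (\<alpha> u M))"
          using c(1) NM u unfolding lim_families_def by blast
        then show ?thesis
          using Q.lim_carrier_compat[OF \<alpha>_lim[OF objs_mem[OF P u]] NM] by simp
      qed
      have c_mem: "c N (\<alpha> u N) \<in> carrier (fgrp (fusion_quotient F N))" if N: "N \<in> OSC" and u: "u \<in> P" for N u
      proof -
        interpret N: quotient_fusion F N p using quotient_fusion_open[OF N] .
        have "c N ` N.coset_N ` P \<subseteq> N.coset_N ` R"
          using N.fhom_FN_iff[OF N.coset_image_objs[OF P] N.coset_image_objs[OF R], THEN iffD1, OF c_hom[OF N]] by blast
        then show ?thesis unfolding \<alpha>N[OF N] N.carrier_FN using u objs_subset[OF R] by blast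
      qed
      have \<chi>u: "\<chi> (\<alpha> u) = (\<lambda>N\<in>OSC. c N (\<alpha> u N))" if "u \<in> P" for u using that by (simp add: c(2))
      have "\<chi> (\<alpha> u) \<in> ?lim" if u: "u \<in> P" for u
        unfolding \<chi>u[OF u] lim_carrier_def using c_compat c_mem u by auto
      \<comment> \<open>A compatible family sends each \<open>\<alpha> u\<close> to a point of the
        limit, which \<open>surj\<close> turns back into an element of \<open>S\<close>. The
        resulting map has the morphisms \<open>c N\<close> as its components in the
        quotients.\<close>
      then have "\<exists>\<phi>. \<forall>u\<in>P. \<phi> u \<in> S \<and> \<chi> (\<alpha> u) = \<alpha> (\<phi> u)"
        using surj by (intro bchoice) blast
      then obtain \<phi> where \<phi>: "\<And>u. u \<in> P \<Longrightarrow> \<phi> u \<in> S" "\<And>u. u \<in> P \<Longrightarrow> \<chi> (\<alpha> u) = \<alpha> (\<phi> u)" by blast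
      have "restrict \<phi> P \<in> fhom F P R"
      proof (rule fhom_of_quotients[OF P R restrict_extensional])
        show "restrict \<phi> P u \<in> S" if "u \<in> P" for u using \<phi>(1) that by simp
        fix N assume N: "N \<in> OSC"
        have "N #>\<^bsub>fgrp F\<^esub> restrict \<phi> P u = c N (N #>\<^bsub>fgrp F\<^esub> u)" if u: "u \<in> P" for u
        proof -
          have "\<alpha> (\<phi> u) N = c N (\<alpha> u N)" using \<phi>(2)[OF u] \<chi>u[OF u] N by (metis restrict_apply')
          then show ?thesis using u by (simp add: \<alpha>N[OF N])
        qed
        with c_hom[OF N] show "\<exists>\<chi>\<in>fhom (fusion_quotient F N) ((\<lambda>x. N #>\<^bsub>fgrp F\<^esub> x) ` P) ((\<lambda>x. N #>\<^bsub>fgrp F\<^esub> x) ` R).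
          \<forall>u\<in>P. N #>\<^bsub>fgrp F\<^esub> restrict \<phi> P u = \<chi> (N #>\<^bsub>fgrp F\<^esub> u)" by blast
      qed
      moreover have "\<chi> (\<alpha> u) = \<alpha> (restrict \<phi> P u)" if "u \<in> P" for u using \<phi>(2) that by simp
      moreover have "\<chi> \<in> extensional (\<alpha> ` P)" by (simp add: c(2))
      ultimately show ?r by blast
    next
      assume r: ?r
      then obtain \<phi> where \<phi>: "\<phi> \<in> fhom F P R" "\<And>u. u \<in> P \<Longrightarrow> \<chi> (\<alpha> u) = \<alpha> (\<phi> u)" by blast
      \<comment> \<open>Projecting a morphism of \<open>F\<close> to the quotients needs liftability
        modulo every \<open>N\<close>. The projections are chosen separately; their compatibility
        follows from their common origin \<open>\<phi>\<close>.\<close>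
      have "\<exists>c. \<forall>N\<in>OSC. c N \<in> fhom (fusion_quotient F N) ((\<lambda>x. N #>\<^bsub>fgrp F\<^esub> x) ` P) ((\<lambda>x. N #>\<^bsub>fgrp F\<^esub> x) ` R) \<and>
        (\<forall>u\<in>P. N #>\<^bsub>fgrp F\<^esub> \<phi> u = c N (N #>\<^bsub>fgrp F\<^esub> u))"
      proof (rule bchoice, rule ballI)
        fix N assume N: "N \<in> OSC"
        from quotient_fusion.quotient_lift[OF quotient_fusion_open[OF N] P R \<phi>(1) fhom_lifts[OF N P R \<phi>(1)]]
        show "\<exists>\<chi>. \<chi> \<in> fhom (fusion_quotient F N) ((\<lambda>x. N #>\<^bsub>fgrp F\<^esub> x) ` P) ((\<lambda>x. N #>\<^bsub>fgrp F\<^esub> x) ` R) \<and>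
          (\<forall>u\<in>P. N #>\<^bsub>fgrp F\<^esub> \<phi> u = \<chi> (N #>\<^bsub>fgrp F\<^esub> u))" by blast
      qed
      then obtain c where c: "\<And>N. N \<in> OSC \<Longrightarrow> c N \<in> fhom (fusion_quotient F N) ((\<lambda>x. N #>\<^bsub>fgrp F\<^esub> x) ` P) ((\<lambda>x. N #>\<^bsub>fgrp F\<^esub> x) ` R)"
        "\<And>N u. N \<in> OSC \<Longrightarrow> u \<in> P \<Longrightarrow> c N (N #>\<^bsub>fgrp F\<^esub> u) = N #>\<^bsub>fgrp F\<^esub> \<phi> u" by metis
      have \<phi>S: "\<phi> u \<in> S" if "u \<in> P" for u using fhom_memS[OF P R \<phi>(1) that] .
      have "restrict c OSC \<in> lim_families OSC (\<lambda>N M. M \<subseteq> N) (fusion_quotient F) (fusion_quotient_map F) (\<alpha> ` P) (\<alpha> ` R)"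
        unfolding lim_families_def
      proof (intro CollectI conjI ballI impI restrict_PiE_iff[THEN iffD2])
        show "c N \<in> fhom (fusion_quotient F N) ((\<lambda>x. x N) ` \<alpha> ` P) ((\<lambda>x. x N) ` \<alpha> ` R)" if N: "N \<in> OSC" for N
          unfolding im[OF N] using c(1)[OF N] .
        fix N M w assume NM: "N \<in> OSC" "M \<in> OSC" "M \<subseteq> N" and "w \<in> (\<lambda>x. x M) ` \<alpha> ` P"
        then obtain u where u: "u \<in> P" "w = M #>\<^bsub>fgrp F\<^esub> u" unfolding im[OF NM(2)] by blast
        show "fusion_quotient_map F N M (restrict c OSC M w) = restrict c OSC N (fusion_quotient_map F N M w)"
          using NM(1,2) u c(2)[OF NM(1) u(1)] c(2)[OF NM(2) u(1)] quotient_map_coset[OF NM \<phi>S[OF u(1)]]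
            quotient_map_coset[OF NM objs_mem[OF P u(1)]] by simp
      qed
      moreover have "\<chi> = (\<lambda>x\<in>\<alpha> ` P. \<lambda>N\<in>OSC. restrict c OSC N (x N))"
      proof (rule extensionalityI[of _ "\<alpha> ` P"])
        show "\<chi> \<in> extensional (\<alpha> ` P)" using r by blast
        fix v assume "v \<in> \<alpha> ` P"
        then obtain u where u: "u \<in> P" "v = \<alpha> u" ..
        have "\<chi> v = (\<lambda>N\<in>OSC. N #>\<^bsub>fgrp F\<^esub> \<phi> u)" using u \<phi>(2) by (simp add: \<alpha>_def)
        also have "\<dots> = (\<lambda>N\<in>OSC. restrict c OSC N (v N))"
          using c(2)[OF _ u(1)] u(2) by (intro restrict_ext) (simp add: \<alpha>N)
        finally show "\<chi> v = (\<lambda>x\<in>\<alpha> ` P. \<lambda>N\<in>OSC. restrict c OSC N (x N)) v" using u by simp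
      qed simp
      ultimately show ?l unfolding inverse_limit_def fusion_data.simps by blast
    qed
  qed
qed

end

text \<open>\<open>inverse_limit\<close> is defined for arbitrary data, so it is part of the claim
  that the quotients and the natural maps form an inverse system of fusion systems.\<close>

theorem proposition4p5:
  fixes p :: nat and F :: "'a fusion_data"
  assumes "prime p" and "pro_saturated TYPE('i) TYPE('g) p F"
  shows "inverse_system p (open_strongly_closed F) (\<lambda>N M. M \<subseteq> N) (fusion_quotient F) (fusion_quotient_map F) \<and>
    F \<cong>\<^sub>f inverse_limit (open_strongly_closed F) (\<lambda>N M. M \<subseteq> N) (fusion_quotient F) (fusion_quotient_map F)"
proof -
  have F: "fusion_category F" using assms(2) by (simp add: pro_saturated_def pro_fusion_system_def)
  obtain I :: "'i set" and rel and Fs :: "'i \<Rightarrow> 'g fusion_data" and f where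
    inv: "inverse_system p I rel Fs f" and sat: "\<forall>i\<in>I. saturated p (Fs i)" and iso: "F \<cong>\<^sub>f inverse_limit I rel Fs f"
    using assms(2) unfolding pro_saturated_def by blast
  obtain g where "pro_fusion F p I rel Fs f g" using isomorphic_pro_fusion[OF F inv iso] by blast
  then interpret pro_saturated_fusion F p I rel Fs f g
    using assms(1) sat by (simp add: pro_saturated_fusion_def pro_saturated_fusion_axioms_def)
  show ?thesis using quotient_system quotient_limit ..
qed

end
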